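(* Let $d\in\{1,2,\dots\}$, $p\in[1,\infty)$, and let $w$ be a weight on $\mathbb{R}^d$ with $\mu(dx)=w\,dx$ and $\varphi=w^{1/p}$. Assume condition (Diff). If $p=1$, assume additionally that $\nabla\varphi\in L^\infty_{\mathrm{loc}}(dx;\mathbb{R}^d)$. Then $C_0^\infty(\mathbb{R}^d)$ is dense in $V^{1,p}(\mu)$ (with respect to the norm $\|\cdot\|_{1,p,\mu}$), and, in particular, \[H^{1,p}(\mu)=V^{1,p}(\mu).\]
   Context: A weight is a measurable function $w\in L^1_{\mathrm{loc}}(\mathbb{R}^d)$ with $w\ge 0$ a.e.; $\mu(dx):=w\,dx$, $\varphi:=w^{1/p}$, $q:=p/(p-1)$ ($q=\infty$ if $p=1$). $C_0^\infty(\mathbb{R}^d)$ denotes smooth functions with compact support. Condition (Diff): $\varphi\in W^{1,p}_{\mathrm{loc}}(dx)$ and $\beta:=p\,\frac{\nabla\varphi}{\varphi}\in L^q_{\mathrm{loc}}(\mu;\mathbb{R}^d)$, where $\nabla$ is the weak gradient and $\beta:=0$ on $\{\varphi=0\}$. Under (Diff), $V^{1,p}(\mu)$ is the set of all $\mu$-classes of functions $f\in L^p(\mu)$ for which there is a (necessarily unique) gradient $\nabla^\mu f=(\partial_1^\mu f,\dots,\partial_d^\mu f)\in L^p(\mu;\mathbb{R}^d)$ such that \[\int\partial_i^\mu f\,\eta\,d\mu=-\int f\,\partial_i\eta\,d\mu-\int f\,\eta\,\beta_i\,d\mu\] for all $i\in\{1,\dots,d\}$ and all $\eta\in C_0^\infty(\mathbb{R}^d)$.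 It is normed by $\|f\|_{1,p,\mu}:=\big(\|\nabla^\mu f\|_{L^p(\mu;\mathbb{R}^d)}^p+\|f\|_{L^p(\mu)}^p\big)^{1/p}$. Every $f\in C_0^\infty(\mathbb{R}^d)$ belongs to $V^{1,p}(\mu)$ with $\nabla^\mu f=\nabla f$ $\mu$-a.e. $H^{1,p}(\mu)$ is the completion of $C_0^\infty(\mathbb{R}^d)$ with respect to $\big(\|\nabla\cdot\|_{L^p(\mu;\mathbb{R}^d)}^p+\|\cdot\|_{L^p(\mu)}^p\big)^{1/p}$. Under (Diff) this is a space of $\mu$-classes: it is identified with the set of $u\in L^p(\mu)$ for which there are $u_n\in C_0^\infty(\mathbb{R}^d)$ with $u_n\to u$ in $L^p(\mu)$ and $(\nabla u_n)$ Cauchy in $L^p(\mu;\mathbb{R}^d)$, the gradient of $u$ being the limit of $\nabla u_n$. *)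

theory Defs
  imports "HOL-Analysis.Analysis"
begin

text \<open>Euclidean space of dimension \<open>d\<close> is \<open>real ^ 'n\<close> with \<open>d = CARD('n)\<close>. Measurability
  is with respect to the Lebesgue sigma-algebra. Spaces of classes are represented by sets of
  functions that are closed under changing a function (measurably) on a null set.\<close>

subsection \<open>Smooth functions with compact support\<close>

primrec C_k :: "nat \<Rightarrow> ('a::real_normed_vector \<Rightarrow> real) \<Rightarrow> bool" where
  "C_k 0 f \<longleftrightarrow> continuous_on UNIV f"
| "C_k (Suc k) f \<longleftrightarrow> (\<forall>x. f differentiable (at x)) \<and>
     (\<forall>v. C_k k (\<lambda>x. frechet_derivative f (at x) v))"

definition C0_infty :: "('a::real_normed_vector \<Rightarrow> real) set" where
  "C0_infty = {f. (\<forall>k. C_k k f) \<and> compact (closure {x. f x \<noteq> 0})}"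

definition partial :: "'n::finite \<Rightarrow> (real ^ 'n \<Rightarrow> real) \<Rightarrow> real ^ 'n \<Rightarrow> real" where
  "partial i f x = frechet_derivative f (at x) (axis i 1)"

definition grad :: "(real ^ 'n \<Rightarrow> real) \<Rightarrow> real ^ 'n \<Rightarrow> real ^ 'n::finite" where
  "grad f x = (\<chi> i. partial i f x)"

subsection \<open>Lebesgue spaces\<close>

definition Lp :: "real \<Rightarrow> 'a measure \<Rightarrow> ('a \<Rightarrow> 'b::euclidean_space) set" where
  "Lp p M = {f \<in> borel_measurable M. integrable M (\<lambda>x. norm (f x) powr p)}"

definition Lp_norm :: "real \<Rightarrow> 'a measure \<Rightarrow> ('a \<Rightarrow> 'b::euclidean_space) \<Rightarrow> real" where
  "Lp_norm p M f = (\<integral>x. norm (f x) powr p \<partial>M) powr (1 / p)"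

definition Lp_loc ::
  "real \<Rightarrow> 'a::euclidean_space measure \<Rightarrow> ('a \<Rightarrow> 'b::euclidean_space) set" where
  "Lp_loc p M = {f \<in> borel_measurable M.
     \<forall>K. compact K \<longrightarrow> set_integrable M K (\<lambda>x. norm (f x) powr p)}"

definition Linfty_loc ::
  "'a::euclidean_space measure \<Rightarrow> ('a \<Rightarrow> 'b::euclidean_space) set" where
  "Linfty_loc M = {f \<in> borel_measurable M.
     \<forall>K. compact K \<longrightarrow> (\<exists>C. AE x in M. x \<in> K \<longrightarrow> norm (f x) \<le> C)}"

text \<open>The local space for the exponent \<open>q = p / (p - 1)\<close> conjugate to \<open>p\<close>,
  with \<open>q = \<infinity>\<close> if \<open>p = 1\<close>.\<close>

definition Lconj_loc ::
  "real \<Rightarrow> 'a::euclidean_space measure \<Rightarrow> ('a \<Rightarrow> 'b::euclidean_space) set" where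
  "Lconj_loc p M = (if p = 1 then Linfty_loc M else Lp_loc (p / (p - 1)) M)"

subsection \<open>Weak gradients\<close>

definition has_weak_gradient ::
  "(real ^ 'n \<Rightarrow> real) \<Rightarrow> (real ^ 'n \<Rightarrow> real ^ 'n::finite) \<Rightarrow> bool" where
  "has_weak_gradient f g \<longleftrightarrow>
     f \<in> Lp_loc 1 lebesgue \<and> g \<in> Lp_loc 1 lebesgue \<and>
     (\<forall>i. \<forall>\<eta>\<in>C0_infty. (\<integral>x. f x * partial i \<eta> x \<partial>lebesgue) = - (\<integral>x. g x $ i * \<eta> x \<partial>lebesgue))"

text \<open>Weak gradients are unique up to null sets; the choice fixes a representative. The same
  remark applies to \<open>mu_gradient\<close> and \<open>H_gradient\<close> below, under the condition \<open>Diff_cond\<close>.\<close>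

definition weak_gradient :: "(real ^ 'n \<Rightarrow> real) \<Rightarrow> real ^ 'n \<Rightarrow> real ^ 'n::finite" where
  "weak_gradient f = (SOME g. has_weak_gradient f g)"

definition W1p_loc :: "real \<Rightarrow> (real ^ 'n::finite \<Rightarrow> real) set" where
  "W1p_loc p = {f \<in> Lp_loc p lebesgue.
     (\<exists>g. has_weak_gradient f g) \<and> weak_gradient f \<in> Lp_loc p lebesgue}"

subsection \<open>Weights and the condition (Diff)\<close>

definition weight :: "(real ^ 'n::finite \<Rightarrow> real) \<Rightarrow> bool" where
  "weight w \<longleftrightarrow> w \<in> Lp_loc 1 lebesgue \<and> (AE x in lebesgue. 0 \<le> w x)"

definition mu :: "(real ^ 'n::finite \<Rightarrow> real) \<Rightarrow> (real ^ 'n) measure" where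
  "mu w = density lebesgue (\<lambda>x. ennreal (w x))"

definition phi :: "real \<Rightarrow> (real ^ 'n::finite \<Rightarrow> real) \<Rightarrow> real ^ 'n \<Rightarrow> real" where
  "phi p w x = w x powr (1 / p)"

definition beta :: "real \<Rightarrow> (real ^ 'n::finite \<Rightarrow> real) \<Rightarrow> real ^ 'n \<Rightarrow> real ^ 'n" where
  "beta p w x = (if phi p w x = 0 then 0
     else p *\<^sub>R (weak_gradient (phi p w) x /\<^sub>R phi p w x))"

definition Diff_cond :: "real \<Rightarrow> (real ^ 'n::finite \<Rightarrow> real) \<Rightarrow> bool" where
  "Diff_cond p w \<longleftrightarrow> phi p w \<in> W1p_loc p \<and> beta p w \<in> Lconj_loc p (mu w)"

subsection \<open>The space V\<close>

definition has_mu_gradient ::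
  "real \<Rightarrow> (real ^ 'n \<Rightarrow> real) \<Rightarrow> (real ^ 'n \<Rightarrow> real) \<Rightarrow> (real ^ 'n \<Rightarrow> real ^ 'n::finite) \<Rightarrow> bool"
  where
  "has_mu_gradient p w f g \<longleftrightarrow> g \<in> Lp p (mu w) \<and>
     (\<forall>i. \<forall>\<eta>\<in>C0_infty.
        (\<integral>x. g x $ i * \<eta> x \<partial>mu w) =
          - (\<integral>x. f x * partial i \<eta> x \<partial>mu w) - (\<integral>x. f x * \<eta> x * beta p w x $ i \<partial>mu w))"

definition V1p :: "real \<Rightarrow> (real ^ 'n::finite \<Rightarrow> real) \<Rightarrow> (real ^ 'n \<Rightarrow> real) set" where
  "V1p p w = {f \<in> Lp p (mu w). \<exists>g. has_mu_gradient p w f g}"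

definition mu_gradient ::
  "real \<Rightarrow> (real ^ 'n \<Rightarrow> real) \<Rightarrow> (real ^ 'n \<Rightarrow> real) \<Rightarrow> real ^ 'n \<Rightarrow> real ^ 'n::finite" where
  "mu_gradient p w f = (SOME g. has_mu_gradient p w f g)"

definition V_norm :: "real \<Rightarrow> (real ^ 'n::finite \<Rightarrow> real) \<Rightarrow> (real ^ 'n \<Rightarrow> real) \<Rightarrow> real" where
  "V_norm p w f =
     (Lp_norm p (mu w) (mu_gradient p w f) powr p + Lp_norm p (mu w) f powr p) powr (1 / p)"

subsection \<open>The space H\<close>

text \<open>The completion of the test functions, realised inside \<open>Lp p (mu w)\<close>.\<close>

definition H1p :: "real \<Rightarrow> (real ^ 'n::finite \<Rightarrow> real) \<Rightarrow> (real ^ 'n \<Rightarrow> real) set" where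
  "H1p p w = {u \<in> Lp p (mu w). \<exists>U :: nat \<Rightarrow> real ^ 'n \<Rightarrow> real.
     (\<forall>n. U n \<in> C0_infty) \<and>
     (\<lambda>n. Lp_norm p (mu w) (\<lambda>x. U n x - u x)) \<longlonglongrightarrow> 0 \<and>
     (\<forall>e>0. \<exists>N. \<forall>m\<ge>N. \<forall>n\<ge>N. Lp_norm p (mu w) (\<lambda>x. grad (U m) x - grad (U n) x) < e)}"

definition has_H_gradient ::
  "real \<Rightarrow> (real ^ 'n \<Rightarrow> real) \<Rightarrow> (real ^ 'n \<Rightarrow> real) \<Rightarrow> (real ^ 'n \<Rightarrow> real ^ 'n::finite) \<Rightarrow> bool"
  where
  "has_H_gradient p w u g \<longleftrightarrow> g \<in> Lp p (mu w) \<and> (\<exists>U :: nat \<Rightarrow> real ^ 'n \<Rightarrow> real.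
     (\<forall>n. U n \<in> C0_infty) \<and>
     (\<lambda>n. Lp_norm p (mu w) (\<lambda>x. U n x - u x)) \<longlonglongrightarrow> 0 \<and>
     (\<lambda>n. Lp_norm p (mu w) (\<lambda>x. grad (U n) x - g x)) \<longlonglongrightarrow> 0)"

definition H_gradient ::
  "real \<Rightarrow> (real ^ 'n \<Rightarrow> real) \<Rightarrow> (real ^ 'n \<Rightarrow> real) \<Rightarrow> real ^ 'n \<Rightarrow> real ^ 'n::finite" where
  "H_gradient p w u = (SOME g. has_H_gradient p w u g)"

end

theory Submission
  imports Defs
begin

text \<open>
  Write \<open>\<phi> = w\<^sup>1\<^sup>/\<^sup>p\<close>, so that \<open>\<parallel>f\<parallel>\<close> in \<open>L\<^sup>p(\<mu>)\<close> is the norm of \<open>f \<phi>\<close> in \<open>L\<^sup>p(dx)\<close>. After truncation and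
  multiplication by a cut-off function it suffices to approximate a bounded \<open>f\<close> with compact
  support that vanishes on \<open>{\<phi> = 0}\<close>. Although \<open>w\<close> need not be doubling or a Muckenhoupt weight, the
  mollified functions \<open>f * \<rho>\<^sub>n\<close> converge to \<open>f\<close> in the weighted norm along a subsequence. For
  \<open>\<phi> (f * \<rho>\<^sub>n)\<close> this is dominated convergence, as \<open>f\<close> is bounded. For the derivatives, write
  \<open>\<phi>(x) \<partial>\<^sub>i(f * \<rho>\<^sub>n)(x) = ((\<phi> f) * \<partial>\<^sub>i\<rho>\<^sub>n)(x) + \<integral> (\<phi>(x) - \<phi>(x - y)) f(x - y) \<partial>\<^sub>i\<rho>\<^sub>n(y) dy\<close>.
  The first term is \<open>(\<partial>\<^sub>i(\<phi> f)) * \<rho>\<^sub>n\<close>, which tends to \<open>\<partial>\<^sub>i(\<phi> f) = \<phi> \<partial>\<^sub>i\<^sup>\<mu> f + f \<partial>\<^sub>i\<phi>\<close> in \<open>L\<^sup>p(dx)\<close>. In the second,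
  \<open>\<phi>(x) - \<phi>(x - y)\<close> may be replaced by \<open>y \<bullet> \<nabla>\<phi>(x)\<close>: the error is \<open>o(1/n)\<close> in \<open>L\<^sup>p\<close> for \<open>|y| \<le> 1/n\<close>, by
  continuity of translations applied to \<open>\<nabla>\<phi>\<close> (\<open>pow_int_taylor\<close>), while \<open>\<partial>\<^sub>i\<rho>\<^sub>n\<close> has \<open>L\<^sup>1\<close> norm \<open>O(n)\<close>.
  What remains is \<open>\<Sum>\<^sub>j \<partial>\<^sub>j\<phi>(x) \<integral> y\<^sub>j f(x - y) \<partial>\<^sub>i\<rho>\<^sub>n(y) dy\<close>, and this tends to \<open>- f \<partial>\<^sub>i\<phi>\<close> because
  \<open>\<integral> y\<^sub>j \<partial>\<^sub>i\<rho> dy = - \<delta>\<^sub>i\<^sub>j\<close>. The terms \<open>f \<partial>\<^sub>i\<phi>\<close> cancel. This is the lemma \<open>mollify\<close>.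

  It uses that \<open>\<phi> f\<close> is weakly differentiable with the product rule as expected. The definition of
  \<open>V\<close> provides this for \<open>w f = \<phi>\<^sup>p f\<close> only (\<open>mu_gradient_iff_wder\<close>), and \<open>\<phi>\<close> may have zeros; the division by
  \<open>\<phi>\<^sup>p\<^sup>-\<^sup>1\<close> is carried out for truncations of \<open>f\<close> by a regularised chain rule (\<open>truncated_wder\<close>, from
  \<open>wder_chain\<close>). That test functions belong to \<open>V\<close> amounts to the weak differentiability of \<open>\<phi>\<^sup>p\<close>
  (\<open>wder_powr\<close>).

  Density gives \<open>V \<subseteq> H\<close>. Conversely, for a sequence of test functions as in the definition of \<open>H\<close> the
  gradients have a limit in \<open>L\<^sup>p(\<mu>)\<close> (\<open>pow_int_complete\<close>), and each term of the identity that defines the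
  gradient in \<open>V\<close> is continuous on \<open>L\<^sup>p(\<mu>)\<close> (\<open>dual_limit\<close>), so the limit is the gradient in \<open>V\<close>
  (\<open>limit_mu_gradient\<close>). Gradients in \<open>V\<close> are unique almost everywhere (\<open>mu_gradient_unique\<close>).

  The analysis is done for Borel functions and \<open>lborel\<close>, one partial derivative at a time; the locale
  \<open>diff_weight\<close> transfers it to Lebesgue measurable functions and the measure \<open>mu w\<close> through Borel
  representatives.
\<close>

section \<open>Smooth functions\<close>

text \<open>Functions that are differentiable arbitrarily often.\<close>

definition smooth :: "('a::real_normed_vector \<Rightarrow> real) \<Rightarrow> bool" where
  "smooth f \<longleftrightarrow> (\<forall>k. C_k k f)"

lemma C_k_SucI:
  assumes "\<And>x. (f has_derivative D x) (at x)" "\<And>v. C_k k (\<lambda>x. D x v)"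
  shows "C_k (Suc k) f"
proof -
  have "frechet_derivative f (at x) = D x" for x
    using frechet_derivative_at[OF assms(1)[of x]] by simp
  then show ?thesis using assms by (auto simp: differentiable_def)
qed

lemma C_k_SucD: "C_k (Suc k) f \<Longrightarrow> C_k k f"
proof (induction k arbitrary: f)
  case 0
  then show ?case
    by (auto intro!: differentiable_imp_continuous_on simp: differentiable_on_def)
next
  case (Suc k)
  have "f differentiable at x" "C_k (Suc k) (\<lambda>x. frechet_derivative f (at x) v)" for x v
    using Suc.prems C_k.simps(2)[of "Suc k" f] by blast+
  with Suc.IH show ?case using C_k.simps(2)[of k f] by blast
qed

lemma C_k_has_derivative:
  "C_k (Suc k) f \<Longrightarrow> (f has_derivative frechet_derivative f (at x)) (at x)"
  by (simp add: frechet_derivative_works[symmetric])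

lemma C_k_const: "C_k k (\<lambda>x. c)"
proof (induction k arbitrary: c)
  case (Suc k)
  show ?case by (rule C_k_SucI[where D="\<lambda>x v. 0"]) (auto simp: Suc)
qed simp

lemma C_k_add: "C_k k f \<Longrightarrow> C_k k g \<Longrightarrow> C_k k (\<lambda>x. f x + g x)"
proof (induction k arbitrary: f g)
  case 0 then show ?case by (auto intro: continuous_intros)
next
  case (Suc k)
  show ?case
    by (rule C_k_SucI, rule has_derivative_add[OF C_k_has_derivative[OF Suc.prems(1)] C_k_has_derivative[OF Suc.prems(2)]])
       (use Suc in auto)
qed

lemma C_k_mult: "C_k k f \<Longrightarrow> C_k k g \<Longrightarrow> C_k k (\<lambda>x. f x * g x)"
proof (induction k arbitrary: f g)
  case 0 then show ?case by (auto intro: continuous_intros)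
next
  case (Suc k)
  show ?case
    by (rule C_k_SucI, rule has_derivative_mult[OF C_k_has_derivative[OF Suc.prems(1)] C_k_has_derivative[OF Suc.prems(2)]])
       (use Suc C_k_SucD[OF Suc.prems(1)] C_k_SucD[OF Suc.prems(2)] in \<open>auto intro!: C_k_add\<close>)
qed

lemma C_k_compose_affine:
  "bounded_linear L \<Longrightarrow> C_k k f \<Longrightarrow> C_k k (\<lambda>x. f (L x + b))"
proof (induction k arbitrary: f)
  case 0
  then have "continuous_on UNIV (\<lambda>x. L x + b)"
    by (intro continuous_intros linear_continuous_on)
  with 0 show ?case by (auto intro: continuous_on_compose2[of UNIV f])
next
  case (Suc k)
  have D: "((\<lambda>x. f (L x + b)) has_derivative (\<lambda>v. frechet_derivative f (at (L x + b)) (L v))) (at x)" for x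
    by (rule has_derivative_compose[OF _ C_k_has_derivative[OF Suc.prems(2)]])
       (auto intro!: derivative_eq_intros bounded_linear_imp_has_derivative Suc.prems(1))
  show ?case
    by (rule C_k_SucI, rule D) (use Suc in auto)
qed

lemma smoothI:
  assumes "\<And>x. (f has_derivative D x) (at x)" "\<And>v. smooth (\<lambda>x. D x v)"
  shows "smooth f"
  unfolding smooth_def
proof
  fix k show "C_k k f"
    by (rule C_k_SucD, rule C_k_SucI, rule assms(1)) (use assms(2) in \<open>auto simp: smooth_def\<close>)
qed

lemma smooth_const: "smooth (\<lambda>x. c)"
  and smooth_add: "smooth f \<Longrightarrow> smooth g \<Longrightarrow> smooth (\<lambda>x. f x + g x)"
  and smooth_mult: "smooth f \<Longrightarrow> smooth g \<Longrightarrow> smooth (\<lambda>x. f x * g x)"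
  and smooth_compose_affine: "bounded_linear L \<Longrightarrow> smooth f \<Longrightarrow> smooth (\<lambda>x. f (L x + b))"
  by (auto simp: smooth_def C_k_const C_k_add C_k_mult C_k_compose_affine)

lemma smooth_prod: "finite A \<Longrightarrow> (\<And>i. i \<in> A \<Longrightarrow> smooth (f i)) \<Longrightarrow> smooth (\<lambda>x. \<Prod>i\<in>A. f i x)"
  by (induction A rule: finite_induct) (auto simp: smooth_const intro!: smooth_mult)

lemma smooth_has_derivative: "smooth f \<Longrightarrow> (f has_derivative frechet_derivative f (at x)) (at x)"
  using C_k_has_derivative[of 0 f x] unfolding smooth_def by blast

lemma smooth_frechet_derivative: "smooth f \<Longrightarrow> smooth (\<lambda>x. frechet_derivative f (at x) v)"
  unfolding smooth_def using C_k.simps(2)[of _ f] by blast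

lemma smooth_continuous: "smooth f \<Longrightarrow> continuous_on UNIV f"
  unfolding smooth_def using C_k.simps(1)[of f] by blast

lemma smooth_coord: "smooth (\<lambda>x::real^'n. x $ i)"
proof (rule smoothI)
  show "((\<lambda>x::real^'n. x $ i) has_derivative (\<lambda>v. v $ i)) (at x)" for x
    by (rule bounded_linear_imp_has_derivative[OF bounded_linear_vec_nth])
qed (rule smooth_const)

subsection \<open>A bump function\<close>

text \<open>The functions \<open>t\<^sup>-\<^sup>n exp(- 1/t)\<close>, extended by \<open>0\<close> to \<open>t \<le> 0\<close>. Their linear span is closed under
  differentiation, so all of them are smooth.\<close>

definition flat :: "nat \<Rightarrow> real \<Rightarrow> real" where
  "flat n t = (if t > 0 then inverse t ^ n * exp (- inverse t) else 0)"

lemma flat_tendsto_0: "(flat n \<longlongrightarrow> 0) (at 0)"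
proof -
  have "((\<lambda>t. inverse t ^ n / exp (inverse t)) \<longlongrightarrow> 0) (at_right (0::real))"
    by (rule filterlim_compose[OF tendsto_power_div_exp_0 filterlim_inverse_at_top_right])
  then have "(flat n \<longlongrightarrow> 0) (at_right 0)"
    by (rule Lim_transform_eventually)
       (auto simp: flat_def eventually_at_filter exp_minus field_simps)
  moreover have "(flat n \<longlongrightarrow> 0) (at_left 0)"
    by (rule Lim_transform_eventually[of "\<lambda>_. 0"]) (auto simp: flat_def eventually_at_filter)
  ultimately show ?thesis
    using filterlim_split_at by blast
qed

lemma flat_deriv: "(flat n has_real_derivative flat (n+2) t - real n * flat (n+1) t) (at t)"
proof -
  consider "t > 0" | "t < 0" | "t = 0" by linarith
  then show ?thesis
  proof cases
    case 1
    have "((\<lambda>t. inverse t ^ n * exp (- inverse t)) has_real_derivative flat (n+2) t - real n * flat (n+1) t) (at t)"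
      using 1 by (auto intro!: derivative_eq_intros simp: flat_def field_simps power2_eq_square)
        (cases n; simp add: field_simps)
    then show ?thesis
      by (rule has_field_derivative_transform_within[where d=t])
         (use 1 in \<open>auto simp: flat_def dist_real_def\<close>)
  next
    case 2
    have "((\<lambda>t. 0) has_real_derivative flat (n+2) t - real n * flat (n+1) t) (at t)"
      using 2 by (auto simp: flat_def)
    then show ?thesis
      by (rule has_field_derivative_transform_within[where d="-t"])
         (use 2 in \<open>auto simp: flat_def dist_real_def\<close>)
  next
    case 3
    have "((\<lambda>h. (flat n (0 + h) - flat n 0) / h) \<longlongrightarrow> 0) (at 0)"
      by (rule Lim_transform_eventually[OF flat_tendsto_0[of "Suc n"]])
         (auto simp: flat_def eventually_at_filter field_simps)
    then show ?thesis unfolding DERIV_def using 3 by (simp add: flat_def)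
  qed
qed

lemma smooth_flat: "smooth (flat n)"
  unfolding smooth_def
proof
  fix k show "C_k k (flat n)"
  proof (induction k arbitrary: n)
    case 0
    show ?case using flat_deriv DERIV_isCont by (fastforce simp: continuous_on_eq_continuous_at)
  next
    case (Suc k)
    show ?case
    proof (rule C_k_SucI)
      show "(flat n has_derivative (\<lambda>v. (flat (n+2) x + (- real n) * flat (n+1) x) * v)) (at x)" for x
        using flat_deriv[of n x] by (simp add: has_field_derivative_def)
      show "C_k k (\<lambda>x. (flat (n+2) x + (- real n) * flat (n+1) x) * v)" for v
        by (intro C_k_mult C_k_add C_k_const Suc)
    qed
  qed
qed

text \<open>A nonnegative smooth function with support in the unit ball, the product of one-dimensional bump
  functions that live on \<open>[- 1/d, 1/d]\<close>. The factors \<open>1\<close> and \<open>- 1\<close> make each argument an affine function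
  of a coordinate.\<close>

definition bump :: "real ^ 'n::finite \<Rightarrow> real" where
  "bump x = (\<Prod>i\<in>UNIV. flat 0 (1 * (x $ i) + 1 / CARD('n)) * flat 0 ((- 1) * (x $ i) + 1 / CARD('n)))"

lemma smooth_bump: "smooth (bump :: real ^ 'n::finite \<Rightarrow> real)"
proof -
  have *: "smooth (\<lambda>x::real^'n. flat 0 (c * (x $ i) + b))" for c b i
    by (rule smooth_compose_affine[OF _ smooth_flat, of "\<lambda>x. c * x $ i"])
       (intro bounded_linear_const_mult bounded_linear_vec_nth)
  show ?thesis
    unfolding bump_def[abs_def] by (rule smooth_prod[OF finite], rule smooth_mult; rule *)
qed

lemma bump_nonneg: "bump x \<ge> 0"
  unfolding bump_def by (intro prod_nonneg) (auto simp: flat_def)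

lemma bump_0_pos: "bump 0 > 0"
  unfolding bump_def by (intro prod_pos) (auto simp: flat_def)

lemma bump_support: "norm x > 1 \<Longrightarrow> bump (x :: real ^ 'n::finite) = 0"
proof (rule ccontr)
  assume x: "norm x > 1" and "bump x \<noteq> 0"
  then have "\<bar>x $ i\<bar> < 1 / CARD('n)" for i
    by (auto simp: bump_def flat_def split: if_splits dest!: spec[of _ i])
  then have "(\<Sum>i\<in>UNIV. \<bar>x $ i\<bar>) \<le> (\<Sum>i\<in>(UNIV::'n set). 1 / CARD('n))"
    by (intro sum_mono) (simp add: less_imp_le)
  then show False using x norm_le_l1_cart[of x] by simp
qed

subsection \<open>Test functions\<close>

lemma C0_inftyI:
  fixes f :: "'a::euclidean_space \<Rightarrow> real"
  assumes "smooth f" "\<And>x. norm x > R \<Longrightarrow> f x = 0"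
  shows "f \<in> C0_infty"
proof -
  have "{x. f x \<noteq> 0} \<subseteq> cball 0 R" using assms(2) by force
  then show ?thesis using assms(1)
    by (auto simp: C0_infty_def smooth_def compact_closure intro: bounded_subset[OF bounded_cball])
qed

lemma C0_infty_smooth: "f \<in> C0_infty \<Longrightarrow> smooth f"
  by (simp add: C0_infty_def smooth_def)

lemma C0_infty_support:
  fixes f :: "'a::euclidean_space \<Rightarrow> real"
  assumes "f \<in> C0_infty"
  obtains R where "R > 0" "\<And>x. norm x > R \<Longrightarrow> f x = 0"
proof -
  have "bounded {x. f x \<noteq> 0}" using assms by (simp add: C0_infty_def)
  then obtain R where "R > 0" "\<forall>x\<in>{x. f x \<noteq> 0}. norm x \<le> R" using bounded_pos by blast
  then show ?thesis by (intro that[of R]) force+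
qed

lemma C0_infty_mult_smooth:
  "f \<in> C0_infty \<Longrightarrow> smooth g \<Longrightarrow> (\<lambda>x. f x * g x) \<in> C0_infty" for f :: "'a::euclidean_space \<Rightarrow> real"
  by (rule C0_infty_support, assumption, rule C0_inftyI) (auto intro: smooth_mult C0_infty_smooth)

lemma C0_infty_mult: "f \<in> C0_infty \<Longrightarrow> g \<in> C0_infty \<Longrightarrow> (\<lambda>x. f x * g x) \<in> C0_infty"
  for f :: "'a::euclidean_space \<Rightarrow> real"
  by (rule C0_infty_mult_smooth) (auto intro: C0_infty_smooth)

lemma C0_infty_compose_affine:
  fixes f :: "'a::euclidean_space \<Rightarrow> real"
  assumes "f \<in> C0_infty" "c \<noteq> 0"
  shows "(\<lambda>x. f (c *\<^sub>R x + b)) \<in> C0_infty"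
proof -
  obtain R where R: "R > 0" "\<And>x. norm x > R \<Longrightarrow> f x = 0" using C0_infty_support assms by blast
  show ?thesis
  proof (rule C0_inftyI)
    show "smooth (\<lambda>x. f (c *\<^sub>R x + b))"
      by (rule smooth_compose_affine) (auto intro: C0_infty_smooth assms bounded_linear_scaleR_right)
    fix x :: 'a assume "norm x > (R + norm b) / \<bar>c\<bar>"
    then have "norm (c *\<^sub>R x) > R + norm b" using assms(2) by (simp add: field_simps)
    then have "norm (c *\<^sub>R x + b) > R"
      using norm_triangle_ineq2[of "c *\<^sub>R x" "- b"] by simp
    then show "f (c *\<^sub>R x + b) = 0" by (rule R)
  qed
qed

lemma C0_infty_partial:
  assumes "f \<in> C0_infty"
  shows "partial i f \<in> C0_infty"
proof -
  obtain R where R: "R > 0" "\<And>x. norm x > R \<Longrightarrow> f x = 0" using C0_infty_support assms by blast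
  show ?thesis
  proof (rule C0_inftyI)
    show "smooth (partial i f)"
      unfolding partial_def[abs_def] by (rule smooth_frechet_derivative[OF C0_infty_smooth[OF assms]])
    fix x :: "real ^ 'a" assume x: "norm x > R"
    have "(f has_derivative (\<lambda>v. 0)) (at x)"
    proof (rule has_derivative_transform_within_open)
      show "((\<lambda>x. 0) has_derivative (\<lambda>v. 0)) (at x)" by simp
      show "open (- cball 0 R)" by auto
    qed (use x R in auto)
    then show "partial i f x = 0"
      unfolding partial_def using frechet_derivative_at by metis
  qed
qed

lemma smooth_has_derivative_partial:
  fixes f :: "real ^ 'n::finite \<Rightarrow> real"
  assumes "smooth f"
  shows "(f has_derivative (\<lambda>v. \<Sum>j\<in>UNIV. v $ j * partial j f x)) (at x)"
proof -
  have D: "(f has_derivative frechet_derivative f (at x)) (at x)" by (rule smooth_has_derivative[OF assms])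
  then interpret bounded_linear "frechet_derivative f (at x)" by (rule has_derivative_bounded_linear)
  have "frechet_derivative f (at x) v = (\<Sum>j\<in>UNIV. v $ j * partial j f x)" for v
  proof -
    have "v = (\<Sum>j\<in>UNIV. v $ j *\<^sub>R axis j 1)"
      using basis_expansion[of v] by (simp only: scalar_mult_eq_scaleR)
    then have "frechet_derivative f (at x) v = frechet_derivative f (at x) (\<Sum>j\<in>UNIV. v $ j *\<^sub>R axis j 1)" by simp
    also have "\<dots> = (\<Sum>j\<in>UNIV. v $ j * partial j f x)"
      by (simp only: sum scaleR partial_def real_scaleR_def)
    finally show ?thesis .
  qed
  then have "frechet_derivative f (at x) = (\<lambda>v. \<Sum>j\<in>UNIV. v $ j * partial j f x)" by auto
  with D show ?thesis by simp
qed

lemma partial_eqI: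
  "(f has_derivative D) (at x) \<Longrightarrow> partial i f x = D (axis i 1)"
  unfolding partial_def using frechet_derivative_at by metis

lemma partial_mult:
  fixes f g :: "real ^ 'n::finite \<Rightarrow> real"
  assumes "smooth f" "smooth g"
  shows "partial i (\<lambda>x. f x * g x) x = f x * partial i g x + partial i f x * g x"
  by (subst partial_eqI[OF has_derivative_mult[OF smooth_has_derivative smooth_has_derivative, OF assms]])
     (simp add: partial_def)

lemma partial_compose_affine:
  fixes f :: "real ^ 'n::finite \<Rightarrow> real"
  assumes "smooth f"
  shows "partial i (\<lambda>x. f (c *\<^sub>R x + b)) x = c * partial i f (c *\<^sub>R x + b)"
proof -
  have D: "((\<lambda>x. f (c *\<^sub>R x + b)) has_derivative (\<lambda>v. frechet_derivative f (at (c *\<^sub>R x + b)) (c *\<^sub>R v))) (at x)"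
    by (rule has_derivative_compose[OF _ smooth_has_derivative[OF assms]])
       (auto intro!: derivative_eq_intros)
  moreover have "linear (frechet_derivative f (at y))" for y
    using smooth_has_derivative[OF assms, of y] by (rule has_derivative_linear)
  ultimately show ?thesis
    using partial_eqI[OF D] by (simp add: linear_cmul partial_def)
qed

lemma C0_infty_bump: "bump \<in> C0_infty"
  by (rule C0_inftyI[OF smooth_bump bump_support])

lemma C0_infty_continuous: "f \<in> C0_infty \<Longrightarrow> continuous_on UNIV f"
  by (rule smooth_continuous[OF C0_infty_smooth])

lemma C0_infty_borel: "f \<in> C0_infty \<Longrightarrow> f \<in> borel_measurable borel"
  for f :: "'a::euclidean_space \<Rightarrow> real"
  by (rule borel_measurable_continuous_onI[OF C0_infty_continuous])

lemma C0_infty_bounded: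
  fixes f :: "'a::euclidean_space \<Rightarrow> real"
  assumes "f \<in> C0_infty"
  obtains B where "B > 0" "\<And>x. \<bar>f x\<bar> \<le> B"
proof -
  obtain R where R: "R > 0" "\<And>x. norm x > R \<Longrightarrow> f x = 0" using C0_infty_support assms by blast
  have "bounded (f ` cball 0 R)"
    by (intro compact_imp_bounded compact_continuous_image continuous_on_subset[OF C0_infty_continuous[OF assms]]) auto
  then obtain B where B: "B > 0" "\<And>x. x \<in> cball 0 R \<Longrightarrow> norm (f x) \<le> B" unfolding bounded_pos by blast
  show ?thesis
  proof
    show "\<bar>f x\<bar> \<le> B" for x
      by (cases "norm x > R") (use B(2)[of x] R B(1) in auto)
  qed (rule B)
qed

lemma C0_infty_bound_indicator:
  fixes f :: "'a::euclidean_space \<Rightarrow> real"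
  assumes "f \<in> C0_infty"
  obtains B R where "B > 0" "R > 0" "\<And>x. \<bar>f x\<bar> \<le> B * indicator (cball 0 R) x"
proof -
  obtain R where R: "R > 0" "\<And>x. norm x > R \<Longrightarrow> f x = 0" using C0_infty_support assms by blast
  obtain B where B: "B > 0" "\<And>x. \<bar>f x\<bar> \<le> B" using C0_infty_bounded assms by blast
  show ?thesis
    by (rule that[OF B(1) R(1)]) (use B(2) R(2) in \<open>auto simp: indicator_def\<close>)
qed

lemma C0_infty_integrable:
  fixes f :: "'a::euclidean_space \<Rightarrow> real"
  assumes "f \<in> C0_infty" shows "integrable lborel f"
proof -
  obtain B R where B: "\<And>x. \<bar>f x\<bar> \<le> B * indicator (cball 0 R) x" 
    using C0_infty_bound_indicator[OF assms] by metis
  show ?thesis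
    by (rule Bochner_Integration.integrable_bound[where f="\<lambda>x. B * indicator (cball 0 R) x"])
       (use B C0_infty_borel[OF assms] in \<open>auto intro!: integrable_mult_right integrable_real_indicator emeasure_lborel_cball_finite
          simp: less_top[symmetric] order.trans[OF _ abs_ge_self]\<close>)
qed

lemma C0_infty_uniformly_continuous:
  fixes f :: "'a::euclidean_space \<Rightarrow> real"
  assumes "f \<in> C0_infty" "e > 0"
  obtains d where "d > 0" "\<And>x y. norm (x - y) < d \<Longrightarrow> \<bar>f x - f y\<bar> < e"
proof -
  obtain R where R: "R > 0" "\<And>x. norm x > R \<Longrightarrow> f x = 0" using C0_infty_support assms by blast
  have "uniformly_continuous_on (cball 0 (R+1)) f"
    by (intro compact_uniformly_continuous continuous_on_subset[OF C0_infty_continuous[OF assms(1)]]) auto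
  then obtain d where d: "d > 0" "\<And>x y. x \<in> cball 0 (R+1) \<Longrightarrow> y \<in> cball 0 (R+1) \<Longrightarrow> dist y x < d \<Longrightarrow> dist (f y) (f x) < e"
    unfolding uniformly_continuous_on_def using assms(2) by metis
  have "\<bar>f x - f y\<bar> < e" if xy: "norm (x - y) < min d 1" for x y
  proof (cases "norm x \<le> R + 1 \<and> norm y \<le> R + 1")
    case True
    then show ?thesis using d(2)[of y x] xy by (simp add: dist_norm dist_real_def)
  next
    case False
    then have "norm x > R" "norm y > R"
      using xy norm_triangle_ineq2[of x y] norm_triangle_ineq2[of y x] by (auto simp: norm_minus_commute)
    then show ?thesis using R assms(2) by simp
  qed
  with d(1) show ?thesis by (intro that[of "min d 1"]) auto
qed

section \<open>Integrals of \<open>p\<close>-th powers\<close>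

text \<open>The \<open>p\<close>-th power of the \<open>L\<^sup>p\<close> norm, with values in \<open>[0, \<infinity>]\<close>. Constants are irrelevant for convergence,
  so the inequality \<open>|a + b|\<^sup>p \<le> 2\<^sup>p (|a|\<^sup>p + |b|\<^sup>p)\<close> takes the place of Minkowski's inequality throughout.\<close>

definition pow_int :: "real \<Rightarrow> 'a measure \<Rightarrow> ('a \<Rightarrow> real) \<Rightarrow> ennreal" where
  "pow_int p M f = (\<integral>\<^sup>+x. ennreal (\<bar>f x\<bar> powr p) \<partial>M)"

lemma powr_add_le:
  fixes a b p :: real
  assumes "p \<ge> 1"
  shows "\<bar>a + b\<bar> powr p \<le> 2 powr p * (\<bar>a\<bar> powr p + \<bar>b\<bar> powr p)"
proof -
  have "\<bar>a + b\<bar> powr p \<le> (2 * max \<bar>a\<bar> \<bar>b\<bar>) powr p"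
    using assms by (intro powr_mono2) auto
  also have "\<dots> = 2 powr p * max \<bar>a\<bar> \<bar>b\<bar> powr p" by (simp add: powr_mult)
  also have "\<dots> \<le> 2 powr p * (\<bar>a\<bar> powr p + \<bar>b\<bar> powr p)"
    by (intro mult_left_mono) (auto simp: max_def)
  finally show ?thesis .
qed

lemma le_one_plus_powr:
  fixes a p :: real
  assumes "p \<ge> 1" shows "\<bar>a\<bar> \<le> 1 + \<bar>a\<bar> powr p"
proof (cases "\<bar>a\<bar> \<le> 1")
  case False
  then have "\<bar>a\<bar> powr 1 \<le> \<bar>a\<bar> powr p" using assms by (intro powr_mono) auto
  then show ?thesis using False by auto
qed (simp add: add_increasing2)

lemma pow_int_mono_AE:
  assumes "p \<ge> 1" "AE x in M. \<bar>f x\<bar> \<le> \<bar>g x\<bar>"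
  shows "pow_int p M f \<le> pow_int p M g"
  unfolding pow_int_def
  by (rule nn_integral_mono_AE) (use assms in \<open>auto elim!: eventually_mono intro!: ennreal_leI powr_mono2\<close>)

lemma pow_int_cong_AE: "AE x in M. f x = g x \<Longrightarrow> pow_int p M f = pow_int p M g"
  unfolding pow_int_def by (rule nn_integral_cong_AE) auto

lemma pow_int_cmult:
  assumes [measurable]: "f \<in> borel_measurable M"
  shows "pow_int p M (\<lambda>x. c * f x) = ennreal (\<bar>c\<bar> powr p) * pow_int p M f"
  unfolding pow_int_def by (subst nn_integral_cmult[symmetric]) (auto simp: abs_mult powr_mult ennreal_mult)

lemma pow_int_add:
  assumes "p \<ge> 1" and [measurable]: "f \<in> borel_measurable M" "g \<in> borel_measurable M"
  shows "pow_int p M (\<lambda>x. f x + g x) \<le> ennreal (2 powr p) * (pow_int p M f + pow_int p M g)"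
proof -
  have "pow_int p M (\<lambda>x. f x + g x) \<le> (\<integral>\<^sup>+x. ennreal (2 powr p) * (ennreal (\<bar>f x\<bar> powr p) + ennreal (\<bar>g x\<bar> powr p)) \<partial>M)"
    unfolding pow_int_def using powr_add_le[OF assms(1)]
    by (intro nn_integral_mono) (auto simp: ennreal_plus[symmetric] ennreal_mult[symmetric] simp del: ennreal_plus)
  also have "\<dots> = ennreal (2 powr p) * (pow_int p M f + pow_int p M g)"
    unfolding pow_int_def by (simp add: nn_integral_cmult nn_integral_add)
  finally show ?thesis .
qed

lemma pow_int_diff:
  assumes "p \<ge> 1" and [measurable]: "f \<in> borel_measurable M" "g \<in> borel_measurable M"
  shows "pow_int p M (\<lambda>x. f x - g x) \<le> ennreal (2 powr p) * (pow_int p M f + pow_int p M g)"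
  using pow_int_add[OF assms(1,2), of "\<lambda>x. - g x"] by (simp add: pow_int_def)

lemma pow_int_add_finite:
  assumes "p \<ge> 1" "f \<in> borel_measurable M" "g \<in> borel_measurable M"
    and "pow_int p M f < \<infinity>" "pow_int p M g < \<infinity>"
  shows "pow_int p M (\<lambda>x. f x + g x) < \<infinity>"
  by (rule le_less_trans[OF pow_int_add[OF assms(1-3)]])
     (use assms in \<open>auto simp: ennreal_mult_less_top\<close>)

lemma pow_int_diff_finite:
  assumes "p \<ge> 1" "f \<in> borel_measurable M" "g \<in> borel_measurable M"
    and "pow_int p M f < \<infinity>" "pow_int p M g < \<infinity>"
  shows "pow_int p M (\<lambda>x. f x - g x) < \<infinity>"
  by (rule le_less_trans[OF pow_int_diff[OF assms(1-3)]])
     (use assms in \<open>auto simp: ennreal_mult_less_top\<close>)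

lemma pow_int_bounded_mult:
  assumes "p \<ge> 1" "f \<in> borel_measurable M" "pow_int p M f < \<infinity>" "AE x in M. \<bar>g x\<bar> \<le> C * \<bar>f x\<bar>"
  shows "pow_int p M g < \<infinity>"
proof -
  have "pow_int p M g \<le> pow_int p M (\<lambda>x. \<bar>C\<bar> * f x)"
  proof (rule pow_int_mono_AE[OF assms(1)])
    have "C * \<bar>f x\<bar> \<le> \<bar>C\<bar> * \<bar>f x\<bar>" for x by (intro mult_right_mono) auto
    then show "AE x in M. \<bar>g x\<bar> \<le> \<bar>\<bar>C\<bar> * f x\<bar>" using assms(4)
      by (auto elim!: eventually_mono simp: abs_mult intro: order.trans)
  qed
  also have "\<dots> < \<infinity>" using assms(2,3) by (simp add: pow_int_cmult ennreal_mult_less_top)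
  finally show ?thesis .
qed

lemma pow_int_sum:
  assumes "p \<ge> 1" "finite A" "\<And>j. j \<in> A \<Longrightarrow> f j \<in> borel_measurable M"
  shows "pow_int p M (\<lambda>x. \<Sum>j\<in>A. f j x) \<le> ennreal (real (card A) powr p) * (\<Sum>j\<in>A. pow_int p M (f j))"
proof (cases "A = {}")
  case True
  then show ?thesis using assms by (simp add: pow_int_def)
next
  case False
  have pw: "\<bar>\<Sum>j\<in>A. f j x\<bar> powr p \<le> real (card A) powr p * (\<Sum>j\<in>A. \<bar>f j x\<bar> powr p)" for x
  proof -
    define m where "m = Max ((\<lambda>j. \<bar>f j x\<bar>) ` A)"
    have m: "m \<in> (\<lambda>j. \<bar>f j x\<bar>) ` A" "\<And>j. j \<in> A \<Longrightarrow> \<bar>f j x\<bar> \<le> m"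
      unfolding m_def using assms(2) False by (auto intro!: Max_in)
    then obtain k where k: "k \<in> A" "m = \<bar>f k x\<bar>" by blast
    have "\<bar>\<Sum>j\<in>A. f j x\<bar> \<le> (\<Sum>j\<in>A. \<bar>f j x\<bar>)" by (rule sum_abs)
    also have "\<dots> \<le> real (card A) * m" using m(2) by (intro sum_bounded_above) auto
    finally have "\<bar>\<Sum>j\<in>A. f j x\<bar> powr p \<le> (real (card A) * m) powr p"
      using assms(1) by (intro powr_mono2) auto
    also have "\<dots> = real (card A) powr p * \<bar>f k x\<bar> powr p" using k by (simp add: powr_mult)
    also have "\<dots> \<le> real (card A) powr p * (\<Sum>j\<in>A. \<bar>f j x\<bar> powr p)"
      using assms(2) k(1) by (intro mult_left_mono member_le_sum) auto
    finally show ?thesis .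
  qed
  have "pow_int p M (\<lambda>x. \<Sum>j\<in>A. f j x) \<le> (\<integral>\<^sup>+x. ennreal (real (card A) powr p) * (\<Sum>j\<in>A. ennreal (\<bar>f j x\<bar> powr p)) \<partial>M)"
    unfolding pow_int_def using pw
    by (intro nn_integral_mono) (auto simp: ennreal_mult[symmetric] sum_nonneg)
  also have "\<dots> = ennreal (real (card A) powr p) * (\<Sum>j\<in>A. pow_int p M (f j))"
    unfolding pow_int_def using assms(3)
    by (subst nn_integral_cmult) (auto simp: nn_integral_sum simp del: sum_ennreal)
  finally show ?thesis .
qed

lemma pow_int_bounded_set:
  assumes "p \<ge> 1" "A \<in> sets M" "emeasure M A < \<infinity>" "\<And>x. \<bar>f x\<bar> \<le> C * indicator A x"
  shows "pow_int p M f < \<infinity>"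
proof -
  have "ennreal (\<bar>f x\<bar> powr p) \<le> ennreal (\<bar>C\<bar> powr p) * indicator A x" for x
    using assms(4)[of x] assms(1) by (cases "x \<in> A") (auto intro!: ennreal_leI powr_mono2)
  then have "pow_int p M f \<le> (\<integral>\<^sup>+x. ennreal (\<bar>C\<bar> powr p) * indicator A x \<partial>M)"
    unfolding pow_int_def by (intro nn_integral_mono)
  also have "\<dots> < \<infinity>" using assms(2,3) by (simp add: nn_integral_cmult_indicator ennreal_mult_less_top)
  finally show ?thesis .
qed

lemma tendsto_0_ennrealI:
  fixes f :: "nat \<Rightarrow> ennreal"
  assumes "\<And>e::real. e > 0 \<Longrightarrow> eventually (\<lambda>n. f n \<le> ennreal e) sequentially"
  shows "f \<longlonglongrightarrow> 0"
proof (rule order_tendstoI)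
  fix a :: ennreal assume "0 < a"
  then obtain e where e: "0 < ennreal e" "ennreal e < a" "e > 0"
    by (metis dense ennreal_cases ennreal_less_zero_iff infinity_ennreal_def less_top not_less_zero top.extremum_strict)
  show "eventually (\<lambda>n. f n < a) sequentially"
    using assms[OF e(3)] e(2) by (auto elim!: eventually_mono)
qed auto

lemma tendsto_0_ennrealD:
  fixes f :: "'a \<Rightarrow> ennreal"
  assumes "(f \<longlongrightarrow> 0) F" "e > 0"
  shows "eventually (\<lambda>n. f n < ennreal e) F"
  using order_tendstoD(2)[OF assms(1), of "ennreal e"] assms(2) by simp

lemma tendsto_0_ennreal_le:
  fixes f g :: "'a \<Rightarrow> ennreal"
  assumes "(g \<longlongrightarrow> 0) F" "\<And>n. f n \<le> g n"
  shows "(f \<longlongrightarrow> 0) F"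
  using tendsto_sandwich[of "\<lambda>_. 0" f F g 0] assms by simp

lemma tendsto_0_ennreal_cmult:
  fixes f :: "'a \<Rightarrow> ennreal"
  assumes "(f \<longlongrightarrow> 0) F" "c < \<infinity>"
  shows "((\<lambda>n. c * f n) \<longlongrightarrow> 0) F"
  using ennreal_tendsto_cmult[OF assms(2)[unfolded infinity_ennreal_def] assms(1)] by simp

lemma pow_int_tendsto_add:
  assumes "p \<ge> 1" "\<And>n. f n \<in> borel_measurable M" "\<And>n. g n \<in> borel_measurable M"
    and "(\<lambda>n. pow_int p M (f n)) \<longlonglongrightarrow> 0" "(\<lambda>n. pow_int p M (g n)) \<longlonglongrightarrow> 0"
  shows "(\<lambda>n. pow_int p M (\<lambda>x. f n x + g n x)) \<longlonglongrightarrow> 0"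
proof (rule tendsto_0_ennreal_le)
  show "(\<lambda>n. ennreal (2 powr p) * (pow_int p M (f n) + pow_int p M (g n))) \<longlonglongrightarrow> 0"
    using tendsto_add[OF assms(4,5)] by (intro tendsto_0_ennreal_cmult) auto
qed (use assms pow_int_add in blast)

lemma pow_int_dominated:
  assumes p: "p \<ge> 1" and [measurable]: "\<And>n. f n \<in> borel_measurable M" "F \<in> borel_measurable M" "G \<in> borel_measurable M"
    and G: "pow_int p M G < \<infinity>"
    and bd: "\<And>n. AE x in M. \<bar>f n x\<bar> \<le> G x"
    and lim: "AE x in M. (\<lambda>n. f n x) \<longlonglongrightarrow> F x"
  shows "(\<lambda>n. pow_int p M (\<lambda>x. f n x - F x)) \<longlonglongrightarrow> 0"
proof -
  have "(\<lambda>n. \<integral>\<^sup>+x. ennreal (norm (0 - \<bar>f n x - F x\<bar> powr p)) \<partial>M) \<longlonglongrightarrow> 0"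
  proof (rule nn_integral_dominated_convergence_norm)
    show "(\<integral>\<^sup>+x. ennreal (\<bar>2 * G x\<bar> powr p) \<partial>M) < \<infinity>"
      using pow_int_cmult[of G M p 2] G by (simp add: pow_int_def ennreal_mult_less_top)
    have F: "AE x in M. \<bar>F x\<bar> \<le> G x"
    proof -
      have "AE x in M. \<forall>n. \<bar>f n x\<bar> \<le> G x" using bd by (simp add: AE_all_countable)
      then show ?thesis using lim
        by eventually_elim (rule LIMSEQ_le_const2[OF tendsto_rabs], auto)
    qed
    show "AE x in M. norm (\<bar>f n x - F x\<bar> powr p) \<le> \<bar>2 * G x\<bar> powr p" for n
      using bd[of n] F by eventually_elim (use p in \<open>auto intro!: powr_mono2\<close>)
    show "AE x in M. (\<lambda>n. \<bar>f n x - F x\<bar> powr p) \<longlonglongrightarrow> 0"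
      using lim
    proof eventually_elim
      fix x assume "(\<lambda>n. f n x) \<longlonglongrightarrow> F x"
      then have "(\<lambda>n. \<bar>f n x - F x\<bar>) \<longlonglongrightarrow> 0" by (simp add: LIM_zero tendsto_rabs_zero)
      from tendsto_powr2[OF this tendsto_const, of p] p
      show "(\<lambda>n. \<bar>f n x - F x\<bar> powr p) \<longlonglongrightarrow> 0" by simp
    qed
  qed simp_all
  then show ?thesis by (simp add: pow_int_def)
qed

lemma pow_int_Fatou:
  assumes "p \<ge> 1" and [measurable]: "\<And>n. f n \<in> borel_measurable M"
    and lim: "AE x in M. (\<lambda>n. f n x) \<longlonglongrightarrow> F x"
    and bd: "\<And>n. pow_int p M (f n) \<le> B"
  shows "pow_int p M F \<le> B"
proof -
  have "pow_int p M F = (\<integral>\<^sup>+x. liminf (\<lambda>n. ennreal (\<bar>f n x\<bar> powr p)) \<partial>M)"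
    unfolding pow_int_def
  proof (rule nn_integral_cong_AE)
    show "AE x in M. ennreal (\<bar>F x\<bar> powr p) = liminf (\<lambda>n. ennreal (\<bar>f n x\<bar> powr p))"
      using lim
    proof eventually_elim
      fix x assume "(\<lambda>n. f n x) \<longlonglongrightarrow> F x"
      then have "(\<lambda>n. ennreal (\<bar>f n x\<bar> powr p)) \<longlonglongrightarrow> ennreal (\<bar>F x\<bar> powr p)"
        using assms(1) by (intro tendsto_ennrealI tendsto_powr2 tendsto_rabs tendsto_const) auto
      then show "ennreal (\<bar>F x\<bar> powr p) = liminf (\<lambda>n. ennreal (\<bar>f n x\<bar> powr p))"
        by (rule lim_imp_Liminf[symmetric, rotated]) simp
    qed
  qed
  also have "\<dots> \<le> liminf (\<lambda>n. pow_int p M (f n))"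
    unfolding pow_int_def by (rule nn_integral_liminf) auto
  also have "\<dots> \<le> B"
    using bd Liminf_mono[of "\<lambda>n. pow_int p M (f n)" "\<lambda>_. B" sequentially] by (simp add: Liminf_const)
  finally show ?thesis .
qed

subsection \<open>Averages\<close>

text \<open>The graph of \<open>t \<mapsto> t\<^sup>p\<close> lies above its tangents.\<close>

lemma powr_tangent:
  fixes p s t :: real
  assumes "p \<ge> 1" "s > 0" "t \<ge> 0"
  shows "p * s powr (p - 1) * t \<le> t powr p + (p - 1) * s powr p"
proof (cases "p = 1")
  case False
  with assms have p: "p > 1" by simp
  define q where "q = p / (p - 1)"
  have q: "q > 1" "1 / p + 1 / q = 1" "(p - 1) * q = p" "p / q = p - 1"
    using p by (auto simp: q_def field_simps)
  have "t * s powr (p - 1) \<le> t powr p / p + (s powr (p - 1)) powr q / q"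
    by (rule Youngs_inequality) (use p q assms in auto)
  also have "(s powr (p - 1)) powr q = s powr p" by (simp add: powr_powr q)
  finally have "p * (t * s powr (p - 1)) \<le> p * (t powr p / p + s powr p / q)"
    using p by (intro mult_left_mono) auto
  also have "\<dots> = t powr p + (p / q) * s powr p" using p by (simp add: field_simps)
  finally show ?thesis using q by (simp add: mult_ac)
qed (use assms in auto)

text \<open>Jensen's inequality for a signed kernel \<open>k\<close> of total mass at most \<open>K\<close>. If \<open>a k\<close> is not integrable, the
  integral on the left is \<open>0\<close> and nothing is claimed.\<close>

lemma Jensen_powr:
  assumes p: "p \<ge> 1" and K: "K > 0" "(\<integral>\<^sup>+y. ennreal \<bar>k y\<bar> \<partial>M) \<le> ennreal K"
    and [measurable]: "a \<in> borel_measurable M" "k \<in> borel_measurable M"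
  shows "ennreal (\<bar>\<integral>y. a y * k y \<partial>M\<bar> powr p) \<le> ennreal (K powr (p - 1)) * (\<integral>\<^sup>+y. ennreal (\<bar>a y\<bar> powr p) * ennreal \<bar>k y\<bar> \<partial>M)"
proof -
  define J where "J = (\<integral>\<^sup>+y. ennreal (\<bar>a y\<bar> powr p) * ennreal \<bar>k y\<bar> \<partial>M)"
  define A where "A = (\<integral>y. \<bar>a y * k y\<bar> \<partial>M)"
  show ?thesis unfolding J_def[symmetric]
  proof (cases "J = \<infinity> \<or> \<not> integrable M (\<lambda>y. a y * k y) \<or> A = 0")
    case True
    then consider "J = \<infinity>" | "\<not> integrable M (\<lambda>y. a y * k y)" | "integrable M (\<lambda>y. a y * k y)" "A = 0" by blast
    then show "ennreal (\<bar>\<integral>y. a y * k y \<partial>M\<bar> powr p) \<le> ennreal (K powr (p - 1)) * J"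
    proof cases
      case 1
      then show ?thesis using K(1) by (simp add: ennreal_mult_eq_top_iff)
    next
      case 2
      then show ?thesis by (simp add: not_integrable_integral_eq)
    next
      case 3
      have "\<bar>\<integral>y. a y * k y \<partial>M\<bar> \<le> A" unfolding A_def by (rule integral_abs_bound)
      then show ?thesis using 3 by simp
    qed
  next
    case False
    have A: "A > 0" using False by (auto simp: A_def less_le)
    have int_k: "integrable M (\<lambda>y. \<bar>k y\<bar>)"
      unfolding integrable_iff_bounded using K(2) by (auto intro: le_less_trans)
    have "(\<integral>y. \<bar>k y\<bar> \<partial>M) \<le> K"
      using K nn_integral_eq_integral[OF int_k] by simp
    note kK = this
    have J': "J = (\<integral>\<^sup>+y. ennreal (\<bar>a y\<bar> powr p * \<bar>k y\<bar>) \<partial>M)"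
      unfolding J_def by (simp add: ennreal_mult)
    have int_J: "integrable M (\<lambda>y. \<bar>a y\<bar> powr p * \<bar>k y\<bar>)"
      unfolding integrable_iff_bounded using False J' by (auto simp: less_top abs_mult)
    define j where "j = (\<integral>y. \<bar>a y\<bar> powr p * \<bar>k y\<bar> \<partial>M)"
    have Jj: "J = ennreal j" unfolding J' j_def by (rule nn_integral_eq_integral[OF int_J]) auto
    define s where "s = A / K"
    have s: "s > 0" "A = s * K" using A K by (auto simp: s_def)
    have "p * s powr (p - 1) * A = (\<integral>y. p * s powr (p - 1) * \<bar>a y * k y\<bar> \<partial>M)"
      unfolding A_def by simp
    also have "\<dots> \<le> (\<integral>y. \<bar>a y\<bar> powr p * \<bar>k y\<bar> + (p - 1) * s powr p * \<bar>k y\<bar> \<partial>M)"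
    proof (rule integral_mono)
      show "integrable M (\<lambda>y. p * s powr (p - 1) * \<bar>a y * k y\<bar>)" using False by (intro integrable_mult_right integrable_abs) auto
      show "integrable M (\<lambda>y. \<bar>a y\<bar> powr p * \<bar>k y\<bar> + (p - 1) * s powr p * \<bar>k y\<bar>)"
        using int_J int_k by (intro Bochner_Integration.integrable_add integrable_mult_right) auto
      show "p * s powr (p - 1) * \<bar>a y * k y\<bar> \<le> \<bar>a y\<bar> powr p * \<bar>k y\<bar> + (p - 1) * s powr p * \<bar>k y\<bar>" for y
        using mult_right_mono[OF powr_tangent[OF p s(1), of "\<bar>a y\<bar>"], of "\<bar>k y\<bar>"]
        by (simp add: abs_mult algebra_simps)
    qed
    also have "\<dots> = j + (p - 1) * s powr p * (\<integral>y. \<bar>k y\<bar> \<partial>M)"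
      unfolding j_def using int_J int_k by (subst Bochner_Integration.integral_add) auto
    also have "\<dots> \<le> j + (p - 1) * s powr p * K"
      using kK p by (intro add_left_mono mult_left_mono) auto
    finally have "p * s powr (p - 1) * (s * K) \<le> j + (p - 1) * s powr p * K" unfolding s(2) .
    moreover have "s powr (p - 1) * s = s powr p"
      using s(1) powr_add[of s "p - 1" 1] by simp
    ultimately have "p * s powr p * K \<le> j + (p - 1) * s powr p * K"
      by (metis mult.assoc)
    then have "s powr p * K \<le> j" by (simp add: algebra_simps)
    then have "K powr (p - 1) * (s powr p * K) \<le> K powr (p - 1) * j" by (intro mult_left_mono) auto
    moreover have "K powr (p - 1) * (s powr p * K) = A powr p"
      using s K powr_add[of K "p - 1" 1] by (simp add: powr_mult)
    ultimately have "A powr p \<le> K powr (p - 1) * j" by simp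
    moreover have "\<bar>\<integral>y. a y * k y \<partial>M\<bar> powr p \<le> A powr p"
      unfolding A_def using p by (intro powr_mono2 integral_abs_bound) auto
    ultimately show "ennreal (\<bar>\<integral>y. a y * k y \<partial>M\<bar> powr p) \<le> ennreal (K powr (p - 1)) * J"
      unfolding Jj by (subst ennreal_mult''[symmetric]) (auto simp: j_def intro!: integral_nonneg_AE)
  qed
qed

text \<open>The form in which Minkowski's integral inequality is used: an average with the kernel \<open>k\<close> of functions
  \<open>F(\<cdot>, y)\<close> that are uniformly bounded in \<open>L\<^sup>p\<close>.\<close>

lemma pow_int_kernel:
  assumes p: "p \<ge> 1" and K: "K > 0" "(\<integral>\<^sup>+y. ennreal \<bar>k y\<bar> \<partial>N) \<le> ennreal K"
    and M: "sigma_finite_measure M" and N: "sigma_finite_measure N"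
    and F[measurable]: "(\<lambda>(x, y). F x y) \<in> borel_measurable (M \<Otimes>\<^sub>M N)"
    and k[measurable]: "k \<in> borel_measurable N"
    and B: "\<And>y. y \<in> space N \<Longrightarrow> k y \<noteq> 0 \<Longrightarrow> pow_int p M (\<lambda>x. F x y) \<le> B"
  shows "pow_int p M (\<lambda>x. \<integral>y. F x y * k y \<partial>N) \<le> ennreal (K powr p) * B"
proof -
  interpret M: sigma_finite_measure M by fact
  interpret N: sigma_finite_measure N by fact
  interpret pair_sigma_finite M N ..
  have "pow_int p M (\<lambda>x. \<integral>y. F x y * k y \<partial>N)
      \<le> (\<integral>\<^sup>+x. ennreal (K powr (p - 1)) * (\<integral>\<^sup>+y. ennreal (\<bar>F x y\<bar> powr p) * ennreal \<bar>k y\<bar> \<partial>N) \<partial>M)"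
    unfolding pow_int_def
  proof (rule nn_integral_mono)
    fix x assume "x \<in> space M"
    then have "F x \<in> borel_measurable N" using F by (simp add: measurable_compose_Pair1[of x M "\<lambda>(x, y). F x y", simplified])
    then show "ennreal (\<bar>\<integral>y. F x y * k y \<partial>N\<bar> powr p)
      \<le> ennreal (K powr (p - 1)) * (\<integral>\<^sup>+y. ennreal (\<bar>F x y\<bar> powr p) * ennreal \<bar>k y\<bar> \<partial>N)"
      by (intro Jensen_powr p K k)
  qed
  also have "\<dots> = ennreal (K powr (p - 1)) * (\<integral>\<^sup>+x. \<integral>\<^sup>+y. ennreal (\<bar>F x y\<bar> powr p) * ennreal \<bar>k y\<bar> \<partial>N \<partial>M)"
    by (rule nn_integral_cmult) measurable
  also have "(\<integral>\<^sup>+x. \<integral>\<^sup>+y. ennreal (\<bar>F x y\<bar> powr p) * ennreal \<bar>k y\<bar> \<partial>N \<partial>M)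
      = (\<integral>\<^sup>+y. \<integral>\<^sup>+x. ennreal (\<bar>F x y\<bar> powr p) * ennreal \<bar>k y\<bar> \<partial>M \<partial>N)"
    by (rule Fubini'[symmetric]) measurable
  also have "\<dots> \<le> (\<integral>\<^sup>+y. B * ennreal \<bar>k y\<bar> \<partial>N)"
  proof (rule nn_integral_mono)
    fix y assume y: "y \<in> space N"
    have [measurable]: "(\<lambda>x. F x y) \<in> borel_measurable M"
      using measurable_compose[OF measurable_Pair2'[OF y] F] by simp
    have "(\<integral>\<^sup>+x. ennreal (\<bar>F x y\<bar> powr p) * ennreal \<bar>k y\<bar> \<partial>M) = pow_int p M (\<lambda>x. F x y) * ennreal \<bar>k y\<bar>"
      unfolding pow_int_def by (rule nn_integral_multc) simp
    also have "\<dots> \<le> B * ennreal \<bar>k y\<bar>"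
      using B[OF y] by (cases "k y = 0") (auto intro: mult_right_mono)
    finally show "(\<integral>\<^sup>+x. ennreal (\<bar>F x y\<bar> powr p) * ennreal \<bar>k y\<bar> \<partial>M) \<le> B * ennreal \<bar>k y\<bar>" .
  qed
  also have "\<dots> = B * (\<integral>\<^sup>+y. ennreal \<bar>k y\<bar> \<partial>N)" by (rule nn_integral_cmult) simp
  also have "\<dots> \<le> B * ennreal K" by (intro mult_left_mono K) auto
  finally have "pow_int p M (\<lambda>x. \<integral>y. F x y * k y \<partial>N) \<le> ennreal (K powr (p - 1)) * (B * ennreal K)"
    by (simp add: mult_left_mono)
  also have "\<dots> = ennreal (K powr (p - 1) * K) * B" using K(1) by (simp add: ennreal_mult mult_ac)
  also have "K powr (p - 1) * K = K powr p" using K powr_add[of K "p - 1" 1] by simp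
  finally show ?thesis .
qed

subsection \<open>Translations\<close>

lemma nn_integral_lborel_translate:
  fixes a :: "'a::euclidean_space"
  assumes [measurable]: "f \<in> borel_measurable borel"
  shows "(\<integral>\<^sup>+x. f (x + a) \<partial>lborel) = (\<integral>\<^sup>+x. f x \<partial>lborel)"
  by (subst (2) lborel_distr_plus[of a, symmetric]) (simp add: nn_integral_distr add.commute)

lemma integrable_lborel_translate:
  fixes a :: "'a::euclidean_space" and f :: "'a \<Rightarrow> real"
  assumes "integrable lborel f"
  shows "integrable lborel (\<lambda>x. f (x + a))"
proof -
  have [measurable]: "f \<in> borel_measurable borel" using borel_measurable_integrable[OF assms] by simp
  have "integrable (distr lborel borel ((+) a)) f" using assms by (simp add: lborel_distr_plus)
  then show ?thesis by (subst (asm) integrable_distr_eq) (auto simp: add.commute)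
qed

lemma integral_lborel_translate:
  fixes a :: "'a::euclidean_space" and f :: "'a \<Rightarrow> real"
  assumes [measurable]: "f \<in> borel_measurable borel"
  shows "(\<integral>x. f (x + a) \<partial>lborel) = (\<integral>x. f x \<partial>lborel)"
  by (subst (2) lborel_distr_plus[of a, symmetric]) (simp add: integral_distr add.commute)

lemma AE_lborel_translate:
  fixes a :: "'a::euclidean_space"
  assumes "AE x in lborel. P x"
  shows "AE x in lborel. P (x + a)"
proof -
  obtain N where N: "{x. \<not> P x} \<subseteq> N" "N \<in> sets borel" "emeasure lborel N = 0"
    using assms by (auto elim!: AE_E)
  have "AE x in lborel. x + a \<notin> N"
  proof (rule AE_I)
    show "{x \<in> space lborel. \<not> x + a \<notin> N} \<subseteq> (\<lambda>x. x + a) -` N" by auto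
    have "(\<lambda>x. x + a) -` N \<in> sets borel"
      using N(2) measurable_sets[of "\<lambda>x. x + a" borel borel N] by auto
    then have "emeasure lborel ((\<lambda>x. x + a) -` N) = (\<integral>\<^sup>+x. indicator ((\<lambda>x. x + a) -` N) x \<partial>lborel)"
      by (intro nn_integral_indicator[symmetric]) simp
    also have "\<dots> = (\<integral>\<^sup>+x. indicator N (x + a) \<partial>lborel)"
      by (rule nn_integral_cong) (simp add: indicator_def)
    also have "\<dots> = 0" using N by (subst nn_integral_lborel_translate) auto
    finally show "emeasure lborel ((\<lambda>x. x + a) -` N) = 0" .
    show "(\<lambda>x. x + a) -` N \<in> sets lborel"
      using N(2) measurable_sets[of "\<lambda>x. x + a" lborel borel N] by auto
  qed
  then show ?thesis using N(1) by (auto elim!: eventually_mono)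
qed

lemma pow_int_translate:
  fixes a :: "'a::euclidean_space"
  assumes [measurable]: "f \<in> borel_measurable borel"
  shows "pow_int p lborel (\<lambda>x. f (x + a)) = pow_int p lborel f"
  unfolding pow_int_def using nn_integral_lborel_translate[of "\<lambda>x. ennreal (\<bar>f x\<bar> powr p)" a] by simp

text \<open>For an open set \<open>U\<close> the indicators satisfy \<open>1\<^sub>U(x + Y\<^sub>n) 1\<^sub>U(x) \<rightarrow> 1\<^sub>U(x)\<close> for every \<open>x\<close>, so no compact
  approximation from inside is needed.\<close>

lemma L1_translation_open:
  fixes U :: "'a::euclidean_space set"
  assumes U: "open U" "emeasure lborel U < \<infinity>" and Y: "Y \<longlonglongrightarrow> 0"
  shows "(\<lambda>n. \<integral>x. \<bar>indicator U (x + Y n) - indicator U x\<bar> \<partial>lborel :: real) \<longlonglongrightarrow> 0"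
proof -
  let ?i = "indicator U :: 'a \<Rightarrow> real"
  have [measurable]: "U \<in> sets borel" using U by simp
  have int: "integrable lborel ?i" using U by (auto intro: integrable_real_indicator)
  have int2: "integrable lborel (\<lambda>x. ?i (x + y))" for y by (rule integrable_lborel_translate[OF int])
  have int3: "integrable lborel (\<lambda>x. ?i (x + y) * ?i x)" for y
    by (rule Bochner_Integration.integrable_bound[OF int]) (auto simp: indicator_def)
  have "(\<lambda>n. \<integral>x. ?i (x + Y n) * ?i x \<partial>lborel) \<longlonglongrightarrow> (\<integral>x. ?i x \<partial>lborel)"
  proof (rule integral_dominated_convergence[where w="?i"])
    have "(\<lambda>n. ?i (x + Y n) * ?i x) \<longlonglongrightarrow> ?i x" for x
    proof (cases "x \<in> U")
      case True
      have "(\<lambda>n. x + Y n) \<longlonglongrightarrow> x" using tendsto_add[OF tendsto_const[of x] Y] by simp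
      then have "eventually (\<lambda>n. x + Y n \<in> U) sequentially" using U(1) True by (rule topological_tendstoD)
      then have "eventually (\<lambda>n. ?i (x + Y n) * ?i x = ?i x) sequentially"
        by eventually_elim (use True in auto)
      then show ?thesis by (rule tendsto_eventually)
    qed simp
    then show "AE x in lborel. (\<lambda>n. ?i (x + Y n) * ?i x) \<longlonglongrightarrow> ?i x" by simp
  qed (use int in \<open>auto simp: indicator_def\<close>)
  then have "(\<lambda>n. (\<integral>x. ?i x \<partial>lborel) + (\<integral>x. ?i x \<partial>lborel) - 2 * (\<integral>x. ?i (x + Y n) * ?i x \<partial>lborel)) \<longlonglongrightarrow>
     (\<integral>x. ?i x \<partial>lborel) + (\<integral>x. ?i x \<partial>lborel) - 2 * (\<integral>x. ?i x \<partial>lborel)"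
    by (intro tendsto_intros)
  moreover have "(\<integral>x. \<bar>?i (x + y) - ?i x\<bar> \<partial>lborel) = (\<integral>x. ?i x \<partial>lborel) + (\<integral>x. ?i x \<partial>lborel) - 2 * (\<integral>x. ?i (x + y) * ?i x \<partial>lborel)" for y
  proof -
    have "(\<integral>x. \<bar>?i (x + y) - ?i x\<bar> \<partial>lborel) = (\<integral>x. ?i (x + y) + ?i x - 2 * (?i (x + y) * ?i x) \<partial>lborel)"
      by (rule Bochner_Integration.integral_cong) (auto simp: indicator_def)
    also have "\<dots> = (\<integral>x. ?i (x + y) \<partial>lborel) + (\<integral>x. ?i x \<partial>lborel) - 2 * (\<integral>x. ?i (x + y) * ?i x \<partial>lborel)"
      using int int2[of y] int3[of y] by simp
    finally show ?thesis by (subst (asm) integral_lborel_translate) auto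
  qed
  ultimately show ?thesis by simp
qed

text \<open>The translation modulus obeys the triangle inequality, which transfers continuity from
  open sets to Borel sets, then to linear combinations and limits.\<close>

lemma L1_translation_approx:
  fixes f :: "'a::euclidean_space \<Rightarrow> real"
  assumes f: "integrable lborel f"
    and g: "\<And>e. e > 0 \<Longrightarrow> \<exists>g. integrable lborel g \<and> (\<integral>x. \<bar>f x - g x\<bar> \<partial>lborel) < e \<and>
              (\<lambda>n. \<integral>x. \<bar>g (x + Y n) - g x\<bar> \<partial>lborel) \<longlonglongrightarrow> 0"
  shows "(\<lambda>n. \<integral>x. \<bar>f (x + Y n) - f x\<bar> \<partial>lborel) \<longlonglongrightarrow> 0"
proof (rule order_tendstoI)
  fix a :: real assume "a < 0"
  then show "eventually (\<lambda>n. a < (\<integral>x. \<bar>f (x + Y n) - f x\<bar> \<partial>lborel)) sequentially"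
    by (intro always_eventually allI order.strict_trans2[OF _ integral_nonneg_AE]) auto
next
  fix e :: real assume "0 < e"
  then obtain g where g: "integrable lborel g" "(\<integral>x. \<bar>f x - g x\<bar> \<partial>lborel) < e / 3"
     "(\<lambda>n. \<integral>x. \<bar>g (x + Y n) - g x\<bar> \<partial>lborel) \<longlonglongrightarrow> 0" using assms(2)[of "e / 3"] by auto
  have [measurable]: "f \<in> borel_measurable borel" "g \<in> borel_measurable borel"
    using f g(1) by (auto dest: borel_measurable_integrable)
  have le: "(\<integral>x. \<bar>f (x + y) - f x\<bar> \<partial>lborel) \<le> 2 * (\<integral>x. \<bar>f x - g x\<bar> \<partial>lborel) + (\<integral>x. \<bar>g (x + y) - g x\<bar> \<partial>lborel)" for y
  proof -
    note ints = f g(1) integrable_lborel_translate[OF f, of y] integrable_lborel_translate[OF g(1), of y]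
    have "(\<integral>x. \<bar>f (x + y) - f x\<bar> \<partial>lborel) \<le> (\<integral>x. \<bar>f (x + y) - g (x + y)\<bar> + \<bar>f x - g x\<bar> + \<bar>g (x + y) - g x\<bar> \<partial>lborel)"
      by (rule integral_mono) (use ints in auto)
    also have "\<dots> = (\<integral>x. \<bar>f (x + y) - g (x + y)\<bar> \<partial>lborel) + (\<integral>x. \<bar>f x - g x\<bar> \<partial>lborel) + (\<integral>x. \<bar>g (x + y) - g x\<bar> \<partial>lborel)"
      using ints by simp
    also have "(\<integral>x. \<bar>f (x + y) - g (x + y)\<bar> \<partial>lborel) = (\<integral>x. \<bar>f x - g x\<bar> \<partial>lborel)"
      using integral_lborel_translate[of "\<lambda>x. \<bar>f x - g x\<bar>" y] by simp
    finally show ?thesis by simp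
  qed
  have "eventually (\<lambda>n. (\<integral>x. \<bar>g (x + Y n) - g x\<bar> \<partial>lborel) < e / 3) sequentially"
    using order_tendstoD(2)[OF g(3), of "e / 3"] \<open>0 < e\<close> by simp
  then show "eventually (\<lambda>n. (\<integral>x. \<bar>f (x + Y n) - f x\<bar> \<partial>lborel) < e) sequentially"
  proof eventually_elim
    case (elim n)
    then show ?case using le[of "Y n"] g(2) by linarith
  qed
qed

lemma L1_translation:
  fixes f :: "'a::euclidean_space \<Rightarrow> real"
  assumes "integrable lborel f" and Y: "Y \<longlonglongrightarrow> 0"
  shows "(\<lambda>n. \<integral>x. \<bar>f (x + Y n) - f x\<bar> \<partial>lborel) \<longlonglongrightarrow> 0"
  using assms(1)
proof (induction f rule: integrable_induct)
  case (base A c)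
  have A: "A \<in> sets borel" using base by simp
  have int_ind: "integrable lborel (indicator A :: 'a \<Rightarrow> real)" using base by (auto intro: integrable_real_indicator)
  have "(\<lambda>n. \<integral>x. \<bar>indicator A (x + Y n) - indicator A x\<bar> \<partial>lborel :: real) \<longlonglongrightarrow> 0"
  proof (rule L1_translation_approx[OF int_ind])
    fix e :: real assume e: "e > 0"
    obtain U where U: "open U" "A \<subseteq> U" "emeasure lborel (U - A) < e"
      using outer_regular_lborel[OF A e] .
    have "emeasure lborel U \<le> emeasure lborel A + emeasure lborel (U - A)"
      using U A by (subst plus_emeasure) (auto intro!: emeasure_mono)
    also have "\<dots> < \<infinity>" using base U(3) by (auto simp: less_top[symmetric] intro: le_less_trans)
    finally have fin: "emeasure lborel U < \<infinity>" .
    have "(\<integral>x. \<bar>indicator A x - indicator U x\<bar> \<partial>lborel) = (\<integral>x. indicator (U - A) x \<partial>lborel :: real)"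
      by (rule Bochner_Integration.integral_cong) (use U in \<open>auto simp: indicator_def\<close>)
    also have "\<dots> = measure lborel (U - A)" using U A by simp
    also have "\<dots> < e"
    proof -
      have "emeasure lborel (U - A) \<noteq> top" using U(3) by (metis ennreal_less_top less_trans less_irrefl)
      then show ?thesis using U(3) e by (simp add: emeasure_eq_ennreal_measure ennreal_less_iff)
    qed
    finally have "(\<integral>x. \<bar>indicator A x - indicator U x\<bar> \<partial>lborel :: real) < e" .
    then show "\<exists>g. integrable lborel g \<and> (\<integral>x. \<bar>indicator A x - g x\<bar> \<partial>lborel) < e \<and>
              (\<lambda>n. \<integral>x. \<bar>g (x + Y n) - g x\<bar> \<partial>lborel) \<longlonglongrightarrow> 0"
      using L1_translation_open[OF U(1) fin Y] U(1) fin
      by (intro exI[of _ "indicator U"]) (auto intro!: integrable_real_indicator)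
  qed
  then have "(\<lambda>n. \<bar>c\<bar> * (\<integral>x. \<bar>indicator A (x + Y n) - indicator A x\<bar> \<partial>lborel)) \<longlonglongrightarrow> \<bar>c\<bar> * 0"
    by (rule tendsto_mult_left)
  moreover have "\<bar>indicator A (x + y) *\<^sub>R c - indicator A x *\<^sub>R c\<bar> = \<bar>c\<bar> * \<bar>indicator A (x + y) - indicator A x\<bar>" for x y
    by (auto simp: indicator_def)
  ultimately show ?case by simp
next
  case (add f g)
  have "(\<integral>x. \<bar>f (x + y) + g (x + y) - (f x + g x)\<bar> \<partial>lborel) \<le> (\<integral>x. \<bar>f (x + y) - f x\<bar> \<partial>lborel) + (\<integral>x. \<bar>g (x + y) - g x\<bar> \<partial>lborel)" for y
  proof -
    note ints = add.hyps integrable_lborel_translate[OF add.hyps(1), of y] integrable_lborel_translate[OF add.hyps(2), of y]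
    have "(\<integral>x. \<bar>f (x + y) + g (x + y) - (f x + g x)\<bar> \<partial>lborel) \<le> (\<integral>x. \<bar>f (x + y) - f x\<bar> + \<bar>g (x + y) - g x\<bar> \<partial>lborel)"
      by (rule integral_mono) (use ints in auto)
    also have "\<dots> = (\<integral>x. \<bar>f (x + y) - f x\<bar> \<partial>lborel) + (\<integral>x. \<bar>g (x + y) - g x\<bar> \<partial>lborel)" using ints by simp
    finally show ?thesis .
  qed
  note le = this
  have sum0: "(\<lambda>n. (\<integral>x. \<bar>f (x + Y n) - f x\<bar> \<partial>lborel) + (\<integral>x. \<bar>g (x + Y n) - g x\<bar> \<partial>lborel)) \<longlonglongrightarrow> 0"
    using tendsto_add[OF add.IH] by simp
  show ?case
    by (rule Lim_null_comparison[OF _ sum0]) (use le in \<open>auto simp: integral_nonneg_AE intro!: always_eventually\<close>)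
next
  case (lim f s)
  show ?case
  proof (rule L1_translation_approx[OF lim.hyps(4)])
    fix e :: real assume e: "e > 0"
    have "(\<lambda>i. \<integral>x. \<bar>f x - s i x\<bar> \<partial>lborel) \<longlonglongrightarrow> (\<integral>x. 0 \<partial>(lborel :: 'a measure))"
    proof (rule integral_dominated_convergence[where w="\<lambda>x. 3 * \<bar>f x\<bar>"])
      show "AE x in lborel. (\<lambda>i. \<bar>f x - s i x\<bar>) \<longlonglongrightarrow> 0"
      proof (rule AE_I2)
        fix x assume "x \<in> space (lborel :: 'a measure)"
        from tendsto_diff[OF tendsto_const[of "f x"] lim.hyps(2)[OF this]]
        show "(\<lambda>i. \<bar>f x - s i x\<bar>) \<longlonglongrightarrow> 0" by (simp add: tendsto_rabs_zero)
      qed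
      show "AE x in lborel. norm \<bar>f x - s i x\<bar> \<le> 3 * \<bar>f x\<bar>" for i
      proof (rule AE_I2)
        fix x assume "x \<in> space (lborel :: 'a measure)"
        from lim.hyps(3)[OF this, of i] show "norm \<bar>f x - s i x\<bar> \<le> 3 * \<bar>f x\<bar>" by simp
      qed
    qed (use lim.hyps(1,4) in auto)
    then have "eventually (\<lambda>i. (\<integral>x. \<bar>f x - s i x\<bar> \<partial>lborel) < e) sequentially"
      using e by (auto dest: order_tendstoD)
    then obtain i where "(\<integral>x. \<bar>f x - s i x\<bar> \<partial>lborel) < e" by (auto simp: eventually_sequentially)
    then show "\<exists>g. integrable lborel g \<and> (\<integral>x. \<bar>f x - g x\<bar> \<partial>lborel) < e \<and>
              (\<lambda>n. \<integral>x. \<bar>g (x + Y n) - g x\<bar> \<partial>lborel) \<longlonglongrightarrow> 0"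
      using lim.hyps(1) lim.IH by blast
  qed
qed

text \<open>The case \<open>p > 1\<close> follows from \<open>p = 1\<close> for the bounded functions with bounded support, for which
  \<open>|f(x + y) - f(x)|\<^sup>p \<le> (2 m)\<^sup>p\<^sup>-\<^sup>1 |f(x + y) - f(x)|\<close>, and these are dense.\<close>

lemma pow_int_translation_seq:
  fixes f :: "'a::euclidean_space \<Rightarrow> real"
  assumes p: "p \<ge> 1" and [measurable]: "f \<in> borel_measurable borel" and fin: "pow_int p lborel f < \<infinity>"
    and Y: "Y \<longlonglongrightarrow> 0"
  shows "(\<lambda>n. pow_int p lborel (\<lambda>x. f (x + Y n) - f x)) \<longlonglongrightarrow> 0"
proof (rule tendsto_0_ennrealI)
  fix e :: real assume e: "e > 0"
  define c where "c = 2 powr p * (2 powr p * 2 + 1)"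
  have c: "c > 0" unfolding c_def by (intro mult_pos_pos add_pos_pos) auto
  define g where "g m x = f x * indicator {x. \<bar>f x\<bar> \<le> real m \<and> norm x \<le> real m} x" for m :: nat and x
  have [measurable]: "g m \<in> borel_measurable borel" for m unfolding g_def[abs_def] by measurable
  have "(\<lambda>m. pow_int p lborel (\<lambda>x. g m x - f x)) \<longlonglongrightarrow> 0"
  proof (rule pow_int_dominated[OF p, where G="\<lambda>x. \<bar>f x\<bar>"])
    show "pow_int p lborel (\<lambda>x. \<bar>f x\<bar>) < \<infinity>" using fin by (simp add: pow_int_def)
    show "AE x in lborel. (\<lambda>n. g n x) \<longlonglongrightarrow> f x"
    proof (rule AE_I2, rule tendsto_eventually)
      fix x
      obtain N :: nat where N: "max \<bar>f x\<bar> (norm x) \<le> real N" using real_arch_simple by blast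
      show "eventually (\<lambda>n. g n x = f x) sequentially"
        using eventually_ge_at_top[of N]
      proof eventually_elim
        case (elim n)
        then have "max \<bar>f x\<bar> (norm x) \<le> real n" using N by linarith
        then show ?case by (simp add: g_def)
      qed
    qed
  qed (auto simp: g_def indicator_def)
  then have "eventually (\<lambda>m. pow_int p lborel (\<lambda>x. g m x - f x) < ennreal (e / c)) sequentially"
    using e c by (intro tendsto_0_ennrealD) auto
  then obtain m where m: "pow_int p lborel (\<lambda>x. g m x - f x) < ennreal (e / c)"
    by (auto simp: eventually_sequentially)
  have gm: "\<bar>g m x\<bar> \<le> real m * indicator (cball 0 (real m)) x" for x
    by (auto simp: g_def indicator_def)
  have int: "integrable lborel (g m)"
    by (rule Bochner_Integration.integrable_bound[where f="\<lambda>x. real m * indicator (cball 0 (real m)) x"])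
       (use gm in \<open>auto intro!: integrable_mult_right integrable_real_indicator emeasure_lborel_cball_finite simp: abs_mult\<close>)
  have "(\<lambda>n. (2 * real m) powr (p - 1) * (\<integral>x. \<bar>g m (x + Y n) - g m x\<bar> \<partial>lborel)) \<longlonglongrightarrow> (2 * real m) powr (p - 1) * 0"
    by (intro tendsto_mult_left L1_translation int Y)
  then have ev: "eventually (\<lambda>n. (2 * real m) powr (p - 1) * (\<integral>x. \<bar>g m (x + Y n) - g m x\<bar> \<partial>lborel) < e / c) sequentially"
    using e c by (auto dest: order_tendstoD(2)[of _ _ _ "e / c"])
  have g_le: "pow_int p lborel (\<lambda>x. g m (x + y) - g m x) \<le> ennreal ((2 * real m) powr (p - 1) * (\<integral>x. \<bar>g m (x + y) - g m x\<bar> \<partial>lborel))" for y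
  proof -
    have "\<bar>g m (x + y) - g m x\<bar> powr p \<le> (2 * real m) powr (p - 1) * \<bar>g m (x + y) - g m x\<bar>" for x
    proof (cases "g m (x + y) - g m x = 0")
      case False
      have b: "\<bar>g m x\<bar> \<le> real m" for x by (rule order.trans[OF gm]) (auto simp: indicator_def)
      have "\<bar>g m (x + y) - g m x\<bar> powr p = \<bar>g m (x + y) - g m x\<bar> powr (p - 1) * \<bar>g m (x + y) - g m x\<bar>"
        using False powr_add[of "\<bar>g m (x + y) - g m x\<bar>" "p - 1" 1] by simp
      also have "\<dots> \<le> (2 * real m) powr (p - 1) * \<bar>g m (x + y) - g m x\<bar>"
        using p b[of x] b[of "x + y"] by (intro mult_right_mono powr_mono2) auto
      finally show ?thesis .
    qed (use p in auto)
    then have "pow_int p lborel (\<lambda>x. g m (x + y) - g m x) \<le> (\<integral>\<^sup>+x. ennreal ((2 * real m) powr (p - 1) * \<bar>g m (x + y) - g m x\<bar>) \<partial>lborel)"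
      unfolding pow_int_def by (intro nn_integral_mono ennreal_leI)
    also have "\<dots> = ennreal (\<integral>x. (2 * real m) powr (p - 1) * \<bar>g m (x + y) - g m x\<bar> \<partial>lborel)"
      by (rule nn_integral_eq_integral) (use int integrable_lborel_translate[OF int, of y] in auto)
    finally show ?thesis by simp
  qed
  have main: "pow_int p lborel (\<lambda>x. f (x + y) - f x) \<le> ennreal (2 powr p) * (ennreal (2 powr p) * (ennreal (e / c) + ennreal (e / c)) + ennreal (e / c))"
    if y: "(2 * real m) powr (p - 1) * (\<integral>x. \<bar>g m (x + y) - g m x\<bar> \<partial>lborel) < e / c" for y
  proof -
    let ?r = "\<lambda>x. g m x - f x"
    have "pow_int p lborel (\<lambda>x. f (x + y) - f x) = pow_int p lborel (\<lambda>x. (?r x - ?r (x + y)) + (g m (x + y) - g m x))"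
      by (rule arg_cong[where f="pow_int p lborel"]) auto
    also have "\<dots> \<le> ennreal (2 powr p) * (pow_int p lborel (\<lambda>x. ?r x - ?r (x + y)) + pow_int p lborel (\<lambda>x. g m (x + y) - g m x))"
      by (rule pow_int_add[OF p]) auto
    also have "\<dots> \<le> ennreal (2 powr p) * (ennreal (2 powr p) * (pow_int p lborel ?r + pow_int p lborel (\<lambda>x. ?r (x + y))) + pow_int p lborel (\<lambda>x. g m (x + y) - g m x))"
      by (intro mult_left_mono add_right_mono pow_int_diff[OF p]) auto
    also have "pow_int p lborel (\<lambda>x. ?r (x + y)) = pow_int p lborel ?r"
      using pow_int_translate[of ?r p y] by simp
    also have "ennreal (2 powr p) * (ennreal (2 powr p) * (pow_int p lborel ?r + pow_int p lborel ?r) + pow_int p lborel (\<lambda>x. g m (x + y) - g m x))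
      \<le> ennreal (2 powr p) * (ennreal (2 powr p) * (ennreal (e / c) + ennreal (e / c)) + ennreal (e / c))"
      using m order.trans[OF g_le[of y] ennreal_leI[OF less_imp_le[OF y]]]
      by (intro mult_left_mono add_mono) auto
    finally show ?thesis .
  qed
  also have eq: "ennreal (2 powr p) * (ennreal (2 powr p) * (ennreal (e / c) + ennreal (e / c)) + ennreal (e / c)) = ennreal e"
  proof -
    have "ennreal (2 powr p) * (ennreal (2 powr p) * (ennreal (e / c) + ennreal (e / c)) + ennreal (e / c))
      = ennreal (2 powr p * (2 powr p * (e / c + e / c) + e / c))"
      using e c by (simp add: ennreal_plus[symmetric] ennreal_mult[symmetric] del: ennreal_plus)
    also have "a * (a * (b + b) + b) = (a * (a * 2 + 1)) * b" for a b :: real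
      by (simp add: algebra_simps)
    then have "2 powr p * (2 powr p * (e / c + e / c) + e / c) = c * (e / c)"
      unfolding c_def .
    finally show ?thesis using c by simp
  qed
  show "eventually (\<lambda>n. pow_int p lborel (\<lambda>x. f (x + Y n) - f x) \<le> ennreal e) sequentially"
    using ev by eventually_elim (use main eq in auto)
qed

lemma pow_int_translation:
  fixes f :: "'a::euclidean_space \<Rightarrow> real"
  assumes "p \<ge> 1" "f \<in> borel_measurable borel" "pow_int p lborel f < \<infinity>" "e > 0"
  obtains d where "d > 0" "\<And>y. norm y < d \<Longrightarrow> pow_int p lborel (\<lambda>x. f (x + y) - f x) \<le> ennreal e"
proof -
  have "\<exists>d>0. \<forall>y. norm y < d \<longrightarrow> pow_int p lborel (\<lambda>x. f (x + y) - f x) \<le> ennreal e"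
  proof (rule ccontr)
    assume "\<not> ?thesis"
    then have "\<forall>n. \<exists>y. norm y < inverse (real (Suc n)) \<and> \<not> pow_int p lborel (\<lambda>x. f (x + y) - f x) \<le> ennreal e"
      by (metis inverse_positive_iff_positive of_nat_0_less_iff zero_less_Suc)
    then obtain Y where Y: "\<And>n. norm (Y n) < inverse (real (Suc n))"
       "\<And>n. \<not> pow_int p lborel (\<lambda>x. f (x + Y n) - f x) \<le> ennreal e" by metis
    have "Y \<longlonglongrightarrow> 0"
      by (rule Lim_null_comparison[OF _ LIMSEQ_inverse_real_of_nat]) (use Y(1) in \<open>auto intro!: always_eventually less_imp_le\<close>)
    from pow_int_translation_seq[OF assms(1-3) this]
    have "eventually (\<lambda>n. pow_int p lborel (\<lambda>x. f (x + Y n) - f x) < ennreal e) sequentially"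
      by (rule tendsto_0_ennrealD[OF _ assms(4)])
    then show False using Y(2) by (auto simp: eventually_sequentially not_le dest: order.asym)
  qed
  with that show ?thesis by blast
qed

section \<open>Convolution\<close>

text \<open>Convolution with respect to Lebesgue measure; \<open>0\<close> at points where the integral does not exist.\<close>

definition conv :: "('a::euclidean_space \<Rightarrow> real) \<Rightarrow> ('a \<Rightarrow> real) \<Rightarrow> 'a \<Rightarrow> real" where
  "conv f k x = (\<integral>y. f (x - y) * k y \<partial>lborel)"

lemma indicator_cball_measurable [measurable]:
  "indicator (cball (a::'a::euclidean_space) r) \<in> borel_measurable borel"
  by (rule borel_measurable_indicator) (simp add: borel_closed)

lemma lborel_distr_reflect: "distr lborel borel (\<lambda>y. a - y) = (lborel :: 'a::euclidean_space measure)"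
  using lborel_affine[of "-1" a] by (simp add: density_1)

lemma integral_reflect:
  fixes f :: "'a::euclidean_space \<Rightarrow> real"
  assumes [measurable]: "f \<in> borel_measurable borel"
  shows "(\<integral>y. f (a - y) \<partial>lborel) = (\<integral>y. f y \<partial>lborel)"
  by (subst (2) lborel_distr_reflect[of a, symmetric]) (simp add: integral_distr)

lemma integrable_reflect:
  fixes f :: "'a::euclidean_space \<Rightarrow> real"
  assumes "integrable lborel f"
  shows "integrable lborel (\<lambda>y. f (a - y))"
proof -
  have [measurable]: "f \<in> borel_measurable borel" using borel_measurable_integrable[OF assms] by simp
  have "integrable (distr lborel borel (\<lambda>y. a - y)) f" using assms by (simp add: lborel_distr_reflect)
  then show ?thesis by (subst (asm) integrable_distr_eq) auto
qed

lemma conv_swap: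
  assumes [measurable]: "f \<in> borel_measurable borel" "k \<in> borel_measurable borel"
  shows "conv f k x = (\<integral>y. f y * k (x - y) \<partial>lborel)"
  unfolding conv_def using integral_reflect[of "\<lambda>y. f y * k (x - y)" x] by simp

lemma conv_measurable [measurable]:
  assumes [measurable]: "f \<in> borel_measurable borel" "k \<in> borel_measurable borel"
  shows "conv f k \<in> borel_measurable borel"
  unfolding conv_def[abs_def] by measurable

lemma integrable_mult_bounded:
  fixes f k :: "'a \<Rightarrow> real"
  assumes "integrable M f" "k \<in> borel_measurable M" "\<And>x. \<bar>k x\<bar> \<le> C"
  shows "integrable M (\<lambda>x. f x * k x)"
proof (rule Bochner_Integration.integrable_bound)
  show "integrable M (\<lambda>x. C * \<bar>f x\<bar>)" using assms(1) by auto
  have "\<bar>f x * k x\<bar> \<le> \<bar>C * \<bar>f x\<bar>\<bar>" for x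
    using mult_left_mono[OF assms(3)[of x] abs_ge_zero[of "f x"]]
    by (intro order.trans[OF _ abs_ge_self]) (simp add: abs_mult mult_ac)
  then show "AE x in M. norm (f x * k x) \<le> norm (C * \<bar>f x\<bar>)" by simp
qed (use assms in auto)

lemma integrable_conv_integrand:
  fixes f k :: "'a::euclidean_space \<Rightarrow> real"
  assumes "integrable lborel f" "k \<in> borel_measurable borel" "\<And>x. \<bar>k x\<bar> \<le> C"
  shows "integrable lborel (\<lambda>y. f (x - y) * k y)"
  by (rule integrable_mult_bounded[OF integrable_reflect[OF assms(1)]]) (use assms in auto)

lemma conv_support:
  fixes f k :: "'a::euclidean_space \<Rightarrow> real"
  assumes "\<And>x. norm x > R \<Longrightarrow> f x = 0" "\<And>x. norm x > S \<Longrightarrow> k x = 0" "norm x > R + S"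
  shows "conv f k x = 0"
proof -
  have z: "f (x - y) * k y = 0" for y
  proof (cases "norm y > S")
    case False
    then have "norm (x - y) > R" using assms(3) norm_triangle_ineq2[of x y] by simp
    then show ?thesis using assms(1) by simp
  qed (simp add: assms(2))
  show ?thesis unfolding conv_def z by simp
qed

lemma test_function_linearization:
  fixes k :: "real ^ 'n::finite \<Rightarrow> real"
  assumes k: "k \<in> C0_infty" and e: "e > 0"
  obtains d where "d > 0" "\<And>x h. norm h < d \<Longrightarrow> \<bar>k (x + h) - k x - (\<Sum>j\<in>UNIV. h $ j * partial j k x)\<bar> \<le> e * norm h"
proof -
  define m where "m = e / CARD('n)"
  have m: "m > 0" using e by (simp add: m_def)
  have "\<exists>d>0. \<forall>x y. norm (x - y) < d \<longrightarrow> \<bar>partial j k x - partial j k y\<bar> < m" for j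
    using C0_infty_uniformly_continuous[OF C0_infty_partial[OF k, of j] m] by metis
  then obtain d where d: "\<And>j. d j > 0" "\<And>j x y. norm (x - y) < d j \<Longrightarrow> \<bar>partial j k x - partial j k y\<bar> < m" by metis
  define D where "D = Min (range d)"
  have D: "D > 0" "\<And>j. D \<le> d j" using d(1) by (auto simp: D_def)
  show ?thesis
  proof (rule that[OF D(1)])
    fix x h :: "real ^ 'n" assume h: "norm h < D"
    let ?k' = "\<lambda>x v. \<Sum>j\<in>UNIV. v $ j * partial j k x"
    have "norm (k (x + h) - k x - ?k' x (x + h - x)) \<le> norm (x + h - x) * e"
    proof (rule differentiable_bound_linearization[where S="cball x (norm h)"])
      fix t :: real assume "t \<in> {0..1}"
      then show "x + t *\<^sub>R (x + h - x) \<in> cball x (norm h)"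
        by (auto simp: dist_norm mult_left_le_one_le)
    next
      fix y assume "y \<in> cball x (norm h)"
      show "(k has_derivative ?k' y) (at y within cball x (norm h))"
        by (rule has_derivative_at_withinI, rule smooth_has_derivative_partial[OF C0_infty_smooth[OF k]])
    next
      fix y assume y: "y \<in> cball x (norm h)"
      show "onorm (?k' y - ?k' x) \<le> e"
      proof (rule onorm_le)
        fix v :: "real ^ 'n"
        have "norm ((?k' y - ?k' x) v) = \<bar>\<Sum>j\<in>UNIV. v $ j * (partial j k y - partial j k x)\<bar>"
          by (simp add: sum_subtractf right_diff_distrib)
        also have "\<dots> \<le> (\<Sum>j\<in>(UNIV::'n set). norm v * m)"
        proof (rule order.trans[OF sum_abs], rule sum_mono)
          fix j :: 'n
          have "norm (y - x) < d j" using y h D(2)[of j] by (simp add: dist_norm norm_minus_commute)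
          then have "\<bar>partial j k y - partial j k x\<bar> \<le> m" using d(2) by (simp add: less_imp_le)
          then show "\<bar>v $ j * (partial j k y - partial j k x)\<bar> \<le> norm v * m"
            unfolding abs_mult by (intro mult_mono component_le_norm_cart) auto
        qed
        also have "\<dots> = e * norm v" by (simp add: m_def)
        finally show "norm ((?k' y - ?k' x) v) \<le> e * norm v" .
      qed
    qed auto
    then show "\<bar>k (x + h) - k x - (\<Sum>j\<in>UNIV. h $ j * partial j k x)\<bar> \<le> e * norm h" by (simp add: mult.commute)
  qed
qed

lemma conv_has_derivative:
  fixes f k :: "real ^ 'n::finite \<Rightarrow> real"
  assumes f: "integrable lborel f" and k: "k \<in> C0_infty"
  shows "(conv f k has_derivative (\<lambda>v. \<Sum>j\<in>UNIV. v $ j * conv f (partial j k) x)) (at x)"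
  unfolding has_derivative_at_alt
proof (intro conjI allI impI)
  show "bounded_linear (\<lambda>v::real^'n. \<Sum>j\<in>UNIV. v $ j * conv f (partial j k) x)"
    by (intro bounded_linear_sum bounded_linear_mult_const bounded_linear_vec_nth)
  fix e :: real assume e: "0 < e"
  have [measurable]: "f \<in> borel_measurable borel" "k \<in> borel_measurable borel"
     "\<And>j. partial j k \<in> borel_measurable borel"
    using borel_measurable_integrable[OF f] k C0_infty_partial[OF k] by (auto intro: C0_infty_borel)
  define I where "I = (\<integral>y. \<bar>f y\<bar> \<partial>lborel) + 1"
  have I: "I > 0" unfolding I_def by (intro add_nonneg_pos integral_nonneg_AE) auto
  have eI: "e / I > 0" using e I by simp
  obtain d where d: "d > 0" "\<And>x h. norm h < d \<Longrightarrow> \<bar>k (x + h) - k x - (\<Sum>j\<in>UNIV. h $ j * partial j k x)\<bar> \<le> e / I * norm h"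
    by (rule test_function_linearization[OF k eI]) blast
  have intk: "integrable lborel (\<lambda>y. f y * k (a - y))" for a
  proof -
    obtain B where "\<And>x. \<bar>k x\<bar> \<le> B" using C0_infty_bounded[OF k] by metis
    then show ?thesis by (intro integrable_mult_bounded[OF f]) auto
  qed
  have intp: "integrable lborel (\<lambda>y. f y * partial j k (a - y))" for a j
  proof -
    obtain B where "\<And>x. \<bar>partial j k x\<bar> \<le> B" using C0_infty_bounded[OF C0_infty_partial[OF k]] by metis
    then show ?thesis by (intro integrable_mult_bounded[OF f]) auto
  qed
  show "\<exists>d>0. \<forall>y. norm (y - x) < d \<longrightarrow>
     norm (conv f k y - conv f k x - (\<Sum>j\<in>UNIV. (y - x) $ j * conv f (partial j k) x)) \<le> e * norm (y - x)"
  proof (intro exI[of _ d] conjI allI impI d(1))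
    fix z :: "real ^ 'n" assume z: "norm (z - x) < d"
    define h where "h = z - x"
    have zh: "z = x + h" by (simp add: h_def)
    let ?R = "\<lambda>y. k (x - y + h) - k (x - y) - (\<Sum>j\<in>UNIV. h $ j * partial j k (x - y))"
    have eq: "f y * ?R y = f y * k (z - y) - f y * k (x - y) - (\<Sum>j\<in>UNIV. h $ j * (f y * partial j k (x - y)))" for y
      by (simp add: zh algebra_simps sum_distrib_left)
    have "conv f k z - conv f k x - (\<Sum>j\<in>UNIV. (z - x) $ j * conv f (partial j k) x) = (\<integral>y. f y * ?R y \<partial>lborel)"
    proof -
      have "(\<integral>y. f y * ?R y \<partial>lborel) = (\<integral>y. f y * k (z - y) \<partial>lborel) - (\<integral>y. f y * k (x - y) \<partial>lborel)
         - (\<Sum>j\<in>UNIV. \<integral>y. h $ j * (f y * partial j k (x - y)) \<partial>lborel)"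
        unfolding eq
        by (simp only: Bochner_Integration.integral_diff[OF Bochner_Integration.integrable_diff[OF intk intk] Bochner_Integration.integrable_sum[OF integrable_mult_right[OF intp]]]
            Bochner_Integration.integral_diff[OF intk intk] Bochner_Integration.integral_sum[OF integrable_mult_right[OF intp]])
      then show ?thesis unfolding h_def[symmetric] by (simp only: conv_swap \<open>f \<in> borel_measurable borel\<close>
          \<open>k \<in> borel_measurable borel\<close> \<open>\<And>j. partial j k \<in> borel_measurable borel\<close> integral_mult_right_zero)
    qed
    also have "\<bar>\<dots>\<bar> \<le> (\<integral>y. \<bar>f y\<bar> * (e / I * norm h) \<partial>lborel)"
    proof (rule order.trans[OF integral_abs_bound], rule integral_mono)
      show "integrable lborel (\<lambda>y. \<bar>f y * ?R y\<bar>)"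
        unfolding eq using intk intp by (intro integrable_abs Bochner_Integration.integrable_diff Bochner_Integration.integrable_sum integrable_mult_right) auto
      show "integrable lborel (\<lambda>y. \<bar>f y\<bar> * (e / I * norm h))" using f by auto
      show "\<bar>f y * ?R y\<bar> \<le> \<bar>f y\<bar> * (e / I * norm h)" for y
        unfolding abs_mult using z by (intro mult_left_mono d(2)) (auto simp: h_def)
    qed
    also have "\<dots> = (I - 1) * (e / I * norm h)" unfolding I_def by simp
    also have "\<dots> \<le> I * (e / I * norm h)" using I e by (intro mult_right_mono) auto
    also have "\<dots> = e * norm (z - x)" using I by (simp add: h_def)
    finally show "norm (conv f k z - conv f k x - (\<Sum>j\<in>UNIV. (z - x) $ j * conv f (partial j k) x)) \<le> e * norm (z - x)"
      by simp
  qed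
qed

lemma C_k_sum: "finite A \<Longrightarrow> (\<And>i. i \<in> A \<Longrightarrow> C_k m (f i)) \<Longrightarrow> C_k m (\<lambda>x. \<Sum>i\<in>A. f i x)"
  by (induction A rule: finite_induct) (auto simp: C_k_const intro!: C_k_add)

lemma smooth_conv:
  fixes f k :: "real ^ 'n::finite \<Rightarrow> real"
  assumes f: "integrable lborel f" and k: "k \<in> C0_infty"
  shows "smooth (conv f k)"
  unfolding smooth_def
proof
  fix m show "C_k m (conv f k)" using k
  proof (induction m arbitrary: k)
    case 0
    show ?case using conv_has_derivative[OF f 0]
      by (auto simp: continuous_on_eq_continuous_at intro: has_derivative_continuous)
  next
    case (Suc m)
    show ?case
      by (rule C_k_SucI, rule conv_has_derivative[OF f Suc.prems])
         (intro C_k_sum C_k_mult C_k_const Suc.IH C0_infty_partial Suc.prems, auto)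
  qed
qed

lemma partial_conv:
  fixes f k :: "real ^ 'n::finite \<Rightarrow> real"
  assumes f: "integrable lborel f" and k: "k \<in> C0_infty"
  shows "partial i (conv f k) x = conv f (partial i k) x"
  by (subst partial_eqI[OF conv_has_derivative[OF f k]]) (simp add: axis_def if_distrib if_distribR cong: if_cong)

subsection \<open>Approximate identities\<close>

text \<open>The rescaled kernels \<open>k\<^sub>n(y) = N\<^sup>d k(N y)\<close> with \<open>N = n + 1\<close>; all of them have the same integral.\<close>

definition dil :: "nat \<Rightarrow> ('a::euclidean_space \<Rightarrow> real) \<Rightarrow> 'a \<Rightarrow> real" where
  "dil n k y = real (Suc n) ^ DIM('a) * k (real (Suc n) *\<^sub>R y)"

lemma nn_integral_dil:
  fixes k :: "'a::euclidean_space \<Rightarrow> real"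
  assumes [measurable]: "k \<in> borel_measurable borel"
  shows "(\<integral>\<^sup>+y. ennreal \<bar>dil n k y\<bar> \<partial>lborel) = (\<integral>\<^sup>+y. ennreal \<bar>k y\<bar> \<partial>lborel)"
proof -
  have "(\<integral>\<^sup>+y. ennreal \<bar>k y\<bar> \<partial>lborel) = (\<integral>\<^sup>+y. ennreal (real (Suc n) ^ DIM('a)) * ennreal \<bar>k (real (Suc n) *\<^sub>R y)\<bar> \<partial>lborel)"
    by (subst lborel_affine[of "real (Suc n)" 0]) (auto simp: nn_integral_density nn_integral_distr nn_integral_cmult)
  also have "\<dots> = (\<integral>\<^sup>+y. ennreal \<bar>dil n k y\<bar> \<partial>lborel)"
    by (rule nn_integral_cong) (simp add: dil_def abs_mult ennreal_mult)
  finally show ?thesis ..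
qed

lemma integral_dil:
  fixes k :: "'a::euclidean_space \<Rightarrow> real"
  assumes [measurable]: "k \<in> borel_measurable borel"
  shows "(\<integral>y. dil n k y \<partial>lborel) = (\<integral>y. k y \<partial>lborel)"
proof -
  have "(\<integral>y. k y \<partial>lborel) = (\<integral>y. real (Suc n) ^ DIM('a) * k (real (Suc n) *\<^sub>R y) \<partial>lborel)"
    by (subst lborel_affine[of "real (Suc n)" 0]) (auto simp: integral_density integral_distr)
  then show ?thesis by (simp add: dil_def)
qed

lemma dil_measurable [measurable]:
  fixes k :: "'a::euclidean_space \<Rightarrow> real"
  assumes [measurable]: "k \<in> borel_measurable borel"
  shows "dil n k \<in> borel_measurable borel"
  unfolding dil_def[abs_def] by measurable

lemma dil_support:
  assumes "\<And>y. norm y > 1 \<Longrightarrow> k y = 0" "dil n k y \<noteq> 0"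
  shows "norm y \<le> 1 / real (Suc n)"
proof (rule ccontr)
  assume "\<not> ?thesis"
  then have "norm (real (Suc n) *\<^sub>R y) > 1" by (simp add: field_simps del: of_nat_Suc)
  then show False using assms unfolding dil_def by auto
qed

text \<open>The kernel need neither be nonnegative nor have integral \<open>1\<close>: besides the mollifier this is applied to
  \<open>y\<^sub>j \<partial>\<^sub>i\<rho>(y)\<close>.\<close>

lemma approximate_identity:
  fixes f k :: "'a::euclidean_space \<Rightarrow> real"
  assumes p: "p \<ge> 1" and f: "integrable lborel f" and fin: "pow_int p lborel f < \<infinity>"
    and k[measurable]: "k \<in> borel_measurable borel" and kb: "\<And>y. \<bar>k y\<bar> \<le> C" and ks: "\<And>y. norm y > 1 \<Longrightarrow> k y = 0"
  shows "(\<lambda>n. pow_int p lborel (\<lambda>x. conv f (dil n k) x - (\<integral>y. k y \<partial>lborel) * f x)) \<longlonglongrightarrow> 0"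
proof (rule tendsto_0_ennrealI)
  fix e :: real assume e: "e > 0"
  have [measurable]: "f \<in> borel_measurable borel" using borel_measurable_integrable[OF f] by simp
  have kb1: "\<bar>k y\<bar> \<le> C * indicator (cball 0 1) y" for y using kb[of y] ks[of y] by (auto simp: indicator_def)
  have intk: "integrable lborel k"
    by (rule Bochner_Integration.integrable_bound[where f="\<lambda>x. C * indicator (cball 0 1) x"])
       (use kb1 in \<open>auto intro!: integrable_mult_right integrable_real_indicator emeasure_lborel_cball_finite
          simp: less_top[symmetric] order.trans[OF _ abs_ge_self]\<close>)
  define K where "K = (\<integral>y. \<bar>k y\<bar> \<partial>lborel) + 1"
  have K: "K > 0" unfolding K_def by (intro add_nonneg_pos integral_nonneg_AE) auto
  have Kn: "(\<integral>\<^sup>+y. ennreal \<bar>dil n k y\<bar> \<partial>lborel) \<le> ennreal K" for n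
    unfolding nn_integral_dil[OF k] using intk by (subst nn_integral_eq_integral) (auto simp: K_def intro!: ennreal_leI)
  have dilb: "\<bar>dil n k y\<bar> \<le> real (Suc n) ^ DIM('a) * C" for n y
    unfolding dil_def abs_mult using kb by (auto intro!: mult_left_mono)
  have intdil: "integrable lborel (dil n k)" for n
    unfolding integrable_iff_bounded using Kn[of n] by (auto intro: le_less_trans)
  obtain d where d: "d > 0" "\<And>y. norm y < d \<Longrightarrow> pow_int p lborel (\<lambda>x. f (x + y) - f x) \<le> ennreal (e / K powr p)"
    using pow_int_translation[OF p _ fin, of "e / K powr p"] e K by auto
  obtain N :: nat where N: "inverse (real (Suc N)) < d" using reals_Archimedean[OF d(1)] by blast
  show "eventually (\<lambda>n. pow_int p lborel (\<lambda>x. conv f (dil n k) x - (\<integral>y. k y \<partial>lborel) * f x) \<le> ennreal e) sequentially"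
    using eventually_ge_at_top[of N]
  proof eventually_elim
    case (elim n)
    have "conv f (dil n k) x - (\<integral>y. k y \<partial>lborel) * f x = (\<integral>y. (f (x - y) - f x) * dil n k y \<partial>lborel)" for x
    proof -
      have "(\<integral>y. (f (x - y) - f x) * dil n k y \<partial>lborel) = (\<integral>y. f (x - y) * dil n k y - f x * dil n k y \<partial>lborel)"
        by (simp add: left_diff_distrib)
      also have "\<dots> = conv f (dil n k) x - f x * (\<integral>y. dil n k y \<partial>lborel)"
        unfolding conv_def using integrable_conv_integrand[OF f _ dilb[of n], where x=x] intdil[of n]
        by (subst Bochner_Integration.integral_diff) auto
      finally show ?thesis by (simp add: integral_dil mult.commute)
    qed
    then have "pow_int p lborel (\<lambda>x. conv f (dil n k) x - (\<integral>y. k y \<partial>lborel) * f x)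
        = pow_int p lborel (\<lambda>x. \<integral>y. (f (x - y) - f x) * dil n k y \<partial>lborel)" by simp
    also have "\<dots> \<le> ennreal (K powr p) * ennreal (e / K powr p)"
    proof (rule pow_int_kernel[OF p K Kn sigma_finite_lborel sigma_finite_lborel])
      fix y assume "dil n k y \<noteq> 0"
      then have "norm y \<le> 1 / real (Suc n)" by (intro dil_support[of k]) (use ks in auto)
      also have "\<dots> \<le> 1 / real (Suc N)" using elim by (intro divide_left_mono) auto
      also have "\<dots> < d" using N by (simp add: inverse_eq_divide)
      finally show "pow_int p lborel (\<lambda>x. f (x - y) - f x) \<le> ennreal (e / K powr p)"
        using d(2)[of "- y"] by simp
    qed measurable
    also have "\<dots> = ennreal e" using K e by (subst ennreal_mult[symmetric]) auto
    finally show ?case .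
  qed
qed

text \<open>The standard mollifier: the bump function, normalised to integral \<open>1\<close>.\<close>

definition rho :: "real ^ 'n::finite \<Rightarrow> real" where
  "rho x = bump x / (\<integral>y. bump (y :: real ^ 'n) \<partial>lborel)"

lemma integral_bump_pos: "(\<integral>y. bump (y :: real ^ 'n::finite) \<partial>lborel) > 0"
proof (rule ccontr)
  assume "\<not> ?thesis"
  moreover have "(\<integral>y. bump (y :: real ^ 'n) \<partial>lborel) \<ge> 0" by (rule integral_nonneg_AE) (simp add: bump_nonneg)
  ultimately have "(\<integral>y. bump (y :: real ^ 'n) \<partial>lborel) = 0" by simp
  moreover have "(\<integral>y. bump (y :: real ^ 'n) \<partial>lborel) = 0 \<longleftrightarrow> (AE y in lborel. bump (y :: real ^ 'n) = 0)"
    by (rule integral_nonneg_eq_0_iff_AE[OF C0_infty_integrable[OF C0_infty_bump]]) (simp add: bump_nonneg)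
  ultimately have "AE y in lborel. bump (y :: real ^ 'n) = 0" by blast
  moreover have "open {y :: real ^ 'n. bump y \<noteq> 0}"
    using C0_infty_continuous[OF C0_infty_bump] by (intro open_Collect_neq continuous_on_const)
  moreover have "{y :: real ^ 'n. bump y \<noteq> 0} \<in> sets borel"
    using calculation(2) by simp
  ultimately have "{y :: real ^ 'n. bump y \<noteq> 0} \<in> null_sets lborel"
    using AE_iff_null[of lborel "\<lambda>y :: real ^ 'n. bump y = 0"] by simp
  then have "negligible {y :: real ^ 'n. bump y \<noteq> 0}"
    by (auto simp: negligible_iff_null_sets intro: null_sets_completionI)
  then have "{y :: real ^ 'n. bump y \<noteq> 0} = {}"
    using \<open>open {y :: real ^ 'n. bump y \<noteq> 0}\<close> open_not_negligible by blast
  then show False using bump_0_pos by (metis (mono_tags) empty_iff less_irrefl mem_Collect_eq)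
qed

lemma C0_infty_rho: "rho \<in> C0_infty"
  unfolding rho_def[abs_def] divide_inverse
  by (rule C0_infty_mult_smooth[OF C0_infty_bump smooth_const])

lemma rho_nonneg: "rho x \<ge> 0"
  unfolding rho_def using integral_bump_pos bump_nonneg by (intro divide_nonneg_nonneg) (auto intro: less_imp_le)

lemma integral_rho: "(\<integral>x. rho (x :: real ^ 'n::finite) \<partial>lborel) = 1"
  unfolding rho_def using integral_bump_pos[where 'n='n] by simp

lemma rho_support: "norm x > 1 \<Longrightarrow> rho x = 0"
  by (simp add: rho_def bump_support)

lemma C0_infty_dil:
  assumes "k \<in> C0_infty" shows "dil n k \<in> C0_infty"
proof -
  have "(\<lambda>x. k (real (Suc n) *\<^sub>R x + 0) * real (Suc n) ^ DIM('a)) \<in> C0_infty"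
    by (intro C0_infty_mult_smooth C0_infty_compose_affine assms smooth_const) simp
  then show ?thesis by (simp add: dil_def[abs_def] mult.commute)
qed

lemma partial_dil:
  fixes k :: "real ^ 'n::finite \<Rightarrow> real"
  assumes "k \<in> C0_infty"
  shows "partial i (dil n k) x = real (Suc n) * dil n (partial i k) x"
proof -
  have 1: "smooth (\<lambda>x. k (real (Suc n) *\<^sub>R x + 0))"
    by (rule C0_infty_smooth[OF C0_infty_compose_affine[OF assms]]) simp
  have "partial i (\<lambda>x. real (Suc n) ^ DIM(real^'n) * k (real (Suc n) *\<^sub>R x + 0)) x
     = real (Suc n) ^ DIM(real^'n) * (real (Suc n) * partial i k (real (Suc n) *\<^sub>R x + 0))"
    by (subst partial_mult[OF smooth_const 1])
       (subst partial_compose_affine[OF C0_infty_smooth[OF assms]], simp add: partial_def)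
  then show ?thesis by (simp add: dil_def[abs_def] mult_ac)
qed

subsection \<open>Integration by parts\<close>

lemma has_derivative_along_line:
  fixes f :: "real ^ 'n::finite \<Rightarrow> real"
  assumes "\<And>x. f differentiable (at x)"
  shows "((\<lambda>t. f (x + t *\<^sub>R axis i 1)) has_real_derivative partial i f (x + t *\<^sub>R axis i 1)) (at t)"
proof -
  have D: "(f has_derivative frechet_derivative f (at y)) (at y)" for y
    using assms frechet_derivative_works by blast
  have "((\<lambda>t. f (x + t *\<^sub>R axis i 1)) has_derivative (\<lambda>s. frechet_derivative f (at (x + t *\<^sub>R axis i 1)) (s *\<^sub>R axis i 1))) (at t)"
    by (rule has_derivative_compose[OF _ D]) (auto intro!: derivative_eq_intros)
  moreover have "frechet_derivative f (at y) (s *\<^sub>R axis i 1) = partial i f y * s" for y s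
    using linear_cmul[OF has_derivative_linear[OF D[of y]], of s "axis i 1"] by (simp add: partial_def)
  ultimately show ?thesis by (simp add: has_field_derivative_def)
qed

text \<open>The difference quotients of \<open>f\<close> have integral \<open>0\<close> by translation invariance, and they converge to the
  derivative boundedly.\<close>

lemma integral_partial_eq_0:
  fixes f :: "real ^ 'n::finite \<Rightarrow> real"
  assumes diff: "\<And>x. f differentiable (at x)" and supp: "\<And>x. norm x > R \<Longrightarrow> f x = 0"
    and bd: "\<And>x. \<bar>partial i f x\<bar> \<le> C"
  shows "(\<integral>x. partial i f x \<partial>lborel) = 0"
proof -
  have "continuous_on UNIV f"
    using diff by (intro differentiable_imp_continuous_on) (auto simp: differentiable_on_def)
  then have [measurable]: "f \<in> borel_measurable borel" by (rule borel_measurable_continuous_onI)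
  obtain B where B: "\<And>x. \<bar>f x\<bar> \<le> B * indicator (cball 0 R) x"
  proof -
    have "bounded (f ` cball 0 R)"
      by (intro compact_imp_bounded compact_continuous_image continuous_on_subset[OF \<open>continuous_on UNIV f\<close>]) auto
    then obtain B where B: "\<And>x. x \<in> cball 0 R \<Longrightarrow> norm (f x) \<le> B" unfolding bounded_iff by blast
    show ?thesis by (rule that[of B]) (use B supp in \<open>auto simp: indicator_def\<close>)
  qed
  have intf: "integrable lborel f"
    by (rule Bochner_Integration.integrable_bound[where f="\<lambda>x. B * indicator (cball 0 R) x"])
       (use B in \<open>auto intro!: integrable_mult_right integrable_real_indicator emeasure_lborel_cball_finite
          simp: less_top[symmetric] order.trans[OF _ abs_ge_self]\<close>)
  define t where "t n = 1 / real (Suc n)" for n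
  have t: "t n > 0" "t n \<le> 1" for n by (auto simp: t_def)
  have t0: "t \<longlonglongrightarrow> 0" unfolding t_def[abs_def] using LIMSEQ_inverse_real_of_nat by (simp add: inverse_eq_divide)
  define q where "q n x = (f (x + t n *\<^sub>R axis i 1) - f x) / t n" for n x
  have [measurable]: "q n \<in> borel_measurable borel" for n unfolding q_def[abs_def] by measurable
  have lim: "(\<lambda>n. q n x) \<longlonglongrightarrow> partial i f x" for x
  proof -
    have "((\<lambda>h. (f (x + h *\<^sub>R axis i 1) - f x) / h) \<longlongrightarrow> partial i f x) (at 0)"
      using has_derivative_along_line[OF diff, of x i 0] by (simp add: DERIV_def)
    moreover have "filterlim t (at 0) sequentially"
      using t0 t(1) by (auto simp: filterlim_at less_imp_neq[symmetric])
    ultimately show ?thesis unfolding q_def by (rule filterlim_compose)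
  qed
  have [measurable]: "partial i f \<in> borel_measurable borel"
    by (rule borel_measurable_LIMSEQ_real[OF lim]) simp
  have "(\<lambda>n. \<integral>x. q n x \<partial>lborel) \<longlonglongrightarrow> (\<integral>x. partial i f x \<partial>lborel)"
  proof (rule integral_dominated_convergence[where w="\<lambda>x. C * indicator (cball 0 (R + 1)) x"])
    show "integrable lborel (\<lambda>x. C * indicator (cball 0 (R + 1)) x)"
      by (auto intro!: integrable_mult_right integrable_real_indicator emeasure_lborel_cball_finite simp: less_top[symmetric])
    show "AE x in lborel. norm (q n x) \<le> C * indicator (cball 0 (R + 1)) x" for n
    proof (rule AE_I2)
      fix x :: "real ^ 'n"
      obtain s where s: "s > 0" "s < t n" "f (x + t n *\<^sub>R axis i 1) - f (x + 0 *\<^sub>R axis i 1) = (t n - 0) * partial i f (x + s *\<^sub>R axis i 1)"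
        using MVT2[OF t(1)[of n], of "\<lambda>t. f (x + t *\<^sub>R axis i 1)" "\<lambda>t. partial i f (x + t *\<^sub>R axis i 1)"]
          has_derivative_along_line[OF diff] by blast
      then have q: "q n x = partial i f (x + s *\<^sub>R axis i 1)" using t(1)[of n] by (simp add: q_def)
      show "norm (q n x) \<le> C * indicator (cball 0 (R + 1)) x"
      proof (cases "norm x \<le> R + 1")
        case True
        then show ?thesis using bd by (simp add: q)
      next
        case False
        have "norm (x + t n *\<^sub>R axis i 1) \<ge> norm x - t n"
          using norm_diff_ineq[of x "t n *\<^sub>R axis i 1"] t(1)[of n] by (simp add: norm_axis_1)
        then have "norm (x + t n *\<^sub>R axis i 1) > R" using False t(2)[of n] by linarith
        then show ?thesis using supp False by (simp add: q_def)
      qed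
    qed
  qed (use lim in auto)
  moreover have "(\<integral>x. q n x \<partial>lborel) = 0" for n
    unfolding q_def using intf integrable_lborel_translate[OF intf] by (simp add: integral_lborel_translate)
  ultimately show ?thesis by (simp add: LIMSEQ_const_iff)
qed

lemma C0_infty_integral_partial: "f \<in> C0_infty \<Longrightarrow> (\<integral>x. partial i f x \<partial>lborel) = 0"
proof -
  assume f: "f \<in> C0_infty"
  obtain R where R: "\<And>x. norm x > R \<Longrightarrow> f x = 0" using C0_infty_support[OF f] by metis
  obtain C where C: "\<And>x. \<bar>partial i f x\<bar> \<le> C" using C0_infty_bounded[OF C0_infty_partial[OF f]] by metis
  show ?thesis
    using smooth_has_derivative[OF C0_infty_smooth[OF f]]
    by (intro integral_partial_eq_0[OF _ R C]) (auto simp: differentiable_def)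
qed

lemma integral_coord_partial_rho:
  "(\<integral>y. y $ j * partial i rho y \<partial>lborel) = (if i = j then - 1 else 0 :: real)"
  for i j :: "'n::finite"
proof -
  let ?r = "rho :: real ^ 'n \<Rightarrow> real"
  have 1: "partial i (\<lambda>y. ?r y * y $ j) y = (if i = j then ?r y else 0) + y $ j * partial i ?r y" for y
  proof -
    have "partial i (\<lambda>y::real^'n. y $ j) y = (if i = j then 1 else 0)"
      by (subst partial_eqI[OF bounded_linear_imp_has_derivative[OF bounded_linear_vec_nth]]) (simp add: axis_def)
    then show ?thesis
      by (subst partial_mult[OF C0_infty_smooth[OF C0_infty_rho] smooth_coord]) (simp add: mult.commute)
  qed
  have 2: "(\<lambda>y. partial i ?r y * y $ j) \<in> C0_infty"
    by (rule C0_infty_mult_smooth[OF C0_infty_partial[OF C0_infty_rho] smooth_coord])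
  have "0 = (\<integral>y. partial i (\<lambda>y. ?r y * y $ j) y \<partial>lborel)"
    by (rule C0_infty_integral_partial[symmetric], rule C0_infty_mult_smooth[OF C0_infty_rho smooth_coord])
  also have "\<dots> = (\<integral>y. (if i = j then ?r y else 0) \<partial>lborel) + (\<integral>y. y $ j * partial i ?r y \<partial>lborel)"
    unfolding 1 using C0_infty_integrable[OF 2] C0_infty_integrable[OF C0_infty_rho]
    by (subst Bochner_Integration.integral_add) (cases "i = j"; auto simp: mult.commute)+
  finally show ?thesis by (auto simp: integral_rho split: if_splits)
qed

subsection \<open>Cut-off functions\<close>

text \<open>Equal to \<open>1\<close> on the ball of radius \<open>R\<close> and to \<open>0\<close> outside that of radius \<open>R + 2\<close>. As a mollified indicator
  it has derivatives that are bounded independently of \<open>R\<close>.\<close>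

definition cutoff :: "real \<Rightarrow> real ^ 'n::finite \<Rightarrow> real" where
  "cutoff R = conv (indicator (cball 0 (R + 1))) rho"

lemma integrable_indicator_cball: "integrable lborel (indicator (cball (a::'a::euclidean_space) r) :: 'a \<Rightarrow> real)"
  by (auto intro!: integrable_real_indicator emeasure_lborel_cball_finite simp: less_top[symmetric])

lemma cutoff_support: "norm x > R + 2 \<Longrightarrow> cutoff R x = 0"
  unfolding cutoff_def by (rule conv_support[where R="R + 1" and S=1]) (auto simp: rho_support)

lemma C0_infty_cutoff: "cutoff R \<in> C0_infty"
  by (rule C0_inftyI[OF _ cutoff_support]) (unfold cutoff_def, rule smooth_conv[OF integrable_indicator_cball C0_infty_rho])

lemma cutoff_eq_1: "norm x \<le> R \<Longrightarrow> cutoff R (x :: real ^ 'n::finite) = 1"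
proof -
  assume x: "norm x \<le> R"
  have z: "indicator (cball 0 (R + 1)) (x - y) * rho y = rho y" for y
  proof (cases "norm y \<le> 1")
    case True
    then have "norm (x - y) \<le> R + 1" using x norm_triangle_ineq4[of x y] by simp
    then show ?thesis by simp
  qed (simp add: rho_support)
  show ?thesis unfolding cutoff_def conv_def z by (rule integral_rho)
qed

lemma cutoff_bounds: "0 \<le> cutoff R x" "cutoff R x \<le> 1"
proof -
  have int: "integrable lborel (\<lambda>y. indicator (cball 0 (R + 1)) (x - y) * rho y)"
  proof -
    obtain B where "\<And>x. \<bar>rho (x::real^'a)\<bar> \<le> B" using C0_infty_bounded[OF C0_infty_rho] by metis
    then show ?thesis
      by (intro integrable_conv_integrand integrable_indicator_cball) (auto intro: C0_infty_borel C0_infty_rho)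
  qed
  show "0 \<le> cutoff R x" unfolding cutoff_def conv_def
    by (intro integral_nonneg_AE AE_I2) (auto intro!: mult_nonneg_nonneg rho_nonneg)
  have "cutoff R x \<le> (\<integral>y. rho (y :: real^'a) \<partial>lborel)"
    unfolding cutoff_def conv_def
    by (rule integral_mono[OF int C0_infty_integrable[OF C0_infty_rho]]) (auto simp: indicator_def rho_nonneg)
  then show "cutoff R x \<le> 1" by (simp add: integral_rho)
qed

lemma partial_eq_0_if_const:
  fixes f :: "real ^ 'n::finite \<Rightarrow> real"
  assumes "open S" "x \<in> S" "\<And>y. y \<in> S \<Longrightarrow> f y = c"
  shows "partial i f x = 0"
proof -
  have "(f has_derivative (\<lambda>v. 0)) (at x)"
    by (rule has_derivative_transform_within_open[OF _ assms(1,2), of "\<lambda>_. c"]) (use assms(3) in auto)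
  then show ?thesis by (simp add: partial_eqI)
qed

lemma partial_cutoff_eq_0: "norm x < R \<Longrightarrow> partial i (cutoff R) (x :: real ^ 'n::finite) = 0"
  by (rule partial_eq_0_if_const[of "ball 0 R" _ _ 1]) (auto simp: cutoff_eq_1)

lemma partial_cutoff_bounded:
  obtains C where "C > 0" "\<And>R x. \<bar>partial i (cutoff R) (x :: real ^ 'n::finite)\<bar> \<le> C"
proof -
  define C where "C = (\<integral>y. \<bar>partial i (rho :: real ^ 'n \<Rightarrow> real) y\<bar> \<partial>lborel)"
  have int: "integrable lborel (partial i (rho :: real ^ 'n \<Rightarrow> real))"
    by (rule C0_infty_integrable[OF C0_infty_partial[OF C0_infty_rho]])
  have "\<bar>partial i (cutoff R) x\<bar> \<le> C" for R and x :: "real ^ 'n"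
    unfolding cutoff_def partial_conv[OF integrable_indicator_cball C0_infty_rho] conv_def C_def
  proof (rule order.trans[OF integral_abs_bound], rule integral_mono)
    show "integrable lborel (\<lambda>y. \<bar>indicator (cball 0 (R + 1)) (x - y) * partial i rho y\<bar>)"
      by (rule integrable_abs, rule Bochner_Integration.integrable_bound[OF int])
         (use C0_infty_borel[OF C0_infty_partial[OF C0_infty_rho]] in \<open>measurable, auto simp: indicator_def\<close>)
  qed (use int in \<open>auto simp: indicator_def\<close>)
  moreover have "C \<ge> 0" unfolding C_def by (rule integral_nonneg_AE) auto
  ultimately show ?thesis by (intro that[of "C + 1"]) (auto intro: add_increasing2)
qed

section \<open>Weak partial derivatives\<close>

text \<open>Borel functions that are integrable on every ball.\<close>

definition loc_int :: "('a::euclidean_space \<Rightarrow> real) \<Rightarrow> bool" where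
  "loc_int u \<longleftrightarrow> u \<in> borel_measurable borel \<and> (\<forall>R. integrable lborel (\<lambda>x. indicator (cball 0 R) x * u x))"

text \<open>The Borel function \<open>g\<close> is a weak partial derivative of \<open>u\<close> in the \<open>i\<close>-th coordinate direction.\<close>

definition wder :: "'n::finite \<Rightarrow> (real ^ 'n \<Rightarrow> real) \<Rightarrow> (real ^ 'n \<Rightarrow> real) \<Rightarrow> bool" where
  "wder i u g \<longleftrightarrow> loc_int u \<and> loc_int g \<and>
     (\<forall>\<eta>\<in>C0_infty. (\<integral>x. u x * partial i \<eta> x \<partial>lborel) = - (\<integral>x. g x * \<eta> x \<partial>lborel))"

lemma loc_int_measurable: "loc_int u \<Longrightarrow> u \<in> borel_measurable borel"
  by (simp add: loc_int_def)

lemma wder_measurable: "wder i u g \<Longrightarrow> u \<in> borel_measurable borel" "wder i u g \<Longrightarrow> g \<in> borel_measurable borel"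
  by (simp_all add: wder_def loc_int_def)

lemma loc_int_bound:
  assumes "loc_int u" "v \<in> borel_measurable borel" "AE x in lborel. \<bar>v x\<bar> \<le> \<bar>u x\<bar>"
  shows "loc_int v"
  unfolding loc_int_def
proof (intro conjI allI)
  fix R
  note [measurable] = assms(2)
  have m: "(\<lambda>x. indicator (cball 0 R) x * v x) \<in> borel_measurable lborel" by measurable
  show "integrable lborel (\<lambda>x. indicator (cball 0 R) x * v x)"
    by (rule Bochner_Integration.integrable_bound[where f="\<lambda>x. indicator (cball 0 R) x * u x"])
       (use assms m in \<open>auto simp: loc_int_def abs_mult elim!: eventually_mono intro: mult_left_mono\<close>)
qed fact

lemma loc_int_add: "loc_int u \<Longrightarrow> loc_int v \<Longrightarrow> loc_int (\<lambda>x. u x + v x)"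
  by (auto simp: loc_int_def distrib_left)

lemma loc_int_cmult: "loc_int u \<Longrightarrow> loc_int (\<lambda>x. c * u x)"
  using integrable_mult_right[of c lborel]
  by (auto simp: loc_int_def mult.left_commute[of _ c])

lemma loc_int_abs: "loc_int u \<Longrightarrow> loc_int (\<lambda>x. \<bar>u x\<bar>)"
  by (rule loc_int_bound, assumption) (auto intro!: borel_measurable_abs dest: loc_int_measurable)

lemma loc_int_const: "loc_int (\<lambda>x. c)"
  using integrable_indicator_cball by (auto simp: loc_int_def)

lemma loc_int_integrable:
  assumes "integrable lborel u" shows "loc_int u"
proof -
  have "integrable lborel (\<lambda>x. u x * indicator (cball 0 R) x)" for R
    by (rule integrable_mult_bounded[OF assms, where C=1]) (use indicator_cball_measurable in auto)
  then show ?thesis using borel_measurable_integrable[OF assms] by (simp add: loc_int_def mult.commute)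
qed

lemma loc_int_mult_bounded:
  assumes "loc_int u" "k \<in> borel_measurable borel" "\<And>x. \<bar>k x\<bar> \<le> C"
  shows "loc_int (\<lambda>x. k x * u x)"
proof (rule loc_int_bound)
  show "loc_int (\<lambda>x. C * u x)" by (rule loc_int_cmult[OF assms(1)])
  have "0 \<le> C" using assms(3) abs_ge_zero order.trans by blast
  then show "AE x in lborel. \<bar>k x * u x\<bar> \<le> \<bar>C * u x\<bar>"
    using assms(3) by (auto simp: abs_mult intro!: mult_right_mono)
qed (use assms in \<open>auto dest: loc_int_measurable\<close>)

lemma loc_int_mult_support:
  assumes "loc_int u" "k \<in> borel_measurable borel" "\<And>x. \<bar>k x\<bar> \<le> C * indicator (cball 0 R) x"
  shows "integrable lborel (\<lambda>x. u x * k x)"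
proof -
  have "integrable lborel (\<lambda>x. (indicator (cball 0 R) x * u x) * k x)"
  proof (rule integrable_mult_bounded)
    show "\<bar>k x\<bar> \<le> \<bar>C\<bar>" for x using assms(3)[of x] by (cases "x \<in> cball 0 R") auto
  qed (use assms in \<open>auto simp: loc_int_def\<close>)
  moreover have "(indicator (cball 0 R) x * u x) * k x = u x * k x" for x
    using assms(3)[of x] by (cases "x \<in> cball 0 R") auto
  ultimately show ?thesis by simp
qed

lemma loc_int_mult_C0: 
  assumes "loc_int u" "\<eta> \<in> C0_infty" shows "integrable lborel (\<lambda>x. u x * \<eta> x)"
  using C0_infty_bound_indicator[OF assms(2)] loc_int_mult_support[OF assms(1) C0_infty_borel[OF assms(2)]] by metis

lemma loc_int_powr:
  assumes p: "p \<ge> 1" and u: "u \<in> borel_measurable borel" and "loc_int (\<lambda>x. \<bar>u x\<bar> powr p)"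
  shows "loc_int u"
  by (rule loc_int_bound[OF loc_int_add[OF loc_int_const[of 1] assms(3)] u])
     (use le_one_plus_powr[OF p] in \<open>auto simp: abs_of_nonneg\<close>)

lemma wder_mult_C0:
  assumes w: "wder i u g" and c: "\<zeta> \<in> C0_infty"
  shows "wder i (\<lambda>x. \<zeta> x * u x) (\<lambda>x. \<zeta> x * g x + partial i \<zeta> x * u x)"
  unfolding wder_def
proof (intro conjI ballI)
  have l: "loc_int u" "loc_int g" using w by (auto simp: wder_def)
  obtain B where B: "\<And>x. \<bar>\<zeta> x\<bar> \<le> B" using C0_infty_bounded[OF c] by metis
  obtain B' where B': "\<And>x. \<bar>partial i \<zeta> x\<bar> \<le> B'" using C0_infty_bounded[OF C0_infty_partial[OF c]] by metis
  note cb = C0_infty_borel[OF c] C0_infty_borel[OF C0_infty_partial[OF c]]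
  show "loc_int (\<lambda>x. \<zeta> x * u x)" by (rule loc_int_mult_bounded[OF l(1) cb(1) B])
  show "loc_int (\<lambda>x. \<zeta> x * g x + partial i \<zeta> x * u x)"
    by (intro loc_int_add loc_int_mult_bounded[OF l(2) cb(1) B] loc_int_mult_bounded[OF l(1) cb(2) B'])
  fix \<eta> :: "real ^ 'a \<Rightarrow> real" assume e: "\<eta> \<in> C0_infty"
  note ce = C0_infty_mult[OF c e]
  have P: "partial i (\<lambda>x. \<zeta> x * \<eta> x) x = \<zeta> x * partial i \<eta> x + partial i \<zeta> x * \<eta> x" for x
    by (rule partial_mult[OF C0_infty_smooth[OF c] C0_infty_smooth[OF e]])
  have i1: "integrable lborel (\<lambda>x. u x * (\<zeta> x * partial i \<eta> x))"
    by (rule loc_int_mult_C0[OF l(1) C0_infty_mult[OF c C0_infty_partial[OF e]]])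
  have i2: "integrable lborel (\<lambda>x. u x * (partial i \<zeta> x * \<eta> x))"
    by (rule loc_int_mult_C0[OF l(1) C0_infty_mult[OF C0_infty_partial[OF c] e]])
  have i3: "integrable lborel (\<lambda>x. g x * (\<zeta> x * \<eta> x))"
    by (rule loc_int_mult_C0[OF l(2) ce])
  have "(\<integral>x. u x * partial i (\<lambda>x. \<zeta> x * \<eta> x) x \<partial>lborel) = - (\<integral>x. g x * (\<zeta> x * \<eta> x) \<partial>lborel)"
    using w ce by (auto simp: wder_def)
  also have "(\<integral>x. u x * partial i (\<lambda>x. \<zeta> x * \<eta> x) x \<partial>lborel)
     = (\<integral>x. u x * (\<zeta> x * partial i \<eta> x) \<partial>lborel) + (\<integral>x. u x * (partial i \<zeta> x * \<eta> x) \<partial>lborel)"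
    unfolding P distrib_left using i1 i2 by simp
  finally have eq: "(\<integral>x. u x * (\<zeta> x * partial i \<eta> x) \<partial>lborel) =
     - ((\<integral>x. g x * (\<zeta> x * \<eta> x) \<partial>lborel) + (\<integral>x. u x * (partial i \<zeta> x * \<eta> x) \<partial>lborel))" by simp
  have "(\<integral>x. \<zeta> x * u x * partial i \<eta> x \<partial>lborel) = (\<integral>x. u x * (\<zeta> x * partial i \<eta> x) \<partial>lborel)"
    by (simp add: mult_ac)
  moreover have "(\<integral>x. (\<zeta> x * g x + partial i \<zeta> x * u x) * \<eta> x \<partial>lborel) =
      (\<integral>x. g x * (\<zeta> x * \<eta> x) + u x * (partial i \<zeta> x * \<eta> x) \<partial>lborel)"
    by (simp add: algebra_simps)
  ultimately show "(\<integral>x. \<zeta> x * u x * partial i \<eta> x \<partial>lborel) = - (\<integral>x. (\<zeta> x * g x + partial i \<zeta> x * u x) * \<eta> x \<partial>lborel)"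
    using eq i2 i3 by simp
qed

lemma wder_limit:
  assumes w: "\<And>n. wder i (u n) (g n)"
    and U: "loc_int U" "\<And>n. AE x in lborel. \<bar>u n x\<bar> \<le> U x" and G: "loc_int G" "\<And>n. AE x in lborel. \<bar>g n x\<bar> \<le> G x"
    and lim: "AE x in lborel. (\<lambda>n. u n x) \<longlonglongrightarrow> v x" "AE x in lborel. (\<lambda>n. g n x) \<longlonglongrightarrow> h x"
    and [measurable]: "v \<in> borel_measurable borel" "h \<in> borel_measurable borel"
  shows "wder i v h"
  unfolding wder_def
proof (intro conjI ballI)
  note [measurable] = wder_measurable[OF w] loc_int_measurable[OF U(1)] loc_int_measurable[OF G(1)]
  have bd: "AE x in lborel. \<bar>v' x\<bar> \<le> \<bar>U' x\<bar>"
    if "\<And>n. AE x in lborel. \<bar>u' n x\<bar> \<le> U' x" "AE x in lborel. (\<lambda>n. u' n x) \<longlonglongrightarrow> v' x" 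
    for u' :: "nat \<Rightarrow> real ^ 'a \<Rightarrow> real" and U' v'
  proof -
    have "AE x in lborel. \<forall>n. \<bar>u' n x\<bar> \<le> U' x" using that(1) by (simp add: AE_all_countable)
    then show ?thesis using that(2)
      by eventually_elim (rule order.trans[OF LIMSEQ_le_const2[OF tendsto_rabs] abs_ge_self], auto)
  qed
  show "loc_int v" by (rule loc_int_bound[OF U(1) _ bd[OF U(2) lim(1)]]) auto
  show "loc_int h" by (rule loc_int_bound[OF G(1) _ bd[OF G(2) lim(2)]]) auto
  have conv: "(\<lambda>n. \<integral>x. u' n x * \<eta> x \<partial>lborel) \<longlonglongrightarrow> (\<integral>x. v' x * \<eta> x \<partial>lborel)"
    if "loc_int U'" "\<And>n. AE x in lborel. \<bar>u' n x\<bar> \<le> U' x" "AE x in lborel. (\<lambda>n. u' n x) \<longlonglongrightarrow> v' x" "\<eta> \<in> C0_infty"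
      and [measurable]: "\<And>n. u' n \<in> borel_measurable borel" "v' \<in> borel_measurable borel"
    for u' :: "nat \<Rightarrow> real ^ 'a \<Rightarrow> real" and U' v' \<eta>
  proof (rule integral_dominated_convergence[where w="\<lambda>x. \<bar>U' x * \<eta> x\<bar>"])
    note [measurable] = C0_infty_borel[OF that(4)]
    show "integrable lborel (\<lambda>x. \<bar>U' x * \<eta> x\<bar>)" by (rule integrable_abs[OF loc_int_mult_C0[OF that(1,4)]])
    show "AE x in lborel. norm (u' n x * \<eta> x) \<le> \<bar>U' x * \<eta> x\<bar>" for n
      using that(2)[of n] by eventually_elim (auto simp: abs_mult intro!: mult_right_mono)
    show "AE x in lborel. (\<lambda>n. u' n x * \<eta> x) \<longlonglongrightarrow> v' x * \<eta> x"
      using that(3) by eventually_elim (intro tendsto_intros)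
  qed (use C0_infty_borel[OF that(4)] in auto)
  fix \<eta> :: "real ^ 'a \<Rightarrow> real" assume e: "\<eta> \<in> C0_infty"
  have "(\<lambda>n. \<integral>x. u n x * partial i \<eta> x \<partial>lborel) \<longlonglongrightarrow> (\<integral>x. v x * partial i \<eta> x \<partial>lborel)"
    by (rule conv[OF U lim(1) C0_infty_partial[OF e]]) auto
  moreover have "(\<lambda>n. - (\<integral>x. g n x * \<eta> x \<partial>lborel)) \<longlonglongrightarrow> - (\<integral>x. h x * \<eta> x \<partial>lborel)"
    by (rule tendsto_minus, rule conv[OF G lim(2) e]) auto
  moreover have "(\<integral>x. u n x * partial i \<eta> x \<partial>lborel) = - (\<integral>x. g n x * \<eta> x \<partial>lborel)" for n
    using w[of n] e by (auto simp: wder_def)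
  ultimately show "(\<integral>x. v x * partial i \<eta> x \<partial>lborel) = - (\<integral>x. h x * \<eta> x \<partial>lborel)"
    by (simp add: LIMSEQ_unique)
qed

lemma conv_wder:
  assumes w: "wder i u g" and u: "integrable lborel u" and k: "k \<in> C0_infty"
  shows "conv u (partial i k) x = conv g k x"
proof -
  note [measurable] = wder_measurable[OF w] C0_infty_borel[OF k] C0_infty_borel[OF C0_infty_partial[OF k]]
  have ck: "(\<lambda>y. k ((- 1) *\<^sub>R y + x)) \<in> C0_infty" by (rule C0_infty_compose_affine[OF k]) simp
  have "(\<integral>y. u y * partial i (\<lambda>y. k ((- 1) *\<^sub>R y + x)) y \<partial>lborel) = - (\<integral>y. g y * k ((- 1) *\<^sub>R y + x) \<partial>lborel)"
    using w ck by (auto simp: wder_def)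
  then show ?thesis
    unfolding partial_compose_affine[OF C0_infty_smooth[OF k]] by (simp add: conv_swap)
qed

section \<open>Convergence of mollified functions\<close>

lemma pow_int_AE_subseq:
  assumes p: "p \<ge> 1" and [measurable]: "\<And>n. u n \<in> borel_measurable M"
    and fin: "\<And>n. pow_int p M (u n) < \<infinity>" and lim: "(\<lambda>n. pow_int p M (u n)) \<longlonglongrightarrow> 0"
  shows "\<exists>r :: nat \<Rightarrow> nat. strict_mono r \<and> (AE x in M. (\<lambda>n. u (r n) x) \<longlonglongrightarrow> 0)"
proof -
  have int: "integrable M (\<lambda>x. \<bar>u n x\<bar> powr p)" for n
    unfolding integrable_iff_bounded using fin[of n] by (simp add: pow_int_def)
  have eq: "pow_int p M (u n) = ennreal (\<integral>x. \<bar>u n x\<bar> powr p \<partial>M)" for n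
    unfolding pow_int_def by (rule nn_integral_eq_integral[OF int]) simp
  have "(\<lambda>n. enn2real (pow_int p M (u n))) \<longlonglongrightarrow> enn2real 0"
    using lim by (intro tendsto_enn2real) auto
  then have "(\<lambda>n. \<integral>x. norm (\<bar>u n x\<bar> powr p) \<partial>M) \<longlonglongrightarrow> 0"
    unfolding eq by (simp add: integral_nonneg_AE)
  from tendsto_L1_AE_subseq[OF int this]
  obtain r :: "nat \<Rightarrow> nat" where r: "strict_mono r" "AE x in M. (\<lambda>n. \<bar>u (r n) x\<bar> powr p) \<longlonglongrightarrow> 0" by blast
  have "AE x in M. (\<lambda>n. u (r n) x) \<longlonglongrightarrow> 0"
    using r(2)
  proof eventually_elim
    fix x assume "(\<lambda>n. \<bar>u (r n) x\<bar> powr p) \<longlonglongrightarrow> 0"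
    from tendsto_powr2[OF this tendsto_const, of "1 / p"] p
    have "(\<lambda>n. (\<bar>u (r n) x\<bar> powr p) powr (1 / p)) \<longlonglongrightarrow> 0" by simp
    then have "(\<lambda>n. \<bar>u (r n) x\<bar>) \<longlonglongrightarrow> 0" using p by (simp add: powr_powr)
    then show "(\<lambda>n. u (r n) x) \<longlonglongrightarrow> 0" by (simp add: tendsto_rabs_zero_iff)
  qed
  with r(1) show ?thesis by blast
qed

lemma pow_int_AE_subseq_family:
  fixes u :: "'i::finite \<Rightarrow> nat \<Rightarrow> 'a \<Rightarrow> real"
  assumes p: "p \<ge> 1" and [measurable]: "\<And>j n. u j n \<in> borel_measurable M"
    and fin: "\<And>j n. pow_int p M (u j n) < \<infinity>" and lim: "\<And>j. (\<lambda>n. pow_int p M (u j n)) \<longlonglongrightarrow> 0"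
  shows "\<exists>r :: nat \<Rightarrow> nat. strict_mono r \<and> (AE x in M. \<forall>j. (\<lambda>n. u j (r n) x) \<longlonglongrightarrow> 0)"
proof -
  let ?v = "\<lambda>n x. \<Sum>j\<in>UNIV. \<bar>u j n x\<bar>"
  have abs: "pow_int p M (\<lambda>x. \<bar>u j n x\<bar>) = pow_int p M (u j n)" for j n by (simp add: pow_int_def)
  have le: "pow_int p M (?v n) \<le> ennreal (real CARD('i) powr p) * (\<Sum>j\<in>UNIV. pow_int p M (u j n))" for n
    using pow_int_sum[OF p, of UNIV "\<lambda>j x. \<bar>u j n x\<bar>" M] by (simp add: abs)
  have fin': "pow_int p M (?v n) < \<infinity>" for n
    by (rule le_less_trans[OF le]) (use fin in \<open>auto simp: ennreal_mult_less_top\<close>)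
  have "(\<lambda>n. \<Sum>j\<in>UNIV. pow_int p M (u j n)) \<longlonglongrightarrow> (\<Sum>j\<in>(UNIV :: 'i set). 0)"
    by (intro tendsto_sum lim)
  then have lim': "(\<lambda>n. pow_int p M (?v n)) \<longlonglongrightarrow> 0"
    by (intro tendsto_0_ennreal_le[OF tendsto_0_ennreal_cmult le]) auto
  obtain r :: "nat \<Rightarrow> nat" where r: "strict_mono r" "AE x in M. (\<lambda>n. ?v (r n) x) \<longlonglongrightarrow> 0"
    using pow_int_AE_subseq[OF p _ fin' lim'] by auto
  have "AE x in M. \<forall>j. (\<lambda>n. u j (r n) x) \<longlonglongrightarrow> 0"
    using r(2)
  proof eventually_elim
    fix x assume l: "(\<lambda>n. ?v (r n) x) \<longlonglongrightarrow> 0"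
    show "\<forall>j. (\<lambda>n. u j (r n) x) \<longlonglongrightarrow> 0"
      by (intro allI Lim_null_comparison[OF _ l] always_eventually) (auto intro: member_le_sum)
  qed
  with r(1) show ?thesis by blast
qed

lemma pow_int_1_integrable:
  assumes "integrable M f" shows "pow_int 1 M f < \<infinity>"
  using assms unfolding pow_int_def integrable_iff_bounded by simp

lemma mollify_L1:
  fixes f :: "real ^ 'n::finite \<Rightarrow> real"
  assumes "p \<ge> 1" "integrable lborel f" "pow_int p lborel f < \<infinity>"
  shows "(\<lambda>n. pow_int p lborel (\<lambda>x. conv f (dil n rho) x - f x)) \<longlonglongrightarrow> 0"
proof -
  obtain C where C: "\<And>x. \<bar>rho (x :: real ^ 'n)\<bar> \<le> C" using C0_infty_bounded[OF C0_infty_rho] by metis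
  have "(\<lambda>n. pow_int p lborel (\<lambda>x. conv f (dil n rho) x - (\<integral>y. rho (y :: real ^ 'n) \<partial>lborel) * f x)) \<longlonglongrightarrow> 0"
    by (intro approximate_identity[where C=C] assms C0_infty_borel[OF C0_infty_rho] C rho_support)
  then show ?thesis by (simp add: integral_rho)
qed

lemma C0_infty_conv:
  fixes f k :: "real ^ 'n::finite \<Rightarrow> real"
  assumes f: "integrable lborel f" "\<And>x. norm x > R \<Longrightarrow> f x = 0" and k: "k \<in> C0_infty"
  shows "conv f k \<in> C0_infty"
proof -
  obtain S where S: "\<And>x. norm x > S \<Longrightarrow> k x = 0" using C0_infty_support[OF k] by metis
  show ?thesis
    by (rule C0_inftyI[OF smooth_conv[OF f(1) k]], rule conv_support[of R f S k]) (use f S in auto)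
qed

text \<open>Bounded convergence in one factor and convergence in \<open>L\<^sup>1\<close> in the other.\<close>

lemma integral_prod_limit:
  fixes a b :: "nat \<Rightarrow> 'a \<Rightarrow> real"
  assumes [measurable]: "\<And>n. a n \<in> borel_measurable M" "A \<in> borel_measurable M"
    and bd: "\<And>n x. \<bar>a n x\<bar> \<le> C" "\<And>x. \<bar>A x\<bar> \<le> C" and a: "AE x in M. (\<lambda>n. a n x) \<longlonglongrightarrow> A x"
    and b: "\<And>n. integrable M (b n)" "integrable M B" "(\<lambda>n. pow_int 1 M (\<lambda>x. b n x - B x)) \<longlonglongrightarrow> 0"
  shows "(\<lambda>n. \<integral>x. a n x * b n x \<partial>M) \<longlonglongrightarrow> (\<integral>x. A x * B x \<partial>M)"
proof -
  note [measurable] = borel_measurable_integrable[OF b(1)] borel_measurable_integrable[OF b(2)]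
  have int: "integrable M (\<lambda>x. a n x * b n x)" "integrable M (\<lambda>x. a n x * B x)" "integrable M (\<lambda>x. A x * B x)" for n
    using integrable_mult_bounded[OF b(1), of "a n" C] integrable_mult_bounded[OF b(2), of "a n" C]
      integrable_mult_bounded[OF b(2), of A C] bd
    by (simp_all add: mult.commute)
  have 1: "(\<lambda>n. \<integral>x. a n x * B x \<partial>M) \<longlonglongrightarrow> (\<integral>x. A x * B x \<partial>M)"
  proof (rule integral_dominated_convergence[where w="\<lambda>x. C * \<bar>B x\<bar>"])
    show "AE x in M. (\<lambda>n. a n x * B x) \<longlonglongrightarrow> A x * B x"
      using a by eventually_elim (intro tendsto_intros)
    show "AE x in M. norm (a n x * B x) \<le> C * \<bar>B x\<bar>" for n
      using bd(1) by (auto simp: abs_mult intro!: mult_right_mono)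
  qed (use b in auto)
  have eq: "pow_int 1 M (\<lambda>x. b n x - B x) = ennreal (\<integral>x. \<bar>b n x - B x\<bar> \<partial>M)" for n
    unfolding pow_int_def using b by (simp add: nn_integral_eq_integral)
  have "(\<lambda>n. enn2real (pow_int 1 M (\<lambda>x. b n x - B x))) \<longlonglongrightarrow> enn2real 0"
    using b(3) by (intro tendsto_enn2real) auto
  then have "(\<lambda>n. \<integral>x. \<bar>b n x - B x\<bar> \<partial>M) \<longlonglongrightarrow> 0"
    unfolding eq by (simp add: integral_nonneg_AE)
  then have 2: "(\<lambda>n. C * (\<integral>x. \<bar>b n x - B x\<bar> \<partial>M)) \<longlonglongrightarrow> 0"
    using tendsto_mult_left[of _ 0 sequentially C] by simp
  have 3: "(\<lambda>n. (\<integral>x. a n x * b n x \<partial>M) - (\<integral>x. a n x * B x \<partial>M)) \<longlonglongrightarrow> 0"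
  proof (rule Lim_null_comparison[OF always_eventually 2], rule allI)
    fix n
    have "(\<integral>x. a n x * b n x \<partial>M) - (\<integral>x. a n x * B x \<partial>M) = (\<integral>x. a n x * b n x - a n x * B x \<partial>M)"
      using int by simp
    also have "norm \<dots> \<le> (\<integral>x. C * \<bar>b n x - B x\<bar> \<partial>M)"
    proof (rule order.trans[OF integral_norm_bound], rule integral_mono)
      show "norm (a n x * b n x - a n x * B x) \<le> C * \<bar>b n x - B x\<bar>" for x
        using mult_right_mono[OF bd(1)[of n x], of "\<bar>b n x - B x\<bar>"]
        by (simp add: right_diff_distrib[symmetric] abs_mult)
    qed (use int b in auto)
    finally show "norm ((\<integral>x. a n x * b n x \<partial>M) - (\<integral>x. a n x * B x \<partial>M)) \<le> C * (\<integral>x. \<bar>b n x - B x\<bar> \<partial>M)" by simp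
  qed
  from tendsto_add[OF 3 1] show ?thesis by simp
qed

section \<open>The chain rule\<close>

text \<open>The chain rule for a function \<open>F\<close> of two variables with bounded continuous partial derivatives \<open>F1\<close> and
  \<open>F2\<close>. Mollified functions satisfy it classically; along a subsequence they converge almost everywhere,
  which takes care of the bounded factors, and in \<open>L\<^sup>1\<close>, which takes care of the derivatives.\<close>

lemma wder_chain:
  fixes F F1 F2 :: "real \<Rightarrow> real \<Rightarrow> real" and u v :: "real ^ 'n::finite \<Rightarrow> real"
  assumes D: "\<And>a b. ((\<lambda>z. F (fst z) (snd z)) has_derivative (\<lambda>h. F1 a b * fst h + F2 a b * snd h)) (at (a, b))"
    and cont: "continuous_on UNIV (\<lambda>z. F1 (fst z) (snd z))" "continuous_on UNIV (\<lambda>z. F2 (fst z) (snd z))"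
    and bd: "\<And>a b. \<bar>F1 a b\<bar> \<le> C" "\<And>a b. \<bar>F2 a b\<bar> \<le> C"
    and u: "wder i u gu" and v: "wder i v gv"
  shows "wder i (\<lambda>x. F (u x) (v x)) (\<lambda>x. F1 (u x) (v x) * gu x + F2 (u x) (v x) * gv x)"
proof -
  have C: "C \<ge> 0" using bd(1)[of 0 0] by linarith
  have contF: "continuous_on UNIV (\<lambda>z. F (fst z) (snd z))"
    using D by (intro differentiable_imp_continuous_on) (auto simp: differentiable_on_def differentiable_def)
  have meas: "(\<lambda>x. G (f x) (g x)) \<in> borel_measurable borel"
    if "continuous_on UNIV (\<lambda>z. G (fst z) (snd z))" "f \<in> borel_measurable borel" "g \<in> borel_measurable borel"
    for G :: "real \<Rightarrow> real \<Rightarrow> real" and f g :: "real ^ 'n \<Rightarrow> real"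
  proof -
    have "(\<lambda>x. (f x, g x)) \<in> borel \<rightarrow>\<^sub>M borel" using that(2,3) by (rule borel_measurable_Pair)
    from measurable_compose[OF this borel_measurable_continuous_onI[OF that(1)]] show ?thesis by simp
  qed
  note measF = meas[OF contF] meas[OF cont(1)] meas[OF cont(2)]
  have lip: "\<bar>F a b - F a' b'\<bar> \<le> 2 * C * (\<bar>a - a'\<bar> + \<bar>b - b'\<bar>)" for a b a' b'
  proof -
    have "norm ((\<lambda>z. F (fst z) (snd z)) (a, b) - (\<lambda>z. F (fst z) (snd z)) (a', b')) \<le> 2 * C * norm ((a, b) - (a', b'))"
    proof (rule differentiable_bound[where S=UNIV and f'="\<lambda>z h. F1 (fst z) (snd z) * fst h + F2 (fst z) (snd z) * snd h"])
      fix z :: "real \<times> real"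
      show "((\<lambda>z. F (fst z) (snd z)) has_derivative (\<lambda>h. F1 (fst z) (snd z) * fst h + F2 (fst z) (snd z) * snd h)) (at z within UNIV)"
        using D[of "fst z" "snd z"] by simp
      show "onorm (\<lambda>h. F1 (fst z) (snd z) * fst h + F2 (fst z) (snd z) * snd h) \<le> 2 * C"
      proof (rule onorm_le)
        fix h :: "real \<times> real"
        have "\<bar>F1 (fst z) (snd z) * fst h + F2 (fst z) (snd z) * snd h\<bar> \<le> C * \<bar>fst h\<bar> + C * \<bar>snd h\<bar>"
          by (rule order.trans[OF abs_triangle_ineq]) (auto simp: abs_mult intro!: add_mono mult_right_mono bd)
        also have "\<dots> \<le> C * norm h + C * norm h"
          using norm_fst_le[of "fst h" "snd h"] norm_snd_le[of "snd h" "fst h"] C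
          by (intro add_mono mult_left_mono) auto
        finally show "norm (F1 (fst z) (snd z) * fst h + F2 (fst z) (snd z) * snd h) \<le> 2 * C * norm h" by simp
      qed
    qed auto
    also have "\<dots> \<le> 2 * C * (\<bar>a - a'\<bar> + \<bar>b - b'\<bar>)"
      using C norm_Pair_le[of "a - a'" "b - b'"] by (intro mult_left_mono) auto
    finally show ?thesis by simp
  qed
  have l: "loc_int u" "loc_int gu" "loc_int v" "loc_int gv" using u v by (auto simp: wder_def)
  note [measurable] = wder_measurable[OF u] wder_measurable[OF v]
  show ?thesis unfolding wder_def
  proof (intro conjI ballI)
    show "loc_int (\<lambda>x. F (u x) (v x))"
    proof (rule loc_int_bound)
      show "loc_int (\<lambda>x. \<bar>F 0 0\<bar> + 2 * C * (\<bar>u x\<bar> + \<bar>v x\<bar>))"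
        by (intro loc_int_add loc_int_const loc_int_cmult loc_int_abs l)
      have "\<bar>F (u x) (v x)\<bar> \<le> \<bar>F 0 0\<bar> + 2 * C * (\<bar>u x\<bar> + \<bar>v x\<bar>)" for x
        using lip[of "u x" "v x" 0 0] by simp
      then show "AE x in lborel. \<bar>F (u x) (v x)\<bar> \<le> \<bar>\<bar>F 0 0\<bar> + 2 * C * (\<bar>u x\<bar> + \<bar>v x\<bar>)\<bar>"
        by (intro AE_I2 order.trans[OF _ abs_ge_self])
    qed (rule measF; measurable)
    show "loc_int (\<lambda>x. F1 (u x) (v x) * gu x + F2 (u x) (v x) * gv x)"
      by (intro loc_int_add loc_int_mult_bounded[OF l(2) _ bd(1)] loc_int_mult_bounded[OF l(4) _ bd(2)] measF) measurable
    fix \<eta> :: "real ^ 'n \<Rightarrow> real" assume e: "\<eta> \<in> C0_infty"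
    obtain R where R: "R > 0" "\<And>x. norm x > R \<Longrightarrow> \<eta> x = 0" using C0_infty_support[OF e] by metis
    obtain B where B: "B > 0" "\<And>x. \<bar>\<eta> x\<bar> \<le> B" using C0_infty_bounded[OF e] by metis
    obtain B' where B': "B' > 0" "\<And>x. \<bar>partial i \<eta> x\<bar> \<le> B'" using C0_infty_bounded[OF C0_infty_partial[OF e]] by metis
    have Rp: "partial i \<eta> x = 0" if "norm x > R" for x
      by (rule partial_eq_0_if_const[of "- cball 0 R" _ _ 0]) (use that R in auto)
    note [measurable] = C0_infty_borel[OF e] C0_infty_borel[OF C0_infty_partial[OF e]]
    define z where "z = (cutoff (R + 1) :: real ^ 'n \<Rightarrow> real)"
    have z: "z \<in> C0_infty" unfolding z_def by (rule C0_infty_cutoff)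
    have z1: "z x = 1" "partial i z x = 0" if "norm x \<le> R" for x
      unfolding z_def using that by (auto intro!: cutoff_eq_1 partial_cutoff_eq_0)
    have zs: "z x = 0" if "norm x > R + 3" for x unfolding z_def using that by (intro cutoff_support) auto
    note zp = C0_infty_partial[OF z, of i]
    \<comment> \<open>On the support of \<open>\<eta>\<close> nothing changes if the functions are multiplied by \<open>z\<close>.\<close>
    define U where "U x = z x * u x" for x
    define V where "V x = z x * v x" for x
    define GU where "GU x = z x * gu x + partial i z x * u x" for x
    define GV where "GV x = z x * gv x + partial i z x * v x" for x
    have wU: "wder i U GU" and wV: "wder i V GV"
      unfolding U_def[abs_def] V_def[abs_def] GU_def[abs_def] GV_def[abs_def] by (rule wder_mult_C0[OF u z] wder_mult_C0[OF v z])+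
    note [measurable] = wder_measurable[OF wU] wder_measurable[OF wV]
    have int: "integrable lborel U" "integrable lborel V" "integrable lborel GU" "integrable lborel GV"
      unfolding U_def[abs_def] V_def[abs_def] GU_def[abs_def] GV_def[abs_def]
      using loc_int_mult_C0[OF l(1) z] loc_int_mult_C0[OF l(2) z] loc_int_mult_C0[OF l(3) z] loc_int_mult_C0[OF l(4) z]
        loc_int_mult_C0[OF l(1) zp] loc_int_mult_C0[OF l(3) zp]
      by (auto simp: mult.commute)
    define r where "r n = (dil n rho :: real ^ 'n \<Rightarrow> real)" for n
    have r: "r n \<in> C0_infty" for n unfolding r_def by (rule C0_infty_dil[OF C0_infty_rho])
    note [measurable] = C0_infty_borel[OF r]
    have UV: "conv U (r n) \<in> C0_infty" "conv V (r n) \<in> C0_infty" for n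
      by (rule C0_infty_conv[of _ "R + 3"], use int r zs in \<open>auto simp: U_def V_def\<close>)+
    have dUV: "partial i (conv U (r n)) x = conv GU (r n) x" "partial i (conv V (r n)) x = conv GV (r n) x" for n x
      by (simp_all add: partial_conv int r conv_wder[OF wU] conv_wder[OF wV])
    have L1: "(\<lambda>n. pow_int 1 lborel (\<lambda>x. conv f (r n) x - f x)) \<longlonglongrightarrow> 0" if "integrable lborel f" for f
      unfolding r_def by (rule mollify_L1) (use that pow_int_1_integrable in auto)
    have intG: "integrable lborel (conv GU (r n))" "integrable lborel (conv GV (r n))" for n
      using C0_infty_integrable[OF C0_infty_partial[OF UV(1)[of n], of i]] C0_infty_integrable[OF C0_infty_partial[OF UV(2)[of n], of i]]
      by (simp_all add: dUV[abs_def])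
    note intU = C0_infty_integrable[OF UV(1)] C0_infty_integrable[OF UV(2)]
    define E where "E j n = (if j then (\<lambda>x. conv U (r n) x - U x) else (\<lambda>x. conv V (r n) x - V x))" for j n
    have "\<exists>s :: nat \<Rightarrow> nat. strict_mono s \<and> (AE x in lborel. \<forall>j. (\<lambda>n. E j (s n) x) \<longlonglongrightarrow> 0)"
    proof (rule pow_int_AE_subseq_family[where p=1])
      fix j n
      have "integrable lborel (E j n)" using intU int by (cases j) (auto simp: E_def)
      then show "E j n \<in> borel_measurable lborel" by (rule borel_measurable_integrable)
      show "pow_int 1 lborel (E j n) < \<infinity>" by (rule pow_int_1_integrable) fact
      show "(\<lambda>n. pow_int 1 lborel (E j n)) \<longlonglongrightarrow> 0"
        using L1[OF int(1)] L1[OF int(2)] by (cases j) (auto simp: E_def)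
    qed simp
    then obtain s where s: "strict_mono s" "AE x in lborel. (\<lambda>n. conv U (r (s n)) x) \<longlonglongrightarrow> U x \<and> (\<lambda>n. conv V (r (s n)) x) \<longlonglongrightarrow> V x"
      by (auto simp: all_bool_eq LIM_zero_iff E_def)
    have L1s: "(\<lambda>n. pow_int 1 lborel (\<lambda>x. conv f (r (s n)) x - f x)) \<longlonglongrightarrow> 0" if "integrable lborel f" for f
      using LIMSEQ_subseq_LIMSEQ[OF L1[OF that] s(1)] by (simp add: o_def)
    have classical: "(\<integral>x. F (conv U (r n) x) (conv V (r n) x) * partial i \<eta> x \<partial>lborel) =
       - (\<integral>x. (F1 (conv U (r n) x) (conv V (r n) x) * \<eta> x) * conv GU (r n) x \<partial>lborel)
       - (\<integral>x. (F2 (conv U (r n) x) (conv V (r n) x) * \<eta> x) * conv GV (r n) x \<partial>lborel)" for n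
    proof -
      let ?U = "conv U (r n)" and ?V = "conv V (r n)"
      let ?W = "\<lambda>x. F (?U x) (?V x) * \<eta> x"
      have DW: "(?W has_derivative (\<lambda>h. F (?U x) (?V x) * frechet_derivative \<eta> (at x) h
          + (F1 (?U x) (?V x) * frechet_derivative ?U (at x) h + F2 (?U x) (?V x) * frechet_derivative ?V (at x) h) * \<eta> x)) (at x)" for x
      proof -
        have "((\<lambda>x. (?U x, ?V x)) has_derivative (\<lambda>h. (frechet_derivative ?U (at x) h, frechet_derivative ?V (at x) h))) (at x)"
          by (intro has_derivative_Pair smooth_has_derivative C0_infty_smooth UV)
        from has_derivative_compose[OF this D] have "((\<lambda>x. F (?U x) (?V x)) has_derivative
           (\<lambda>h. F1 (?U x) (?V x) * frechet_derivative ?U (at x) h + F2 (?U x) (?V x) * frechet_derivative ?V (at x) h)) (at x)"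
          by simp
        from has_derivative_mult[OF this smooth_has_derivative[OF C0_infty_smooth[OF e]]] show ?thesis .
      qed
      have PW: "partial i ?W x = F (?U x) (?V x) * partial i \<eta> x + (F1 (?U x) (?V x) * conv GU (r n) x + F2 (?U x) (?V x) * conv GV (r n) x) * \<eta> x" for x
        by (subst partial_eqI[OF DW]) (simp add: dUV[symmetric] partial_def)
      obtain b1 where b1: "\<And>x. \<bar>?U x\<bar> \<le> b1" using C0_infty_bounded[OF UV(1)] by metis
      obtain b2 where b2: "\<And>x. \<bar>?V x\<bar> \<le> b2" using C0_infty_bounded[OF UV(2)] by metis
      obtain b3 where b3: "\<And>x. \<bar>conv GU (r n) x\<bar> \<le> b3" using C0_infty_bounded[OF C0_infty_partial[OF UV(1)[of n], of i]] unfolding dUV by metis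
      obtain b4 where b4: "\<And>x. \<bar>conv GV (r n) x\<bar> \<le> b4" using C0_infty_bounded[OF C0_infty_partial[OF UV(2)[of n], of i]] unfolding dUV by metis
      have F_bd: "\<bar>F (?U x) (?V x)\<bar> \<le> \<bar>F 0 0\<bar> + 2 * C * (b1 + b2)" for x
      proof -
        have "2 * C * (\<bar>?U x\<bar> + \<bar>?V x\<bar>) \<le> 2 * C * (b1 + b2)"
          using C by (intro mult_left_mono add_mono b1 b2) auto
        then show ?thesis using lip[of "?U x" "?V x" 0 0] by simp
      qed
      have i1: "integrable lborel (\<lambda>x. partial i \<eta> x * F (?U x) (?V x))"
        by (rule integrable_mult_bounded[OF C0_infty_integrable[OF C0_infty_partial[OF e]] _ F_bd]) (simp add: measF)
      have a1: "\<bar>F1 (?U x) (?V x) * \<eta> x\<bar> \<le> C * B" "\<bar>F2 (?U x) (?V x) * \<eta> x\<bar> \<le> C * B" for x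
        unfolding abs_mult using C by (intro mult_mono bd B(2); simp)+
      have i2: "integrable lborel (\<lambda>x. conv GU (r n) x * (F1 (?U x) (?V x) * \<eta> x))"
        by (rule integrable_mult_bounded[OF intG(1) _ a1(1)]) (intro borel_measurable_times, auto simp: measF)
      have i3: "integrable lborel (\<lambda>x. conv GV (r n) x * (F2 (?U x) (?V x) * \<eta> x))"
        by (rule integrable_mult_bounded[OF intG(2) _ a1(2)]) (intro borel_measurable_times, auto simp: measF)
      have "(\<integral>x. partial i ?W x \<partial>lborel) = 0"
      proof (rule integral_partial_eq_0)
        show "?W differentiable at x" for x using DW by (auto simp: differentiable_def)
        show "?W x = 0" if "norm x > R" for x using R(2)[OF that] by simp
        show "\<bar>partial i ?W x\<bar> \<le> (\<bar>F 0 0\<bar> + 2 * C * (b1 + b2)) * B' + (C * b3 + C * b4) * B" for x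
          unfolding PW
        proof (rule order.trans[OF abs_triangle_ineq], rule add_mono)
          show "\<bar>F (?U x) (?V x) * partial i \<eta> x\<bar> \<le> (\<bar>F 0 0\<bar> + 2 * C * (b1 + b2)) * B'"
            unfolding abs_mult using F_bd[of x] B'(2)[of x] by (intro mult_mono) auto
          have "\<bar>F1 (?U x) (?V x) * conv GU (r n) x + F2 (?U x) (?V x) * conv GV (r n) x\<bar> \<le> C * b3 + C * b4"
            by (rule order.trans[OF abs_triangle_ineq], rule add_mono)
               (unfold abs_mult, (intro mult_mono bd b3 b4 C abs_ge_zero)+)
          then show "\<bar>(F1 (?U x) (?V x) * conv GU (r n) x + F2 (?U x) (?V x) * conv GV (r n) x) * \<eta> x\<bar> \<le> (C * b3 + C * b4) * B"
            unfolding abs_mult[of _ "\<eta> x"] using B(2)[of x] by (intro mult_mono) auto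
        qed
      qed
      moreover have "(\<integral>x. partial i ?W x \<partial>lborel) = (\<integral>x. partial i \<eta> x * F (?U x) (?V x) + (conv GU (r n) x * (F1 (?U x) (?V x) * \<eta> x) + conv GV (r n) x * (F2 (?U x) (?V x) * \<eta> x)) \<partial>lborel)"
        unfolding PW by (rule Bochner_Integration.integral_cong) (auto simp: algebra_simps)
      ultimately show ?thesis using i1 i2 i3 by (simp add: mult.commute)
    qed
    have FUV: "integrable lborel (\<lambda>x. F (f x) (g x) * partial i \<eta> x)" if "integrable lborel f" "integrable lborel g" for f g
    proof (rule Bochner_Integration.integrable_bound[where f="\<lambda>x. \<bar>F 0 0\<bar> * \<bar>partial i \<eta> x\<bar> + 2 * C * B' * (\<bar>f x\<bar> + \<bar>g x\<bar>)"])
      note [measurable] = borel_measurable_integrable[OF that(1)] borel_measurable_integrable[OF that(2)]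
      show "integrable lborel (\<lambda>x. \<bar>F 0 0\<bar> * \<bar>partial i \<eta> x\<bar> + 2 * C * B' * (\<bar>f x\<bar> + \<bar>g x\<bar>))"
        using that C0_infty_integrable[OF C0_infty_partial[OF e, of i]] by (intro Bochner_Integration.integrable_add integrable_mult_right integrable_abs)
      have "f \<in> borel_measurable borel" "g \<in> borel_measurable borel" by measurable
      then show "(\<lambda>x. F (f x) (g x) * partial i \<eta> x) \<in> borel_measurable lborel"
        using measF(1)[of f g] by simp
      have "\<bar>F (f x) (g x) * partial i \<eta> x\<bar> \<le> \<bar>F 0 0\<bar> * \<bar>partial i \<eta> x\<bar> + 2 * C * B' * (\<bar>f x\<bar> + \<bar>g x\<bar>)" for x
      proof -
        have "\<bar>F (f x) (g x)\<bar> \<le> \<bar>F 0 0\<bar> + 2 * C * (\<bar>f x\<bar> + \<bar>g x\<bar>)" using lip[of "f x" "g x" 0 0] by simp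
        then have "\<bar>F (f x) (g x) * partial i \<eta> x\<bar> \<le> (\<bar>F 0 0\<bar> + 2 * C * (\<bar>f x\<bar> + \<bar>g x\<bar>)) * \<bar>partial i \<eta> x\<bar>"
          unfolding abs_mult by (rule mult_right_mono) simp
        also have "\<dots> = \<bar>F 0 0\<bar> * \<bar>partial i \<eta> x\<bar> + 2 * C * (\<bar>f x\<bar> + \<bar>g x\<bar>) * \<bar>partial i \<eta> x\<bar>" by (simp add: distrib_right)
        also have "2 * C * (\<bar>f x\<bar> + \<bar>g x\<bar>) * \<bar>partial i \<eta> x\<bar> \<le> 2 * C * (\<bar>f x\<bar> + \<bar>g x\<bar>) * B'"
          using C B'(2)[of x] by (intro mult_left_mono mult_nonneg_nonneg) auto
        finally show ?thesis by (simp add: mult_ac)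
      qed
      then show "AE x in lborel. norm (F (f x) (g x) * partial i \<eta> x) \<le> norm (\<bar>F 0 0\<bar> * \<bar>partial i \<eta> x\<bar> + 2 * C * B' * (\<bar>f x\<bar> + \<bar>g x\<bar>))"
        by (intro AE_I2) (auto intro: order.trans[OF _ abs_ge_self])
    qed
    have lim1: "(\<lambda>n. \<integral>x. 1 * (F (conv U (r (s n)) x) (conv V (r (s n)) x) * partial i \<eta> x) \<partial>lborel) \<longlonglongrightarrow> (\<integral>x. 1 * (F (U x) (V x) * partial i \<eta> x) \<partial>lborel)"
    proof (rule integral_prod_limit[where C=1])
      show "(\<lambda>n. pow_int 1 lborel (\<lambda>x. F (conv U (r (s n)) x) (conv V (r (s n)) x) * partial i \<eta> x - F (U x) (V x) * partial i \<eta> x)) \<longlonglongrightarrow> 0"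
      proof (rule tendsto_0_ennreal_le)
        have "(\<lambda>n. pow_int 1 lborel (\<lambda>x. \<bar>conv U (r (s n)) x - U x\<bar> + \<bar>conv V (r (s n)) x - V x\<bar>)) \<longlonglongrightarrow> 0"
          by (rule pow_int_tendsto_add) (use L1s[OF int(1)] L1s[OF int(2)] in \<open>auto simp: pow_int_def\<close>)
        then have "(\<lambda>n. ennreal (\<bar>2 * C * B'\<bar> powr 1) * pow_int 1 lborel (\<lambda>x. \<bar>conv U (r (s n)) x - U x\<bar> + \<bar>conv V (r (s n)) x - V x\<bar>)) \<longlonglongrightarrow> 0"
          by (rule tendsto_0_ennreal_cmult) auto
        then show "(\<lambda>n. pow_int 1 lborel (\<lambda>x. 2 * C * B' * (\<bar>conv U (r (s n)) x - U x\<bar> + \<bar>conv V (r (s n)) x - V x\<bar>))) \<longlonglongrightarrow> 0"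
          by (subst pow_int_cmult) auto
        fix n
        have "\<bar>F a b * q - F a' b' * q\<bar> \<le> \<bar>2 * C * B' * (\<bar>a - a'\<bar> + \<bar>b - b'\<bar>)\<bar>" if "\<bar>q\<bar> \<le> B'" for a b a' b' q
        proof -
          have "\<bar>F a b * q - F a' b' * q\<bar> = \<bar>F a b - F a' b'\<bar> * \<bar>q\<bar>" by (simp add: left_diff_distrib[symmetric] abs_mult)
          also have "\<dots> \<le> 2 * C * (\<bar>a - a'\<bar> + \<bar>b - b'\<bar>) * B'"
            using that C by (intro mult_mono lip) auto
          finally show ?thesis by (intro order.trans[OF _ abs_ge_self]) (simp add: mult_ac)
        qed
        then show "pow_int 1 lborel (\<lambda>x. F (conv U (r (s n)) x) (conv V (r (s n)) x) * partial i \<eta> x - F (U x) (V x) * partial i \<eta> x)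
            \<le> pow_int 1 lborel (\<lambda>x. 2 * C * B' * (\<bar>conv U (r (s n)) x - U x\<bar> + \<bar>conv V (r (s n)) x - V x\<bar>))"
          by (intro pow_int_mono_AE AE_I2) (use B' in auto)
      qed
    qed (use FUV[OF intU] FUV[OF int(1,2)] in auto)
    have lim2: "(\<lambda>n. \<integral>x. (G (conv U (r (s n)) x) (conv V (r (s n)) x) * \<eta> x) * conv f (r (s n)) x \<partial>lborel) \<longlonglongrightarrow> (\<integral>x. (G (U x) (V x) * \<eta> x) * f x \<partial>lborel)"
      if G: "continuous_on UNIV (\<lambda>z. G (fst z) (snd z))" "\<And>a b. \<bar>G a b\<bar> \<le> C" and f: "integrable lborel f" "\<And>n. integrable lborel (conv f (r n))" for G f
    proof (rule integral_prod_limit[where C="C * B"])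
      show "AE x in lborel. (\<lambda>n. G (conv U (r (s n)) x) (conv V (r (s n)) x) * \<eta> x) \<longlonglongrightarrow> G (U x) (V x) * \<eta> x"
        using s(2)
      proof eventually_elim
        fix x assume "(\<lambda>n. conv U (r (s n)) x) \<longlonglongrightarrow> U x \<and> (\<lambda>n. conv V (r (s n)) x) \<longlonglongrightarrow> V x"
        then have "(\<lambda>n. (conv U (r (s n)) x, conv V (r (s n)) x)) \<longlonglongrightarrow> (U x, V x)" by (intro tendsto_Pair) auto
        from continuous_on_tendsto_compose[OF G(1) this]
        show "(\<lambda>n. G (conv U (r (s n)) x) (conv V (r (s n)) x) * \<eta> x) \<longlonglongrightarrow> G (U x) (V x) * \<eta> x"
          by (intro tendsto_mult_right) simp
      qed
      have GB: "\<bar>G a b * \<eta> x\<bar> \<le> C * B" for a b x unfolding abs_mult using C by (intro mult_mono G(2) B(2)) auto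
      then show "\<bar>G (conv U (r (s n)) x) (conv V (r (s n)) x) * \<eta> x\<bar> \<le> C * B" for n x .
      show "\<bar>G (U x) (V x) * \<eta> x\<bar> \<le> C * B" for x by (rule GB)
      show "(\<lambda>n. pow_int 1 lborel (\<lambda>x. conv f (r (s n)) x - f x)) \<longlonglongrightarrow> 0" by (rule L1s[OF f(1)])
    qed (use f meas[OF G(1)] in \<open>auto intro!: borel_measurable_times\<close>)
    have "(\<lambda>n. - (\<integral>x. (F1 (conv U (r (s n)) x) (conv V (r (s n)) x) * \<eta> x) * conv GU (r (s n)) x \<partial>lborel)
        - (\<integral>x. (F2 (conv U (r (s n)) x) (conv V (r (s n)) x) * \<eta> x) * conv GV (r (s n)) x \<partial>lborel))
       \<longlonglongrightarrow> - (\<integral>x. (F1 (U x) (V x) * \<eta> x) * GU x \<partial>lborel) - (\<integral>x. (F2 (U x) (V x) * \<eta> x) * GV x \<partial>lborel)"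
      by (intro tendsto_diff tendsto_minus lim2 cont bd int intG)
    with lim1 have eq: "(\<integral>x. F (U x) (V x) * partial i \<eta> x \<partial>lborel)
        = - (\<integral>x. (F1 (U x) (V x) * \<eta> x) * GU x \<partial>lborel) - (\<integral>x. (F2 (U x) (V x) * \<eta> x) * GV x \<partial>lborel)"
      unfolding mult_1 classical by (rule LIMSEQ_unique)
    have a1: "\<bar>F1 (U x) (V x) * \<eta> x\<bar> \<le> C * B" "\<bar>F2 (U x) (V x) * \<eta> x\<bar> \<le> C * B" for x
      unfolding abs_mult using C by (intro mult_mono bd B(2); simp)+
    have i2: "integrable lborel (\<lambda>x. GU x * (F1 (U x) (V x) * \<eta> x))"
      by (rule integrable_mult_bounded[OF int(3) _ a1(1)]) (intro borel_measurable_times, auto simp: measF)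
    have i3: "integrable lborel (\<lambda>x. GV x * (F2 (U x) (V x) * \<eta> x))"
      by (rule integrable_mult_bounded[OF int(4) _ a1(2)]) (intro borel_measurable_times, auto simp: measF)
    have e1: "F (U x) (V x) * partial i \<eta> x = F (u x) (v x) * partial i \<eta> x" for x
      using Rp[of x] z1[of x] by (cases "norm x \<le> R") (auto simp: U_def V_def)
    have e2: "GU x * (F1 (U x) (V x) * \<eta> x) + GV x * (F2 (U x) (V x) * \<eta> x) = (F1 (u x) (v x) * gu x + F2 (u x) (v x) * gv x) * \<eta> x" for x
      using R(2)[of x] z1[of x] by (cases "norm x \<le> R") (auto simp: U_def V_def GU_def GV_def algebra_simps)
    have "(\<integral>x. (F1 (u x) (v x) * gu x + F2 (u x) (v x) * gv x) * \<eta> x \<partial>lborel)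
       = (\<integral>x. (F1 (U x) (V x) * \<eta> x) * GU x \<partial>lborel) + (\<integral>x. (F2 (U x) (V x) * \<eta> x) * GV x \<partial>lborel)"
      unfolding e2[symmetric] using i2 i3 by (simp add: mult.commute)
    then show "(\<integral>x. F (u x) (v x) * partial i \<eta> x \<partial>lborel) = - (\<integral>x. (F1 (u x) (v x) * gu x + F2 (u x) (v x) * gv x) * \<eta> x \<partial>lborel)"
      using eq unfolding e1 by simp
  qed
qed

section \<open>Taylor expansion in the mean\<close>

text \<open>First-order Taylor expansion in \<open>L\<^sup>p\<close>: its error is controlled by the modulus of
  continuity of the weak gradient.\<close>

lemma pow_int_taylor:
  fixes P :: "real ^ 'n::finite \<Rightarrow> real"
  assumes p: "p \<ge> 1" and P: "integrable lborel P" and D: "\<And>j. integrable lborel (D j)"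
    and w: "\<And>j. wder j P (D j)"
    and B: "\<And>z j. norm z \<le> norm y \<Longrightarrow> pow_int p lborel (\<lambda>x. D j (x + z) - D j x) \<le> B"
  shows "pow_int p lborel (\<lambda>x. P (x - y) - P x + (\<Sum>j\<in>UNIV. y $ j * D j x))
    \<le> ennreal (norm y powr p) * (ennreal (real CARD('n) powr p) * (of_nat CARD('n) * B))"
proof -
  define r where "r n = (dil n rho :: real ^ 'n \<Rightarrow> real)" for n
  have r: "r n \<in> C0_infty" for n unfolding r_def by (rule C0_infty_dil[OF C0_infty_rho])
  note [measurable] = C0_infty_borel[OF r] wder_measurable[OF w]
  have r_norm: "(\<integral>\<^sup>+s. ennreal \<bar>r n s\<bar> \<partial>lborel) \<le> ennreal 1" for n
    unfolding r_def nn_integral_dil[OF C0_infty_borel[OF C0_infty_rho]]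
    using C0_infty_integrable[OF C0_infty_rho]
    by (subst nn_integral_eq_integral) (simp_all add: integral_rho rho_nonneg abs_of_nonneg[OF rho_nonneg])
  define C where "C = ennreal (norm y powr p) * (ennreal (real CARD('n) powr p) * (of_nat CARD('n) * B))"
  \<comment> \<open>The estimate for the mollified function, by the fundamental theorem of calculus.\<close>
  have smooth_case: "pow_int p lborel (\<lambda>x. conv P (r n) (x - y) - conv P (r n) x + (\<Sum>j\<in>UNIV. y $ j * conv (D j) (r n) x)) \<le> C" for n
  proof -
    let ?P = "conv P (r n)" and ?D = "\<lambda>j. conv (D j) (r n)"
    have dP: "(?P has_derivative (\<lambda>v. \<Sum>j\<in>UNIV. v $ j * ?D j x)) (at x)" for x
      using conv_has_derivative[OF P r, of n x] by (simp add: conv_wder[OF w P r])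
    have contD: "continuous_on UNIV (?D j)" for j by (rule smooth_continuous[OF smooth_conv[OF D r]])
    define F where "F x t = - (\<Sum>j\<in>UNIV. y $ j * (?D j (x - t *\<^sub>R y) - ?D j x))" for x and t :: real
    have [measurable]: "(\<lambda>(x, t). F x t) \<in> borel_measurable (lborel \<Otimes>\<^sub>M lborel)"
      unfolding F_def by measurable
    have FTC: "?P (x - y) - ?P x + (\<Sum>j\<in>UNIV. y $ j * ?D j x) = (\<integral>t. F x t * indicator {0..1} t \<partial>lborel)" for x
    proof -
      let ?g = "\<lambda>t. ?P (x - t *\<^sub>R y) + t * (\<Sum>j\<in>UNIV. y $ j * ?D j x)"
      have g: "(?g has_real_derivative F x t) (at t)" for t
      proof -
        have "((\<lambda>t. ?P (x - t *\<^sub>R y)) has_derivative (\<lambda>h. \<Sum>j\<in>UNIV. (- (h *\<^sub>R y)) $ j * ?D j (x - t *\<^sub>R y))) (at t)"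
          by (rule has_derivative_compose[OF _ dP]) (auto intro!: derivative_eq_intros)
        then have "((\<lambda>t. ?P (x - t *\<^sub>R y)) has_real_derivative - (\<Sum>j\<in>UNIV. y $ j * ?D j (x - t *\<^sub>R y))) (at t)"
          unfolding has_field_derivative_def
          by (rule has_derivative_eq_rhs) (auto simp: fun_eq_iff sum_negf sum_distrib_left sum_distrib_right mult_ac)
        then have "(?g has_real_derivative - (\<Sum>j\<in>UNIV. y $ j * ?D j (x - t *\<^sub>R y)) + 1 * (\<Sum>j\<in>UNIV. y $ j * ?D j x)) (at t)"
          by (intro DERIV_add) (auto intro!: derivative_eq_intros)
        then show ?thesis by (simp add: F_def right_diff_distrib sum_subtractf)
      qed
      have "continuous_on {0..1} (F x)"
        unfolding F_def by (intro continuous_intros continuous_on_compose2[OF contD]) auto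
      then have "(\<integral>t. indicator {0..1} t *\<^sub>R F x t \<partial>lborel) = ?g 1 - ?g 0"
        using g by (intro integral_FTC_Icc) (auto simp: has_real_derivative_iff_has_vector_derivative[symmetric] intro: has_field_derivative_at_within)
      then show ?thesis by (simp add: mult.commute)
    qed
    have shift: "pow_int p lborel (\<lambda>x. ?D j (x + z) - ?D j x) \<le> B" if z: "norm z \<le> norm y" for z j
    proof -
      obtain b where b: "\<And>x. \<bar>r n x\<bar> \<le> b" using C0_infty_bounded[OF r] by metis
      have "?D j (x + z) - ?D j x = (\<integral>s. (D j (x + z - s) - D j (x - s)) * r n s \<partial>lborel)" for x
        unfolding conv_def left_diff_distrib
        by (rule Bochner_Integration.integral_diff[symmetric]) (intro integrable_conv_integrand[OF D _ b]; simp)+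
      then have "pow_int p lborel (\<lambda>x. ?D j (x + z) - ?D j x) = pow_int p lborel (\<lambda>x. \<integral>s. (D j (x + z - s) - D j (x - s)) * r n s \<partial>lborel)" by simp
      also have "\<dots> \<le> ennreal (1 powr p) * B"
      proof (rule pow_int_kernel[OF p _ r_norm sigma_finite_lborel sigma_finite_lborel])
        fix s
        show "pow_int p lborel (\<lambda>x. D j (x + z - s) - D j (x - s)) \<le> B"
          using pow_int_translate[of "\<lambda>x. D j (x + z) - D j x" p "- s"] B[OF z, of j] by (simp add: algebra_simps)
      qed measurable
      finally show ?thesis by simp
    qed
    have "pow_int p lborel (\<lambda>x. \<integral>t. F x t * indicator {0..1} t \<partial>lborel) \<le> ennreal (1 powr p) * C"
    proof (rule pow_int_kernel[OF p _ _ sigma_finite_lborel sigma_finite_lborel])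
      show "(\<integral>\<^sup>+t. ennreal \<bar>indicator {0..1::real} t :: real\<bar> \<partial>lborel) \<le> ennreal 1" by (simp add: ennreal_indicator)
      fix t :: real assume "(indicator {0..1} t :: real) \<noteq> 0"
      then have t: "0 \<le> t" "t \<le> 1" by (auto simp: indicator_def split: if_splits)
      let ?E = "\<lambda>j x. ?D j (x + (- t) *\<^sub>R y) - ?D j x"
      have "pow_int p lborel (\<lambda>x. F x t) \<le> pow_int p lborel (\<lambda>x. norm y * (\<Sum>j\<in>UNIV. \<bar>?E j x\<bar>))"
      proof (rule pow_int_mono_AE[OF p], rule AE_I2)
        fix x
        have "\<bar>F x t\<bar> \<le> (\<Sum>j\<in>UNIV. norm y * \<bar>?E j x\<bar>)"
          unfolding F_def abs_minus by (rule order.trans[OF sum_abs], rule sum_mono)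
            (auto simp: abs_mult intro!: mult_right_mono component_le_norm_cart)
        then show "\<bar>F x t\<bar> \<le> \<bar>norm y * (\<Sum>j\<in>UNIV. \<bar>?E j x\<bar>)\<bar>"
          by (intro order.trans[OF _ abs_ge_self]) (simp add: sum_distrib_left)
      qed
      also have "\<dots> = ennreal (norm y powr p) * pow_int p lborel (\<lambda>x. \<Sum>j\<in>UNIV. \<bar>?E j x\<bar>)"
        by (subst pow_int_cmult) auto
      also have "\<dots> \<le> ennreal (norm y powr p) * (ennreal (real CARD('n) powr p) * (\<Sum>j\<in>(UNIV :: 'n set). pow_int p lborel (\<lambda>x. \<bar>?E j x\<bar>)))"
        by (intro mult_left_mono pow_int_sum[OF p]) auto
      also have "\<dots> \<le> ennreal (norm y powr p) * (ennreal (real CARD('n) powr p) * (\<Sum>j\<in>(UNIV :: 'n set). B))"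
      proof (intro mult_left_mono sum_mono)
        fix j
        have "norm ((- t) *\<^sub>R y) \<le> norm y" using t by (simp add: mult_left_le_one_le)
        from shift[OF this, of j] show "pow_int p lborel (\<lambda>x. \<bar>?E j x\<bar>) \<le> B" by (simp add: pow_int_def)
      qed auto
      finally show "pow_int p lborel (\<lambda>x. F x t) \<le> C" by (simp add: C_def)
    qed measurable
    then show ?thesis unfolding FTC by simp
  qed
  \<comment> \<open>A subsequence along which \<open>P\<close> and all its derivatives are approximated almost everywhere.\<close>
  define u where "u k n = (case k of None \<Rightarrow> (\<lambda>x. conv P (r n) x - P x) | Some j \<Rightarrow> (\<lambda>x. conv (D j) (r n) x - D j x))" for k n
  have L1: "(\<lambda>n. pow_int 1 lborel (\<lambda>x. conv f (r n) x - f x)) \<longlonglongrightarrow> 0" if "integrable lborel f" for f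
    unfolding r_def by (rule mollify_L1) (use that pow_int_1_integrable in auto)
  have fin1: "pow_int 1 lborel (\<lambda>x. conv f (r n) x - f x) < \<infinity>" if f: "integrable lborel f" for f n
  proof -
    note [measurable] = borel_measurable_integrable[OF f]
    have "pow_int 1 lborel (conv f (r n)) \<le> ennreal (1 powr 1) * pow_int 1 lborel f"
      unfolding conv_def
    proof (rule pow_int_kernel[OF _ _ r_norm sigma_finite_lborel sigma_finite_lborel])
      show "pow_int 1 lborel (\<lambda>x. f (x - s)) \<le> pow_int 1 lborel f" for s
        using pow_int_translate[of f 1 "- s"] by simp
    qed (simp_all, measurable)
    then have "pow_int 1 lborel (conv f (r n)) < \<infinity>"
      using pow_int_1_integrable[OF f] by (simp add: le_less_trans)
    then show ?thesis using pow_int_1_integrable[OF f] by (intro pow_int_diff_finite) auto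
  qed
  have "\<exists>s :: nat \<Rightarrow> nat. strict_mono s \<and> (AE x in lborel. \<forall>k. (\<lambda>n. u k (s n) x) \<longlonglongrightarrow> 0)"
  proof (rule pow_int_AE_subseq_family[where p=1])
    fix k n
    show "u k n \<in> borel_measurable lborel" "pow_int 1 lborel (u k n) < \<infinity>"
      using fin1[OF P] fin1[OF D] by (cases k; auto simp: u_def)+
    show "(\<lambda>n. pow_int 1 lborel (u k n)) \<longlonglongrightarrow> 0"
      using L1[OF P] L1[OF D] by (cases k) (auto simp: u_def)
  qed simp
  then obtain s where s: "AE x in lborel. \<forall>k. (\<lambda>n. u k (s n) x) \<longlonglongrightarrow> 0" by blast
  have AE1: "AE x in lborel. (\<lambda>n. conv P (r (s n)) x) \<longlonglongrightarrow> P x \<and> (\<forall>j. (\<lambda>n. conv (D j) (r (s n)) x) \<longlonglongrightarrow> D j x)"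
    using s
  proof eventually_elim
    fix x assume a: "\<forall>k. (\<lambda>n. u k (s n) x) \<longlonglongrightarrow> 0"
    show "(\<lambda>n. conv P (r (s n)) x) \<longlonglongrightarrow> P x \<and> (\<forall>j. (\<lambda>n. conv (D j) (r (s n)) x) \<longlonglongrightarrow> D j x)"
      using a[rule_format, of None] a[rule_format, of "Some j" for j] by (auto simp: u_def LIM_zero_iff)
  qed
  have AE2: "AE x in lborel. (\<lambda>n. conv P (r (s n)) (x - y)) \<longlonglongrightarrow> P (x - y)"
    using AE_lborel_translate[OF AE1, of "- y"] by (auto elim!: eventually_mono)
  show ?thesis unfolding C_def[symmetric]
  proof (rule pow_int_Fatou[OF p])
    show "AE x in lborel. (\<lambda>n. conv P (r (s n)) (x - y) - conv P (r (s n)) x + (\<Sum>j\<in>UNIV. y $ j * conv (D j) (r (s n)) x))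
      \<longlonglongrightarrow> P (x - y) - P x + (\<Sum>j\<in>UNIV. y $ j * D j x)"
      using AE1 AE2 by eventually_elim (intro tendsto_intros; simp)
    show "pow_int p lborel (\<lambda>x. conv P (r (s n)) (x - y) - conv P (r (s n)) x + (\<Sum>j\<in>UNIV. y $ j * conv (D j) (r (s n)) x)) \<le> C" for n
      by (rule smooth_case)
  qed measurable
qed

section \<open>Mollification in the weighted space\<close>

lemma partial_rho_support: "norm y > 1 \<Longrightarrow> partial i rho y = 0"
  by (rule partial_eq_0_if_const[of "- cball 0 1" _ _ 0]) (auto simp: rho_support)

lemma nn_integral_abs_le:
  fixes k :: "'a::euclidean_space \<Rightarrow> real"
  assumes "k \<in> C0_infty" shows "(\<integral>\<^sup>+y. ennreal \<bar>k y\<bar> \<partial>lborel) \<le> ennreal ((\<integral>y. \<bar>k y\<bar> \<partial>lborel) + 1)"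
  using C0_infty_integrable[OF assms] by (subst nn_integral_eq_integral) (auto intro: ennreal_leI)

lemma conv_dil_bound:
  fixes f k :: "'a::euclidean_space \<Rightarrow> real"
  assumes "\<And>x. \<bar>f x\<bar> \<le> M" "f \<in> borel_measurable borel" "integrable lborel f" and k: "k \<in> C0_infty"
  shows "\<bar>conv f (dil n k) x\<bar> \<le> M * ((\<integral>y. \<bar>k y\<bar> \<partial>lborel) + 1)"
proof -
  note [measurable] = C0_infty_borel[OF k] C0_infty_borel[OF C0_infty_dil[OF k]]
  have M: "M \<ge> 0" using assms(1)[of 0] by linarith
  obtain b where b: "\<And>x. \<bar>dil n k x\<bar> \<le> b" using C0_infty_bounded[OF C0_infty_dil[OF k]] by metis
  have intd: "integrable lborel (dil n k)" by (rule C0_infty_integrable[OF C0_infty_dil[OF k]])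
  have "ennreal (\<integral>y. \<bar>dil n k y\<bar> \<partial>lborel) \<le> ennreal ((\<integral>y. \<bar>k y\<bar> \<partial>lborel) + 1)"
    using nn_integral_abs_le[OF k] nn_integral_eq_integral[OF integrable_abs[OF intd]]
    by (simp add: nn_integral_dil)
  then have le: "(\<integral>y. \<bar>dil n k y\<bar> \<partial>lborel) \<le> (\<integral>y. \<bar>k y\<bar> \<partial>lborel) + 1"
    by (subst (asm) ennreal_le_iff) (auto intro!: add_nonneg_nonneg integral_nonneg_AE)
  have "\<bar>conv f (dil n k) x\<bar> \<le> (\<integral>y. M * \<bar>dil n k y\<bar> \<partial>lborel)"
    unfolding conv_def
  proof (rule order.trans[OF integral_abs_bound], rule integral_mono)
    show "integrable lborel (\<lambda>y. \<bar>f (x - y) * dil n k y\<bar>)"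
      by (intro integrable_abs integrable_conv_integrand[OF assms(3) _ b]) measurable
  qed (use intd assms(1) in \<open>auto simp: abs_mult intro!: mult_right_mono\<close>)
  also have "\<dots> = M * (\<integral>y. \<bar>dil n k y\<bar> \<partial>lborel)" by simp
  also have "\<dots> \<le> M * ((\<integral>y. \<bar>k y\<bar> \<partial>lborel) + 1)" by (rule mult_left_mono[OF le M])
  finally show ?thesis .
qed

text \<open>The function \<open>P\<close> plays the role of \<open>w\<^sup>1\<^sup>/\<^sup>p\<close>, made integrable by a cut-off. Only the product \<open>H P\<close>, not
  \<open>H\<close> itself, is assumed to be weakly differentiable; the limit \<open>G i - H D i\<close> is what the product rule
  would give for \<open>P \<partial>\<^sub>i H\<close>.\<close>

lemma mollify:
  fixes P H :: "real ^ 'n::finite \<Rightarrow> real"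
  assumes p: "p \<ge> 1" and P: "integrable lborel P" "pow_int p lborel P < \<infinity>"
    and D: "\<And>j. integrable lborel (D j)" "\<And>j. pow_int p lborel (D j) < \<infinity>" and wP: "\<And>j. wder j P (D j)"
    and H: "integrable lborel H" "\<And>x. \<bar>H x\<bar> \<le> M"
    and G: "\<And>i. integrable lborel (G i)" "\<And>i. pow_int p lborel (G i) < \<infinity>" and wHP: "\<And>i. wder i (\<lambda>x. H x * P x) (G i)"
  shows "\<exists>s :: nat \<Rightarrow> nat. strict_mono s \<and>
    (\<lambda>n. pow_int p lborel (\<lambda>x. P x * conv H (dil (s n) rho) x - H x * P x)) \<longlonglongrightarrow> 0 \<and>
    (\<forall>i. (\<lambda>n. pow_int p lborel (\<lambda>x. P x * partial i (conv H (dil (s n) rho)) x - (G i x - H x * D i x))) \<longlonglongrightarrow> 0)"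
proof -
  have M: "M \<ge> 0" using H(2)[of 0] by linarith
  define k where "k i j y = y $ j * partial i rho y" for i j :: 'n and y :: "real ^ 'n"
  have kC: "k i j \<in> C0_infty" for i j
    using C0_infty_mult_smooth[OF C0_infty_partial[OF C0_infty_rho] smooth_coord, of i j]
    unfolding k_def by (simp add: mult.commute)
  define r where "r n = (dil n rho :: real ^ 'n \<Rightarrow> real)" for n
  have r: "r n \<in> C0_infty" for n unfolding r_def by (rule C0_infty_dil[OF C0_infty_rho])
  have dr: "partial i (r n) y = real (Suc n) * dil n (partial i rho) y" for i n y
    unfolding r_def by (rule partial_dil[OF C0_infty_rho])
  have kd: "dil n (k i j) y = y $ j * partial i (r n) y" for n i j y
    unfolding dr by (simp add: dil_def k_def mult_ac)
  have [measurable]: "(\<lambda>y::real^'n. y $ j) \<in> borel_measurable borel" for j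
    by (rule borel_measurable_continuous_onI[OF smooth_continuous[OF smooth_coord]])
  note [measurable] = C0_infty_borel[OF r] C0_infty_borel[OF C0_infty_partial[OF r]] wder_measurable[OF wP] wder_measurable[OF wHP]
    C0_infty_borel[OF kC]
  have [measurable]: "H \<in> borel_measurable borel" using borel_measurable_integrable[OF H(1)] by simp
  \<comment> \<open>A subsequence along which all the bounded mollified functions converge almost everywhere.\<close>
  define c where "c i j = (if i = j then - 1 else 0 :: real)" for i j :: 'n
  have intk: "(\<integral>y. k i j y \<partial>lborel) = c i j" for i j
    unfolding k_def c_def by (rule integral_coord_partial_rho)
  define u where "u q n = (case q of None \<Rightarrow> (\<lambda>x. conv H (r n) x - H x)
      | Some (i, j) \<Rightarrow> (\<lambda>x. conv H (dil n (k i j)) x - c i j * H x))" for q n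
  have L1k: "(\<lambda>n. pow_int 1 lborel (\<lambda>x. conv H (dil n \<kappa>) x - (\<integral>y. \<kappa> y \<partial>lborel) * H x)) \<longlonglongrightarrow> 0"
    if kap: "\<kappa> \<in> C0_infty" "\<And>y. norm y > 1 \<Longrightarrow> \<kappa> y = 0" for \<kappa>
  proof -
    obtain b where "\<And>x. \<bar>\<kappa> x\<bar> \<le> b" using C0_infty_bounded[OF kap(1)] by metis
    then show ?thesis
      by (intro approximate_identity[where C=b] H pow_int_1_integrable[OF H(1)] C0_infty_borel kap) auto
  qed
  have fin1: "pow_int 1 lborel (conv H \<kappa>) < \<infinity>" if "\<kappa> \<in> C0_infty" for \<kappa>
  proof -
    note [measurable] = C0_infty_borel[OF that]
    have "pow_int 1 lborel (conv H \<kappa>) \<le> ennreal (((\<integral>y. \<bar>\<kappa> y\<bar> \<partial>lborel) + 1) powr 1) * pow_int 1 lborel H"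
      unfolding conv_def
    proof (rule pow_int_kernel[OF _ _ nn_integral_abs_le[OF that] sigma_finite_lborel sigma_finite_lborel])
      show "pow_int 1 lborel (\<lambda>x. H (x - s)) \<le> pow_int 1 lborel H" for s
        using pow_int_translate[of H 1 "- s"] by simp
      show "(\<integral>y. \<bar>\<kappa> y\<bar> \<partial>lborel) + 1 > 0" by (intro add_nonneg_pos integral_nonneg_AE) auto
    qed (simp_all, measurable)
    also have "\<dots> < \<infinity>" using pow_int_1_integrable[OF H(1)] by (simp add: ennreal_mult_less_top)
    finally show ?thesis .
  qed
  have "\<exists>s :: nat \<Rightarrow> nat. strict_mono s \<and> (AE x in lborel. \<forall>q. (\<lambda>n. u q (s n) x) \<longlonglongrightarrow> 0)"
  proof (rule pow_int_AE_subseq_family[where p=1])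
    fix q n
    show "u q n \<in> borel_measurable lborel" unfolding u_def by (cases q) (auto split: prod.splits)
    have "pow_int 1 lborel (\<lambda>x. conv H \<kappa> x - a * H x) < \<infinity>" if "\<kappa> \<in> C0_infty" for \<kappa> a
      using that fin1[OF that] pow_int_1_integrable[OF integrable_mult_right[OF H(1)]]
      by (intro pow_int_diff_finite) (auto dest: C0_infty_borel)
    from this[OF r[of n], of 1] this[OF C0_infty_dil[OF kC]]
    show "pow_int 1 lborel (u q n) < \<infinity>" unfolding u_def by (cases q) (auto split: prod.splits)
    have ks: "norm y > 1 \<Longrightarrow> k i j y = 0" for i j y
      unfolding k_def by (simp add: partial_rho_support)
    have "(\<lambda>n. pow_int 1 lborel (\<lambda>x. conv H (r n) x - (\<integral>y. rho (y::real^'n) \<partial>lborel) * H x)) \<longlonglongrightarrow> 0"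
      unfolding r_def by (rule L1k[OF C0_infty_rho rho_support])
    then show "(\<lambda>n. pow_int 1 lborel (u q n)) \<longlonglongrightarrow> 0"
      using L1k[OF kC ks] unfolding u_def by (cases q) (auto split: prod.splits simp: integral_rho intk)
  qed simp
  then obtain s where s: "strict_mono s" "AE x in lborel. \<forall>q. (\<lambda>n. u q (s n) x) \<longlonglongrightarrow> 0" by blast
  have AE_H: "AE x in lborel. (\<lambda>n. conv H (r (s n)) x) \<longlonglongrightarrow> H x"
    using s(2) by eventually_elim (auto simp: u_def LIM_zero_iff dest: spec[of _ None])
  have AE_k: "AE x in lborel. \<forall>i j. (\<lambda>n. conv H (dil (s n) (k i j)) x) \<longlonglongrightarrow> c i j * H x"
    using s(2)
  proof eventually_elim
    fix x assume a: "\<forall>q. (\<lambda>n. u q (s n) x) \<longlonglongrightarrow> 0"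
    show "\<forall>i j. (\<lambda>n. conv H (dil (s n) (k i j)) x) \<longlonglongrightarrow> c i j * H x"
      using a[rule_format, of "Some (i, j)" for i j] by (auto simp: u_def LIM_zero_iff)
  qed
  have lim0: "(\<lambda>n. pow_int p lborel (\<lambda>x. P x * conv H (r (s n)) x - H x * P x)) \<longlonglongrightarrow> 0"
  proof (rule pow_int_dominated[OF p])
    let ?K = "M * ((\<integral>y. \<bar>rho (y::real^'n)\<bar> \<partial>lborel) + 1)"
    show "pow_int p lborel (\<lambda>x. ?K * \<bar>P x\<bar>) < \<infinity>"
      by (rule pow_int_bounded_mult[OF p _ P(2), where C="\<bar>?K\<bar>"]) (auto simp: abs_mult)
    show "AE x in lborel. \<bar>P x * conv H (r (s n)) x\<bar> \<le> ?K * \<bar>P x\<bar>" for n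
      using conv_dil_bound[OF H(2) _ H(1) C0_infty_rho, of "s n"]
      by (intro AE_I2) (auto simp: abs_mult mult.commute r_def intro!: mult_left_mono)
    show "AE x in lborel. (\<lambda>n. P x * conv H (r (s n)) x) \<longlonglongrightarrow> H x * P x"
      using AE_H by eventually_elim (subst mult.commute, intro tendsto_intros)
  qed measurable
  have lim_i: "(\<lambda>n. pow_int p lborel (\<lambda>x. P x * partial i (conv H (r (s n))) x - (G i x - H x * D i x))) \<longlonglongrightarrow> 0" for i
  proof -
    define T where "T x y = P (x - y) - P x + (\<Sum>j\<in>UNIV. y $ j * D j x)" for x y
    define I where "I n x = (\<integral>y. (T x y * H (x - y)) * partial i (r n) y \<partial>lborel)" for n x
    have [measurable]: "(\<lambda>(x, y). T x y * H (x - y)) \<in> borel_measurable (lborel \<Otimes>\<^sub>M lborel)"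
      unfolding T_def by measurable
    have [measurable]: "I n \<in> borel_measurable borel" for n
      unfolding I_def T_def by measurable
    have intHP: "integrable lborel (\<lambda>x. H x * P x)"
      using integrable_mult_bounded[OF P(1), of H M] H(2) by (simp add: mult.commute)
    \<comment> \<open>The commutator of mollification and multiplication by \<open>P\<close>, split by Taylor expansion.\<close>
    have split: "P x * partial i (conv H (r n)) x = conv (G i) (r n) x - I n x + (\<Sum>j\<in>UNIV. D j x * conv H (dil n (k i j)) x)" for n x
    proof -
      obtain b where b: "\<And>y. \<bar>partial i (r n) y\<bar> \<le> b" using C0_infty_bounded[OF C0_infty_partial[OF r]] by metis
      have "\<exists>b. \<forall>y. \<bar>dil n (k i j) y\<bar> \<le> b" for j
        by (rule C0_infty_bounded[OF C0_infty_dil[OF kC]]) blast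
      then obtain bk where bk: "\<And>j y. \<bar>dil n (k i j) y\<bar> \<le> bk j" by metis
      have i1: "integrable lborel (\<lambda>y. H (x - y) * P (x - y) * partial i (r n) y)"
        by (rule integrable_conv_integrand[OF intHP _ b]) measurable
      have i2: "integrable lborel (\<lambda>y. H (x - y) * partial i (r n) y)"
        by (rule integrable_conv_integrand[OF H(1) _ b]) measurable
      have i3: "integrable lborel (\<lambda>y. H (x - y) * dil n (k i j) y)" for j
        by (rule integrable_conv_integrand[OF H(1) _ bk]) measurable
      have eq: "(T x y * H (x - y)) * partial i (r n) y = H (x - y) * P (x - y) * partial i (r n) y - P x * (H (x - y) * partial i (r n) y)
          + (\<Sum>j\<in>UNIV. D j x * (H (x - y) * dil n (k i j) y))" for y
        unfolding T_def kd by (simp add: algebra_simps sum_distrib_left sum_distrib_right)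
      have "I n x = (\<integral>y. H (x - y) * P (x - y) * partial i (r n) y \<partial>lborel) - (\<integral>y. P x * (H (x - y) * partial i (r n) y) \<partial>lborel)
          + (\<Sum>j\<in>UNIV. \<integral>y. D j x * (H (x - y) * dil n (k i j) y) \<partial>lborel)"
        unfolding I_def eq
        by (simp only: Bochner_Integration.integral_add[OF Bochner_Integration.integrable_diff[OF i1 integrable_mult_right[OF i2]] Bochner_Integration.integrable_sum[OF integrable_mult_right[OF i3]]]
            Bochner_Integration.integral_diff[OF i1 integrable_mult_right[OF i2]] Bochner_Integration.integral_sum[OF integrable_mult_right[OF i3]])
      also have "\<dots> = conv (\<lambda>x. H x * P x) (partial i (r n)) x - P x * conv H (partial i (r n)) x + (\<Sum>j\<in>UNIV. D j x * conv H (dil n (k i j)) x)"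
        by (simp add: conv_def)
      finally show ?thesis
        by (simp add: partial_conv[OF H(1) r] conv_wder[OF wHP intHP r])
    qed
    have limG: "(\<lambda>n. pow_int p lborel (\<lambda>x. conv (G i) (r (s n)) x - G i x)) \<longlonglongrightarrow> 0"
      using LIMSEQ_subseq_LIMSEQ[OF mollify_L1[OF p G] s(1), of i] by (simp add: o_def r_def)
    \<comment> \<open>The kernel has mass of order \<open>n\<close>, the Taylor remainder on its support is of order \<open>o(1/n)\<close>.\<close>
    have limI: "(\<lambda>n. pow_int p lborel (I n)) \<longlonglongrightarrow> 0"
    proof (rule tendsto_0_ennrealI)
      fix e :: real assume e: "e > 0"
      define K where "K = (\<integral>y. \<bar>partial i rho (y :: real ^ 'n)\<bar> \<partial>lborel) + 1"
      have K: "K > 0" unfolding K_def by (intro add_nonneg_pos integral_nonneg_AE) auto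
      \<comment> \<open>\<open>M + 1\<close> instead of \<open>M\<close> keeps \<open>m\<close> positive.\<close>
      define m where "m = ((K * (M + 1)) powr p) * (real CARD('n) powr p * real CARD('n))"
      have m: "m > 0" unfolding m_def using K M by (intro mult_pos_pos) auto
      have em: "e / m > 0" using e m by simp
      have "\<exists>d>0. \<forall>y. norm y < d \<longrightarrow> pow_int p lborel (\<lambda>x. D j (x + y) - D j x) \<le> ennreal (e / m)" for j
        by (rule pow_int_translation[OF p _ D(2)[of j] em]) (measurable, blast)
      then obtain d where d: "\<And>j. d j > 0" "\<And>j y. norm y < d j \<Longrightarrow> pow_int p lborel (\<lambda>x. D j (x + y) - D j x) \<le> ennreal (e / m)"
        by metis
      define dd where "dd = Min (range d)"
      have dd: "dd > 0" "\<And>j. dd \<le> d j" using d(1) by (auto simp: dd_def)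
      obtain N :: nat where N: "inverse (real (Suc N)) < dd" using reals_Archimedean[OF dd(1)] by blast
      show "eventually (\<lambda>n. pow_int p lborel (I n) \<le> ennreal e) sequentially"
        using eventually_ge_at_top[of N]
      proof eventually_elim
        case (elim n)
        define t where "t = 1 / real (Suc n)"
        have t: "t > 0" "t < dd"
        proof -
          show "t > 0" by (simp add: t_def)
          have "t \<le> 1 / real (Suc N)" unfolding t_def using elim by (intro divide_left_mono) auto
          also have "\<dots> < dd" using N by (simp add: inverse_eq_divide)
          finally show "t < dd" .
        qed
        have Kn: "(\<integral>\<^sup>+y. ennreal \<bar>partial i (r n) y\<bar> \<partial>lborel) \<le> ennreal (real (Suc n) * K)"
        proof -
          note [measurable] = C0_infty_borel[OF C0_infty_partial[OF C0_infty_rho]]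
          have "(\<integral>\<^sup>+y. ennreal \<bar>partial i (r n) y\<bar> \<partial>lborel) = (\<integral>\<^sup>+y. ennreal (real (Suc n)) * ennreal \<bar>dil n (partial i rho) y\<bar> \<partial>lborel)"
            unfolding dr by (simp add: abs_mult ennreal_mult)
          also have "\<dots> = ennreal (real (Suc n)) * (\<integral>\<^sup>+y. ennreal \<bar>dil n (partial i rho) (y :: real ^ 'n)\<bar> \<partial>lborel)"
            by (rule nn_integral_cmult) measurable
          also have "\<dots> \<le> ennreal (real (Suc n)) * ennreal K"
            unfolding K_def nn_integral_dil[OF C0_infty_borel[OF C0_infty_partial[OF C0_infty_rho]]]
            by (intro mult_left_mono nn_integral_abs_le C0_infty_partial C0_infty_rho) auto
          finally show ?thesis using K by (simp add: ennreal_mult)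
        qed
        define B where "B = ennreal (M powr p) * (ennreal (t powr p) * (ennreal (real CARD('n) powr p) * (of_nat CARD('n) * ennreal (e / m))))"
        have "pow_int p lborel (I n) \<le> ennreal ((real (Suc n) * K) powr p) * B"
          unfolding I_def
        proof (rule pow_int_kernel[OF p _ Kn sigma_finite_lborel sigma_finite_lborel])
          show "real (Suc n) * K > 0" using K by simp
          fix y assume "partial i (r n) y \<noteq> 0"
          then have "dil n (partial i rho) y \<noteq> 0" unfolding dr by simp
          then have y: "norm y \<le> t" unfolding t_def
            by (rule dil_support[rotated]) (rule partial_rho_support)
          have "pow_int p lborel (\<lambda>x. T x y * H (x - y)) \<le> pow_int p lborel (\<lambda>x. M * T x y)"
          proof (rule pow_int_mono_AE[OF p], rule AE_I2)
            fix x show "\<bar>T x y * H (x - y)\<bar> \<le> \<bar>M * T x y\<bar>"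
              using mult_left_mono[OF H(2)[of "x - y"], of "\<bar>T x y\<bar>"] M by (simp add: abs_mult mult.commute)
          qed
          also have "\<dots> = ennreal (M powr p) * pow_int p lborel (\<lambda>x. T x y)"
            unfolding T_def using M by (subst pow_int_cmult) auto
          also have "pow_int p lborel (\<lambda>x. T x y) \<le> ennreal (norm y powr p) * (ennreal (real CARD('n) powr p) * (of_nat CARD('n) * ennreal (e / m)))"
            unfolding T_def
          proof (rule pow_int_taylor[OF p P(1) D(1) wP])
            fix z :: "real ^ 'n" and j assume "norm z \<le> norm y"
            then have "norm z < d j" using y t(2) dd(2)[of j] by linarith
            then show "pow_int p lborel (\<lambda>x. D j (x + z) - D j x) \<le> ennreal (e / m)" by (rule d(2))
          qed
          also have "\<dots> \<le> ennreal (t powr p) * (ennreal (real CARD('n) powr p) * (of_nat CARD('n) * ennreal (e / m)))"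
            using y p by (intro mult_right_mono ennreal_leI powr_mono2) auto
          finally show "pow_int p lborel (\<lambda>x. T x y * H (x - y)) \<le> B" by (simp add: B_def mult_left_mono)
        qed measurable
        also have "\<dots> = ennreal (((real (Suc n) * K) powr p) * (M powr p * (t powr p * (real CARD('n) powr p * (real CARD('n) * (e / m))))))"
        proof -
          have "ennreal a * (ennreal b * (ennreal c * (ennreal d * (of_nat l * ennreal q)))) = ennreal (a * (b * (c * (d * (real l * q)))))"
            if "0 \<le> a" "0 \<le> b" "0 \<le> c" "0 \<le> d" "0 \<le> q" for a b c d q l
            using that by (simp add: ennreal_mult ennreal_of_nat_eq_real_of_nat)
          then show ?thesis unfolding B_def using em by simp
        qed
        also have "\<dots> \<le> ennreal e"
        proof (rule ennreal_leI)
          have "((real (Suc n) * K) powr p) * (M powr p * (t powr p * (real CARD('n) powr p * (real CARD('n) * (e / m)))))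
            = (real (Suc n) * K * M * t) powr p * (real CARD('n) powr p * real CARD('n)) * (e / m)"
            by (simp add: powr_mult mult_ac del: of_nat_Suc)
          also have "real (Suc n) * K * M * t = K * M" by (simp add: t_def del: of_nat_Suc)
          also have "(K * M) powr p * (real CARD('n) powr p * real CARD('n)) * (e / m) \<le> m * (e / m)"
            unfolding m_def using K M p em by (intro mult_right_mono powr_mono2 mult_left_mono) (auto simp: m_def)
          also have "\<dots> = e" using m by simp
          finally show "((real (Suc n) * K) powr p) * (M powr p * (t powr p * (real CARD('n) powr p * (real CARD('n) * (e / m))))) \<le> e" .
        qed
        finally show ?case .
      qed
    qed
    have limI': "(\<lambda>n. pow_int p lborel (\<lambda>x. - I (s n) x)) \<longlonglongrightarrow> 0"
      using LIMSEQ_subseq_LIMSEQ[OF limI s(1)] by (simp add: o_def pow_int_def)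
    have limk: "(\<lambda>n. pow_int p lborel (\<lambda>x. (\<Sum>j\<in>UNIV. D j x * conv H (dil (s n) (k i j)) x) - (\<Sum>j\<in>UNIV. D j x * (c i j * H x)))) \<longlonglongrightarrow> 0"
    proof (rule pow_int_dominated[OF p])
      define K where "K j = M * ((\<integral>y. \<bar>k i j y\<bar> \<partial>lborel) + 1)" for j
      have Kb: "\<bar>conv H (dil n (k i j)) x\<bar> \<le> K j" for n j x
        unfolding K_def by (rule conv_dil_bound[OF H(2) _ H(1) kC]) measurable
      show "pow_int p lborel (\<lambda>x. \<Sum>j\<in>UNIV. K j * \<bar>D j x\<bar>) < \<infinity>"
      proof (rule le_less_trans[OF pow_int_sum[OF p]])
        have "pow_int p lborel (\<lambda>x. K j * \<bar>D j x\<bar>) < \<infinity>" for j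
          by (rule pow_int_bounded_mult[OF p _ D(2), where C="\<bar>K j\<bar>"]) (auto simp: abs_mult)
        then show "ennreal (real CARD('n) powr p) * (\<Sum>j\<in>UNIV. pow_int p lborel (\<lambda>x. K j * \<bar>D j x\<bar>)) < \<infinity>"
          by (simp add: ennreal_mult_less_top)
      qed auto
      show "AE x in lborel. \<bar>\<Sum>j\<in>UNIV. D j x * conv H (dil (s n) (k i j)) x\<bar> \<le> (\<Sum>j\<in>UNIV. K j * \<bar>D j x\<bar>)" for n
        unfolding mult.commute[of "D _ _"] using Kb
        by (intro AE_I2 order.trans[OF sum_abs] sum_mono) (auto simp: abs_mult intro: mult_right_mono)
      show "AE x in lborel. (\<lambda>n. \<Sum>j\<in>UNIV. D j x * conv H (dil (s n) (k i j)) x) \<longlonglongrightarrow> (\<Sum>j\<in>UNIV. D j x * (c i j * H x))"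
        using AE_k by eventually_elim (intro tendsto_intros; blast)
    qed measurable
    have csum: "(\<Sum>j\<in>UNIV. D j x * (c i j * H x)) = - (H x * D i x)" for x
      unfolding c_def by (simp add: if_distrib if_distribR cong: if_cong)
    have "P x * partial i (conv H (r n)) x - (G i x - H x * D i x)
      = (conv (G i) (r n) x - G i x) + (- I n x) + ((\<Sum>j\<in>UNIV. D j x * conv H (dil n (k i j)) x) - (\<Sum>j\<in>UNIV. D j x * (c i j * H x)))" for n x
      unfolding split csum by simp
    then show ?thesis
      by (simp only:) (intro pow_int_tendsto_add p limG limI' limk; measurable)
  qed
  show ?thesis using s(1) lim0 lim_i unfolding r_def by blast
qed

section \<open>Uniqueness of weak derivatives\<close>

text \<open>The fundamental lemma of the calculus of variations: if \<open>u\<close> is multiplied by a cut-off function, all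
  mollifications of the product vanish.\<close>

lemma AE_0_if_orthogonal:
  fixes u :: "real ^ 'n::finite \<Rightarrow> real"
  assumes u: "loc_int u" and orth: "\<And>\<eta>. \<eta> \<in> C0_infty \<Longrightarrow> (\<integral>x. u x * \<eta> x \<partial>lborel) = 0"
  shows "AE x in lborel. u x = 0"
proof -
  note [measurable] = loc_int_measurable[OF u]
  have "AE x in lborel. cutoff (real m) x * u x = 0" for m :: nat
  proof -
    let ?z = "cutoff (real m) :: real ^ 'n \<Rightarrow> real"
    have z: "?z \<in> C0_infty" by (rule C0_infty_cutoff)
    note [measurable] = C0_infty_borel[OF z]
    have int: "integrable lborel (\<lambda>x. ?z x * u x)" using loc_int_mult_C0[OF u z] by (simp add: mult.commute)
    have "conv (\<lambda>x. ?z x * u x) (dil n rho) x = 0" for n x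
    proof -
      have r: "dil n rho \<in> C0_infty" by (rule C0_infty_dil[OF C0_infty_rho])
      have "conv (\<lambda>x. ?z x * u x) (dil n rho) x = (\<integral>y. ?z y * u y * dil n rho (x - y) \<partial>lborel)"
        by (rule conv_swap) (use C0_infty_borel[OF r] in measurable)
      also have "\<dots> = (\<integral>y. u y * (?z y * dil n rho ((-1) *\<^sub>R y + x)) \<partial>lborel)" by (simp add: mult_ac)
      also have "\<dots> = 0"
        by (intro orth C0_infty_mult z C0_infty_compose_affine r) simp
      finally show ?thesis .
    qed
    then have "(\<lambda>n::nat. pow_int 1 lborel (\<lambda>x. 0 - ?z x * u x)) \<longlonglongrightarrow> 0"
      using mollify_L1[of 1, OF _ int pow_int_1_integrable[OF int]] by simp
    then have "pow_int 1 lborel (\<lambda>x. 0 - ?z x * u x) = 0" by (simp add: LIMSEQ_const_iff)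
    then show ?thesis
      unfolding pow_int_def by (subst (asm) nn_integral_0_iff_AE) (auto elim!: eventually_mono)
  qed
  then have "AE x in lborel. \<forall>m::nat. cutoff (real m) x * u x = 0" unfolding AE_all_countable by blast
  then show ?thesis
  proof eventually_elim
    fix x assume a: "\<forall>m::nat. cutoff (real m) x * u x = 0"
    obtain m :: nat where "norm x \<le> real m" using real_arch_simple by blast
    with a[rule_format, of m] show "u x = 0" by (simp add: cutoff_eq_1)
  qed
qed

section \<open>Truncation\<close>

lemma isCont_continuous_on_UNIV: "(\<And>x. isCont f x) \<Longrightarrow> continuous_on UNIV f"
  by (simp add: continuous_on_eq_continuous_at)

text \<open>A smooth truncation that converges to the identity, and its derivative. Besides \<open>trunc m\<close> also
  \<open>s \<mapsto> s dtrunc m s\<close> is bounded.\<close>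

definition trunc :: "nat \<Rightarrow> real \<Rightarrow> real" where
  "trunc m v = real (Suc m) * arctan (v / real (Suc m))"

definition dtrunc :: "nat \<Rightarrow> real \<Rightarrow> real" where
  "dtrunc m v = 1 / (1 + (v / real (Suc m))^2)"

lemma trunc_deriv: "(trunc m has_real_derivative dtrunc m v) (at v)"
proof -
  have "((\<lambda>v. real (Suc m) * arctan (v / real (Suc m))) has_real_derivative
      real (Suc m) * (inverse (1 + (v / real (Suc m))^2) * (1 / real (Suc m)))) (at v)"
    by (intro DERIV_cmult DERIV_chain2[of arctan] DERIV_arctan) (auto intro!: derivative_eq_intros)
  then show ?thesis unfolding trunc_def[abs_def] dtrunc_def by (simp add: inverse_eq_divide del: of_nat_Suc)
qed

lemma dtrunc_bounds: "0 < dtrunc m v" "dtrunc m v \<le> 1"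
proof -
  define z where "z = 1 + (v / real (Suc m))^2"
  have "z \<ge> 1" by (simp add: z_def)
  then show "0 < dtrunc m v" "dtrunc m v \<le> 1" unfolding dtrunc_def z_def[symmetric] by (simp_all add: divide_le_eq)
qed

lemma trunc_continuous: "continuous_on UNIV (trunc m)"
  using DERIV_isCont[OF trunc_deriv] by (rule isCont_continuous_on_UNIV)

lemma dtrunc_continuous: "continuous_on UNIV (dtrunc m)"
proof -
  have "1 + (v / real (Suc m))^2 \<noteq> 0" for v using zero_le_power2[of "v / real (Suc m)"] by linarith
  then show ?thesis unfolding dtrunc_def by (intro continuous_intros) auto
qed

lemma trunc_bounded: "\<bar>trunc m v\<bar> \<le> real (Suc m) * 2"
proof -
  have "\<bar>arctan (v / real (Suc m))\<bar> \<le> 2"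
    using arctan_bounded[of "v / real (Suc m)"] pi_less_4 by (auto simp: abs_le_iff)
  then have "real (Suc m) * \<bar>arctan (v / real (Suc m))\<bar> \<le> real (Suc m) * 2" by (intro mult_left_mono) auto
  then show ?thesis by (simp only: trunc_def abs_mult abs_of_nat)
qed

lemma trunc_le: assumes "v \<ge> 0" shows "0 \<le> trunc m v" "trunc m v \<le> v"
proof -
  have "arctan (v / real (Suc m)) \<le> v / real (Suc m)" using assms by (intro arctan_le_self) auto
  then show "trunc m v \<le> v" unfolding trunc_def by (simp add: field_simps del: of_nat_Suc)
  show "0 \<le> trunc m v" unfolding trunc_def using assms by (auto simp: zero_le_arctan_iff)
qed

lemma trunc_minus: "trunc m (- v) = - trunc m v"
  by (simp add: trunc_def arctan_minus)

lemma abs_trunc_le: "\<bar>trunc m v\<bar> \<le> \<bar>v\<bar>"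
  using trunc_le[of v m] trunc_le[of "- v" m] by (cases "v \<ge> 0") (auto simp: trunc_minus)

lemma dtrunc_mult_bounded: "\<bar>dtrunc m v * v\<bar> \<le> real (Suc m) * 2"
proof -
  define N where "N = real (Suc m)"
  have N: "N > 0" by (simp add: N_def)
  define t where "t = v / N"
  have v: "v = N * t" using N by (simp add: t_def)
  have pos: "1 + t^2 > 0" by (intro add_pos_nonneg) auto
  have "\<bar>t\<bar> \<le> 2 * (1 + t^2)"
    using zero_le_power2[of "\<bar>t\<bar> - 1"] zero_le_power2[of t] by (simp add: power2_eq_square algebra_simps)
  then have "\<bar>t\<bar> / (1 + t^2) \<le> 2" using pos by (simp add: divide_le_eq)
  then have "N * (\<bar>t\<bar> / (1 + t^2)) \<le> N * 2" using N by (intro mult_left_mono) auto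
  moreover have "\<bar>dtrunc m v * v\<bar> = N * (\<bar>t\<bar> / (1 + t^2))"
    unfolding dtrunc_def N_def[symmetric] t_def[symmetric] using N pos by (simp add: v abs_mult)
  ultimately show ?thesis by (simp add: N_def)
qed

lemma trunc_tendsto: "(\<lambda>m. trunc m v) \<longlonglongrightarrow> v"
  and dtrunc_tendsto: "(\<lambda>m. dtrunc m v) \<longlonglongrightarrow> 1"
proof -
  have vN: "(\<lambda>m. v / real (Suc m)) \<longlonglongrightarrow> 0"
    using tendsto_mult[OF tendsto_const[of v] LIMSEQ_inverse_real_of_nat] by (simp add: divide_inverse)
  have "(\<lambda>m. 1 / (1 + (v / real (Suc m))^2)) \<longlonglongrightarrow> 1 / (1 + 0^2)" by (intro tendsto_intros vN) auto
  then show "(\<lambda>m. dtrunc m v) \<longlonglongrightarrow> 1" by (simp add: dtrunc_def)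
  show "(\<lambda>m. trunc m v) \<longlonglongrightarrow> v"
  proof (cases "v = 0")
    case False
    have L: "((\<lambda>h. arctan h / h) \<longlongrightarrow> 1) (at 0)"
      using DERIV_arctan[of 0] unfolding DERIV_def by simp
    have vN0: "filterlim (\<lambda>m. v / real (Suc m)) (at 0) sequentially"
      using vN False by (auto simp: filterlim_at)
    from tendsto_mult[OF tendsto_const[of v] filterlim_compose[OF L vN0]] show ?thesis
      using False by (simp add: trunc_def mult.commute)
  qed (simp add: trunc_def)
qed

text \<open>If \<open>f \<phi>\<^sup>p\<close> is weakly differentiable then so is \<open>T(f) \<phi>\<close> for a bounded truncation \<open>T\<close>. The chain rule is
  applied to \<open>F(a, v) = T(a (v\<^sup>2 + \<epsilon>)\<^sup>-\<^sup>p\<^sup>/\<^sup>2) v\<close> at \<open>a = f \<phi>\<^sup>p\<close> and \<open>v = \<phi>\<close>; the quotient \<open>a / v\<^sup>p = f\<close> is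
  recovered for \<open>\<epsilon> \<rightarrow> 0\<close>. All terms are dominated because \<open>T\<close> and \<open>s T'(s)\<close> are bounded. The value \<open>0\<close> on
  \<open>{\<phi> = 0}\<close> is the limit there, whatever the value of \<open>f\<close>.\<close>

lemma truncated_wder:
  fixes \<phi> f D g b :: "real ^ 'n::finite \<Rightarrow> real" and T T' :: "real \<Rightarrow> real"
  assumes p: "p \<ge> 1" and phi: "\<And>x. \<phi> x \<ge> 0" and w\<phi>: "wder i \<phi> D"
    and f[measurable]: "f \<in> borel_measurable borel" and g[measurable]: "g \<in> borel_measurable borel"
    and b: "\<And>x. b x = (if \<phi> x = 0 then 0 else p * \<phi> x powr (p - 1) * D x)"
    and wf: "wder i (\<lambda>x. f x * \<phi> x powr p) (\<lambda>x. g x * \<phi> x powr p + f x * b x)"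
    and g\<phi>: "loc_int (\<lambda>x. g x * \<phi> x)"
    and T: "\<And>s. (T has_real_derivative T' s) (at s)" "continuous_on UNIV T'" "\<And>s. \<bar>T s\<bar> \<le> A" "\<And>s. \<bar>T' s\<bar> \<le> 1"
      "\<And>s. \<bar>T' s * s\<bar> \<le> A" "T 0 = 0"
  shows "wder i (\<lambda>x. (if \<phi> x = 0 then 0 else T (f x)) * \<phi> x) (\<lambda>x. T' (f x) * (g x * \<phi> x) + (if \<phi> x = 0 then 0 else T (f x)) * D x)"
proof -
  have A: "A \<ge> 0" using T(3)[of 0] by linarith
  note [measurable] = wder_measurable[OF w\<phi>] wder_measurable[OF wf]
  have Tcont: "continuous_on UNIV T" using DERIV_isCont[OF T(1)] by (rule isCont_continuous_on_UNIV)
  note [measurable] = borel_measurable_continuous_onI[OF Tcont] borel_measurable_continuous_onI[OF T(2)]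
  define e where "e m = (inverse (real (Suc m)))^2" for m
  have e: "e m > 0" for m by (simp add: e_def)
  have e0: "e \<longlonglongrightarrow> 0" unfolding e_def using tendsto_power[OF LIMSEQ_inverse_real_of_nat, of 2] by simp
  define r where "r m v = (v^2 + e m) powr (- p / 2)" for m v
  have pos: "v^2 + e m > 0" for m and v :: real using e[of m] by (intro add_nonneg_pos) auto
  have pos_ne: "v^2 + e m \<noteq> 0" for m and v :: real using pos[of v m] by simp
  define F where "F m a v = T (a * r m v) * v" for m a v
  define F1 where "F1 m a v = T' (a * r m v) * (r m v * v)" for m a v
  define F2 where "F2 m a v = T (a * r m v) - p * (T' (a * r m v) * (a * r m v)) * (v^2 / (v^2 + e m))" for m a v
  have r_pos: "r m v > 0" for m v unfolding r_def using pos[of v m] by simp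
  have r_deriv: "(r m has_real_derivative - p * v * r m v / (v^2 + e m)) (at v)" for m v
  proof -
    have "((\<lambda>v. (v^2 + e m) powr (- p / 2)) has_real_derivative (- p / 2) * (v^2 + e m) powr (- p / 2 - of_nat 1) * (2 * v)) (at v)"
      by (rule DERIV_fun_powr) (use pos in \<open>auto intro!: derivative_eq_intros\<close>)
    moreover have "(v^2 + e m) powr (- p / 2 - of_nat 1) = r m v / (v^2 + e m)"
      unfolding r_def using pos[of v m] by (simp add: powr_diff)
    ultimately show ?thesis unfolding r_def[abs_def, symmetric] by (simp add: r_def[abs_def] mult_ac)
  qed
  have r_cont: "continuous_on UNIV (r m)" for m using DERIV_isCont[OF r_deriv] by (rule isCont_continuous_on_UNIV)
  have q_cont: "continuous_on UNIV (\<lambda>v::real. v^2 / (v^2 + e m))" for m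
    by (intro continuous_intros) (simp add: pos_ne)
  have F_wder: "wder i (\<lambda>x. F m (f x * \<phi> x powr p) (\<phi> x))
     (\<lambda>x. F1 m (f x * \<phi> x powr p) (\<phi> x) * (g x * \<phi> x powr p + f x * b x) + F2 m (f x * \<phi> x powr p) (\<phi> x) * D x)" for m
  proof (rule wder_chain[OF _ _ _ _ _ wf w\<phi>])
    fix a v :: real
    have r': "((\<lambda>z. r m (snd z)) has_derivative (\<lambda>h. (- p * v * r m v / (v^2 + e m)) * snd h)) (at (a, v))"
      using has_derivative_compose[OF has_derivative_snd[OF has_derivative_ident] r_deriv[of m "snd (a, v)", unfolded has_field_derivative_def]]
      by simp
    have ar: "((\<lambda>z. fst z * r m (snd z)) has_derivative (\<lambda>h. a * ((- p * v * r m v / (v^2 + e m)) * snd h) + fst h * r m v)) (at (a, v))"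
      using has_derivative_mult[OF has_derivative_fst[OF has_derivative_ident] r'] by simp
    have "((\<lambda>z. T (fst z * r m (snd z))) has_derivative (\<lambda>h. T' (a * r m v) * (a * ((- p * v * r m v / (v^2 + e m)) * snd h) + fst h * r m v))) (at (a, v))"
      using has_derivative_compose[OF ar, of T "\<lambda>h. T' (a * r m v) * h"] T(1)[of "a * r m v"] by (simp add: has_field_derivative_def)
    from has_derivative_mult[OF this has_derivative_snd[OF has_derivative_ident]]
    show "((\<lambda>z. F m (fst z) (snd z)) has_derivative (\<lambda>h. F1 m a v * fst h + F2 m a v * snd h)) (at (a, v))"
      unfolding F_def
      by (rule has_derivative_eq_rhs) (auto simp: fun_eq_iff F1_def F2_def algebra_simps power2_eq_square)
    have arc: "continuous_on UNIV (\<lambda>z. fst z * r m (snd z))"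
      by (intro continuous_intros continuous_on_compose2[OF r_cont]) auto
    show "continuous_on UNIV (\<lambda>z. F1 m (fst z) (snd z))"
      unfolding F1_def
      by (intro continuous_intros continuous_on_compose2[OF T(2) arc] continuous_on_compose2[OF r_cont]) auto
    show "continuous_on UNIV (\<lambda>z. F2 m (fst z) (snd z))"
      unfolding F2_def
      by (intro continuous_intros continuous_on_compose2[OF T(2) arc] continuous_on_compose2[OF Tcont arc] arc
           continuous_on_compose2[OF r_cont] continuous_on_compose2[OF q_cont]) auto
    let ?C = "e m powr ((1 - p) / 2) + A + p * A"
    have "r m v * \<bar>v\<bar> \<le> e m powr ((1 - p) / 2)"
    proof -
      have "\<bar>v\<bar> = (v^2) powr (1/2)" by (simp add: powr_half_sqrt)
      also have "\<dots> \<le> (v^2 + e m) powr (1/2)" using e[of m] by (intro powr_mono2) auto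
      finally have "r m v * \<bar>v\<bar> \<le> (v^2 + e m) powr (- p / 2) * (v^2 + e m) powr (1/2)"
        unfolding r_def by (intro mult_left_mono) auto
      also have "\<dots> = (v^2 + e m) powr ((1 - p) / 2)" by (simp add: powr_add[symmetric] diff_divide_distrib)
      also have "\<dots> \<le> e m powr ((1 - p) / 2)" using p e[of m] by (intro powr_mono2') auto
      finally show ?thesis .
    qed
    moreover have "\<bar>F1 m a v\<bar> \<le> 1 * (r m v * \<bar>v\<bar>)"
      unfolding F1_def abs_mult using r_pos[of m v] T(4) by (intro mult_mono) auto
    moreover have "0 \<le> A + p * A" using A p by auto
    ultimately show "\<bar>F1 m a v\<bar> \<le> ?C" by linarith
    have "\<bar>F2 m a v\<bar> \<le> A + p * A * 1"
      unfolding F2_def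
    proof (rule order.trans[OF abs_triangle_ineq4], rule add_mono[OF T(3)])
      show "\<bar>p * (T' (a * r m v) * (a * r m v)) * (v\<^sup>2 / (v\<^sup>2 + e m))\<bar> \<le> p * A * 1"
        unfolding abs_mult[of "p * _"] abs_mult[of p] using p A T(5) pos[of v m] e[of m]
        by (intro mult_mono) auto
    qed
    then show "\<bar>F2 m a v\<bar> \<le> ?C" using powr_ge_zero[of "e m" "(1 - p) / 2"] by linarith
  qed
  \<comment> \<open>The argument of \<open>T\<close> is \<open>f q\<close> with \<open>0 \<le> q \<le> 1\<close> and \<open>q \<rightarrow> 1\<close> on \<open>{\<phi> > 0}\<close>.\<close>
  define q where "q m x = \<phi> x powr p * r m (\<phi> x)" for m x
  define t where "t m x = (\<phi> x)^2 / ((\<phi> x)^2 + e m)" for m x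
  have facts: "(\<lambda>m. q m x) \<longlonglongrightarrow> 1" "(\<lambda>m. t m x) \<longlonglongrightarrow> 1" "\<And>m. 0 \<le> q m x \<and> q m x \<le> 1" "\<And>m. 0 \<le> t m x \<and> t m x \<le> 1" if x: "\<phi> x > 0" for x
  proof -
    have l: "(\<lambda>m. (\<phi> x)^2 + e m) \<longlonglongrightarrow> (\<phi> x)^2 + 0" by (intro tendsto_intros e0)
    have eq: "\<phi> x powr p * ((\<phi> x)^2) powr (- p / 2) = 1"
    proof -
      have "((\<phi> x)^2) powr (- p / 2) = \<phi> x powr (- p)"
        using x powr_powr[of "\<phi> x" 2 "- p / 2"] by (simp add: powr_numeral)
      then show ?thesis using x by (simp add: powr_add[symmetric])
    qed
    have "(\<lambda>m. \<phi> x powr p * ((\<phi> x)^2 + e m) powr (- p / 2)) \<longlonglongrightarrow> \<phi> x powr p * ((\<phi> x)^2 + 0) powr (- p / 2)"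
      by (intro tendsto_intros l) (use x in auto)
    then show "(\<lambda>m. q m x) \<longlonglongrightarrow> 1" using eq by (simp add: q_def r_def)
    have "(\<lambda>m. t m x) \<longlonglongrightarrow> (\<phi> x)^2 / ((\<phi> x)^2 + 0)"
      unfolding t_def by (intro tendsto_divide tendsto_const l) (use x in auto)
    then show "(\<lambda>m. t m x) \<longlonglongrightarrow> 1" using x by simp
    fix m
    have "((\<phi> x)^2 + e m) powr (- p / 2) \<le> ((\<phi> x)^2) powr (- p / 2)" using x e[of m] p by (intro powr_mono2') auto
    then have "q m x \<le> \<phi> x powr p * ((\<phi> x)^2) powr (- p / 2)" unfolding q_def r_def by (intro mult_left_mono) auto
    then show "0 \<le> q m x \<and> q m x \<le> 1" using eq r_pos[of m "\<phi> x"] by (simp add: q_def)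
    show "0 \<le> t m x \<and> t m x \<le> 1" unfolding t_def using pos[of "\<phi> x" m] e[of m] by auto
  qed
  let ?u = "\<lambda>m x. F m (f x * \<phi> x powr p) (\<phi> x)"
  let ?g = "\<lambda>m x. F1 m (f x * \<phi> x powr p) (\<phi> x) * (g x * \<phi> x powr p + f x * b x) + F2 m (f x * \<phi> x powr p) (\<phi> x) * D x"
  have formF: "?u m x = (if \<phi> x = 0 then 0 else T (f x * q m x)) * \<phi> x" for m x
    by (simp add: F_def q_def mult_ac)
  have formG: "?g m x
    = (if \<phi> x = 0 then 0 else q m x * (T' (f x * q m x) * (g x * \<phi> x)) + p * (T' (f x * q m x) * (f x * q m x)) * D x
       + (T (f x * q m x) - p * (T' (f x * q m x) * (f x * q m x)) * t m x) * D x)" for m x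
  proof (cases "\<phi> x = 0")
    case True
    then show ?thesis using p by (simp add: b F2_def T(6))
  next
    case False
    then have x: "\<phi> x > 0" using phi[of x] by simp
    have 1: "r m (\<phi> x) * \<phi> x * \<phi> x powr (p - 1) = q m x"
      using x powr_add[of "\<phi> x" 1 "p - 1"] by (simp add: q_def mult_ac)
    have "F1 m (f x * \<phi> x powr p) (\<phi> x) * (g x * \<phi> x powr p + f x * b x)
      = T' (f x * q m x) * (g x * \<phi> x) * (\<phi> x powr p * r m (\<phi> x)) + T' (f x * q m x) * f x * p * D x * (r m (\<phi> x) * \<phi> x * \<phi> x powr (p - 1))"
      using x by (simp add: F1_def q_def b algebra_simps)
    also have "\<dots> = q m x * (T' (f x * q m x) * (g x * \<phi> x)) + p * (T' (f x * q m x) * (f x * q m x)) * D x"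
      unfolding 1 q_def[symmetric] by (simp add: mult_ac)
    finally show ?thesis using x by (simp add: F2_def q_def t_def mult.assoc)
  qed
  show ?thesis
  proof (rule wder_limit[OF F_wder])
    show "loc_int (\<lambda>x. A * \<bar>\<phi> x\<bar>)" using w\<phi> by (intro loc_int_cmult loc_int_abs) (simp add: wder_def)
    show "loc_int (\<lambda>x. \<bar>g x * \<phi> x\<bar> + (A + 2 * p * A) * \<bar>D x\<bar>)" using w\<phi> by (intro loc_int_add loc_int_cmult loc_int_abs g\<phi>) (simp add: wder_def)
    show "AE x in lborel. \<bar>?u m x\<bar> \<le> A * \<bar>\<phi> x\<bar>" for m
      unfolding formF abs_mult using T(3) A by (intro AE_I2 mult_right_mono) auto
    show "AE x in lborel. (\<lambda>m. ?u m x) \<longlonglongrightarrow> (if \<phi> x = 0 then 0 else T (f x)) * \<phi> x"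
    proof (rule AE_I2)
      fix x
      show "(\<lambda>m. ?u m x) \<longlonglongrightarrow> (if \<phi> x = 0 then 0 else T (f x)) * \<phi> x"
      proof (cases "\<phi> x = 0")
        case False
        then have x: "\<phi> x > 0" using phi[of x] by simp
        have "(\<lambda>m. f x * q m x) \<longlonglongrightarrow> f x * 1" by (intro tendsto_intros facts(1)[OF x])
        from continuous_on_tendsto_compose[OF Tcont this] have "(\<lambda>m. T (f x * q m x)) \<longlonglongrightarrow> T (f x)" by simp
        then show ?thesis unfolding formF using False by (simp add: tendsto_mult_right)
      qed (simp add: F_def)
    qed
    show "AE x in lborel. \<bar>?g m x\<bar>
       \<le> \<bar>g x * \<phi> x\<bar> + (A + 2 * p * A) * \<bar>D x\<bar>" for m
    proof (rule AE_I2)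
      fix x
      show "\<bar>?g m x\<bar>
       \<le> \<bar>g x * \<phi> x\<bar> + (A + 2 * p * A) * \<bar>D x\<bar>"
      proof (cases "\<phi> x = 0")
        case True
        then show ?thesis unfolding formG using A p by simp
      next
        case False
        then have x: "\<phi> x > 0" using phi[of x] by simp
        let ?s = "f x * q m x"
        have q: "0 \<le> q m x" "q m x \<le> 1" and t: "0 \<le> t m x" "t m x \<le> 1" using facts(3,4)[OF x] by auto
        have "\<bar>q m x * (T' ?s * (g x * \<phi> x))\<bar> \<le> 1 * (1 * \<bar>g x * \<phi> x\<bar>)"
          unfolding abs_mult[of "q m x"] abs_mult[of "T' ?s"] using q T(4) by (intro mult_mono) auto
        moreover have "\<bar>p * (T' ?s * ?s) * D x\<bar> \<le> p * A * \<bar>D x\<bar>"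
          unfolding abs_mult[of "p * _"] abs_mult[of p] using p A T(5) by (intro mult_mono) auto
        moreover have "\<bar>(T ?s - p * (T' ?s * ?s) * t m x) * D x\<bar> \<le> (A + p * A * 1) * \<bar>D x\<bar>"
          unfolding abs_mult[of "_ - _"]
        proof (rule mult_right_mono, rule order.trans[OF abs_triangle_ineq4], rule add_mono[OF T(3)])
          show "\<bar>p * (T' ?s * ?s) * t m x\<bar> \<le> p * A * 1"
            unfolding abs_mult[of "p * _"] abs_mult[of p] using p T(5) t A by (intro mult_mono mult_nonneg_nonneg) auto
        qed auto
        ultimately have "\<bar>q m x * (T' ?s * (g x * \<phi> x)) + p * (T' ?s * ?s) * D x + (T ?s - p * (T' ?s * ?s) * t m x) * D x\<bar>
          \<le> 1 * (1 * \<bar>g x * \<phi> x\<bar>) + p * A * \<bar>D x\<bar> + (A + p * A * 1) * \<bar>D x\<bar>"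
          by (intro order.trans[OF abs_triangle_ineq] add_mono) auto
        also have "\<dots> = \<bar>g x * \<phi> x\<bar> + (A + 2 * p * A) * \<bar>D x\<bar>" by (simp add: algebra_simps)
        finally show ?thesis unfolding formG using False by simp
      qed
    qed
    show "AE x in lborel. (\<lambda>m. ?g m x)
       \<longlonglongrightarrow> T' (f x) * (g x * \<phi> x) + (if \<phi> x = 0 then 0 else T (f x)) * D x"
    proof (rule AE_I2)
      fix x
      show "(\<lambda>m. ?g m x)
       \<longlonglongrightarrow> T' (f x) * (g x * \<phi> x) + (if \<phi> x = 0 then 0 else T (f x)) * D x"
      proof (cases "\<phi> x = 0")
        case True
        then show ?thesis unfolding formG by simp
      next
        case False
        then have x: "\<phi> x > 0" using phi[of x] by simp
        have l: "(\<lambda>m. f x * q m x) \<longlonglongrightarrow> f x" using tendsto_mult[OF tendsto_const[of "f x"] facts(1)[OF x]] by simp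
        have lT: "(\<lambda>m. T (f x * q m x)) \<longlonglongrightarrow> T (f x)" using continuous_on_tendsto_compose[OF Tcont l] by simp
        have lT': "(\<lambda>m. T' (f x * q m x)) \<longlonglongrightarrow> T' (f x)" using continuous_on_tendsto_compose[OF T(2) l] by simp
        have "(\<lambda>m. q m x * (T' (f x * q m x) * (g x * \<phi> x)) + p * (T' (f x * q m x) * (f x * q m x)) * D x
            + (T (f x * q m x) - p * (T' (f x * q m x) * (f x * q m x)) * t m x) * D x)
          \<longlonglongrightarrow> 1 * (T' (f x) * (g x * \<phi> x)) + p * (T' (f x) * f x) * D x + (T (f x) - p * (T' (f x) * f x) * 1) * D x"
          by (intro tendsto_intros l lT lT' facts(1,2)[OF x])
        then show ?thesis unfolding formG using False by (simp add: algebra_simps)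
      qed
    qed
  qed measurable
qed

text \<open>The weight \<open>\<phi>\<^sup>p\<close> itself has the weak derivative \<open>p \<phi>\<^sup>p\<^sup>-\<^sup>1 D\<close>. For \<open>p = 1\<close> this contains the fact that
  \<open>D = 0\<close> almost everywhere on \<open>{\<phi> = 0}\<close>; the regularisation \<open>s\<^sup>2 (s\<^sup>2 + \<epsilon>)\<^sup>p\<^sup>/\<^sup>2\<^sup>-\<^sup>1\<close> of \<open>s\<^sup>p\<close>, whose derivative vanishes
  at \<open>0\<close>, covers it without a case distinction.\<close>

lemma wder_powr:
  fixes \<phi> D b :: "real ^ 'n::finite \<Rightarrow> real"
  assumes p: "p \<ge> 1" and phi: "\<And>x. \<phi> x \<ge> 0" and w\<phi>: "wder i \<phi> D"
    and l: "loc_int (\<lambda>x. \<phi> x powr p)" "loc_int (\<lambda>x. \<bar>D x\<bar> powr p)"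
    and b: "\<And>x. b x = (if \<phi> x = 0 then 0 else p * \<phi> x powr (p - 1) * D x)"
  shows "wder i (\<lambda>x. \<phi> x powr p) b"
proof -
  note [measurable] = wder_measurable[OF w\<phi>]
  have [measurable]: "b \<in> borel_measurable borel" unfolding b[abs_def] by measurable
  define e where "e m = (inverse (real (Suc m)))^2" for m
  have e: "e m > 0" "e m \<le> 1" for m by (auto simp: e_def power_le_one inverse_le_1_iff)
  have e0: "e \<longlonglongrightarrow> 0" unfolding e_def using tendsto_power[OF LIMSEQ_inverse_real_of_nat, of 2] by simp
  have pos: "v^2 + e m > 0" for m and v :: real using e[of m] by (intro add_nonneg_pos) auto
  have pos_ne: "v^2 + e m \<noteq> 0" for m and v :: real using pos[of v m] by simp
  \<comment> \<open>\<open>G m\<close> is composed with \<open>trunc m\<close>, since for \<open>p > 1\<close> its derivative is unbounded.\<close>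
  define G where "G m s = s^2 * (s^2 + e m) powr (p / 2 - 1)" for m s
  define G' where "G' m s = s * (s^2 + e m) powr (p / 2 - 1) * (2 + (p - 2) * (s^2 / (s^2 + e m)))" for m s
  have G: "(G m has_real_derivative G' m s) (at s)" for m s
  proof -
    have 1: "((\<lambda>s. (s^2 + e m) powr (p / 2 - 1)) has_real_derivative (p / 2 - 1) * (s^2 + e m) powr (p / 2 - 1 - of_nat 1) * (2 * s)) (at s)"
      by (rule DERIV_fun_powr) (use pos in \<open>auto intro!: derivative_eq_intros\<close>)
    have 2: "(s^2 + e m) powr (p / 2 - 1 - of_nat 1) = (s^2 + e m) powr (p / 2 - 1) / (s^2 + e m)"
      using pos[of s m] powr_diff[of "s^2 + e m" "p / 2 - 1" "of_nat 1"] by simp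
    have "((\<lambda>s. s^2) has_real_derivative 2 * s) (at s)" by (auto intro!: derivative_eq_intros)
    from DERIV_mult[OF this 1[unfolded 2]] have "(G m has_real_derivative 2 * s * (s^2 + e m) powr (p / 2 - 1)
        + (p / 2 - 1) * ((s^2 + e m) powr (p / 2 - 1) / (s^2 + e m)) * (2 * s) * s^2) (at s)"
      by (simp only: G_def[abs_def])
    moreover have "2 * s * c + (p / 2 - 1) * (c / d) * (2 * s) * s^2 = s * c * (2 + (p - 2) * (s^2 / d))" for c d :: real
    proof -
      have "2 * s * c + (p / 2 - 1) * (c * q) * (2 * s) * s^2 = s * c * (2 + (p - 2) * (s^2 * q))" for q
        by (simp add: algebra_simps)
      from this[of "inverse d"] show ?thesis by (simp only: divide_inverse)
    qed
    ultimately show ?thesis unfolding G'_def by (simp only:)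
  qed
  have Gcont: "continuous_on UNIV (G' m)" for m
    unfolding G'_def by (intro continuous_intros) (simp_all add: pos_ne)
  have G'_bd: "\<bar>G' m s\<bar> \<le> (p + 2) * (s^2 + 1) powr ((p - 1) / 2)" for m s
  proof -
    have t: "0 \<le> s^2 / (s^2 + e m)" "s^2 / (s^2 + e m) \<le> 1" using pos[of s m] e[of m] by auto
    have t3: "\<bar>s^2 / (s^2 + e m)\<bar> \<le> 1" using t by linarith
    have "\<bar>(p - 2) * (s^2 / (s^2 + e m))\<bar> \<le> p * 1"
      unfolding abs_mult by (intro mult_mono t3) (use p in auto)
    then have 1: "\<bar>2 + (p - 2) * (s^2 / (s^2 + e m))\<bar> \<le> p + 2" by linarith
    have "\<bar>s\<bar> = (s^2) powr (1/2)" by (simp add: powr_half_sqrt)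
    also have "\<dots> \<le> (s^2 + e m) powr (1/2)" using e[of m] by (intro powr_mono2) auto
    finally have "\<bar>s\<bar> * (s^2 + e m) powr (p / 2 - 1) \<le> (s^2 + e m) powr (1/2) * (s^2 + e m) powr (p / 2 - 1)"
      by (intro mult_right_mono) auto
    also have "\<dots> = (s^2 + e m) powr ((p - 1) / 2)" by (simp add: powr_add[symmetric] diff_divide_distrib)
    also have "\<dots> \<le> (s^2 + 1) powr ((p - 1) / 2)" using p pos[of s m] e[of m] by (intro powr_mono2) auto
    finally have "\<bar>s\<bar> * (s^2 + e m) powr (p / 2 - 1) * \<bar>2 + (p - 2) * (s^2 / (s^2 + e m))\<bar> \<le> (s^2 + 1) powr ((p - 1) / 2) * (p + 2)"
      using 1 by (intro mult_mono) auto
    then show ?thesis unfolding G'_def abs_mult by (simp add: mult.commute)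
  qed
  have F_wder: "wder i (\<lambda>x. G m (trunc m (\<phi> x))) (\<lambda>x. (G' m (trunc m (\<phi> x)) * dtrunc m (\<phi> x)) * D x + 0 * D x)" for m
  proof (rule wder_chain[OF _ _ _ _ _ w\<phi> w\<phi>, where F="\<lambda>a v. G m (trunc m a)"
        and ?F1.0="\<lambda>a v. G' m (trunc m a) * dtrunc m a" and ?F2.0="\<lambda>a v. 0"])
    fix a v :: real
    have "((\<lambda>a. G m (trunc m a)) has_real_derivative G' m (trunc m a) * dtrunc m a) (at a)"
      by (rule DERIV_chain2[OF G trunc_deriv])
    then show "((\<lambda>z. G m (trunc m (fst z))) has_derivative (\<lambda>h. G' m (trunc m a) * dtrunc m a * fst h + 0 * snd h)) (at (a, v))"
      using has_derivative_compose[OF has_derivative_fst[OF has_derivative_ident], of "\<lambda>a. G m (trunc m a)" _ "(a, v)"]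
      by (simp add: has_field_derivative_def)
    show "continuous_on UNIV (\<lambda>z. G' m (trunc m (fst z)) * dtrunc m (fst z))"
      by (intro continuous_intros continuous_on_compose2[OF Gcont] continuous_on_compose2[OF trunc_continuous] continuous_on_compose2[OF dtrunc_continuous]) auto
    let ?C = "(p + 2) * ((real (Suc m) * 2)^2 + 1) powr ((p - 1) / 2)"
    have "\<bar>G' m (trunc m a)\<bar> \<le> ?C"
    proof (rule order.trans[OF G'_bd], intro mult_left_mono powr_mono2 add_right_mono)
      show "(trunc m a)^2 \<le> (real (Suc m) * 2)^2" using trunc_bounded[of m a] by (intro iffD1[OF abs_le_square_iff]) simp
    qed (use p in auto)
    then have "\<bar>G' m (trunc m a)\<bar> * dtrunc m a \<le> ?C * 1" using dtrunc_bounds[of m a] p by (intro mult_mono) auto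
    then show "\<bar>G' m (trunc m a) * dtrunc m a\<bar> \<le> ?C" using dtrunc_bounds[of m a] by (simp add: abs_mult)
    show "\<bar>0 :: real\<bar> \<le> ?C" using p by simp
  qed auto
  have le1: "(v^2 + 1) powr (p / 2) \<le> 2 powr p * (1 + v powr p)" if "v \<ge> 0" for v :: real
  proof -
    have "(v^2 + 1) powr (p / 2) \<le> ((1 + v)^2) powr (p / 2)" using that p by (intro powr_mono2) (auto simp: power2_eq_square algebra_simps)
    also have "\<dots> = (1 + v) powr p" using that powr_powr[of "1 + v" 2 "p / 2"] by (simp add: powr_numeral)
    also have "\<dots> \<le> 2 powr p * (1 + v powr p)" using powr_add_le[OF p, of 1 v] that by simp
    finally show ?thesis .
  qed
  have le2: "(v^2 + 1) powr ((p - 1) / 2) * d \<le> 2 powr p * (1 + v powr p) + d powr p" if "v \<ge> 0" "d \<ge> 0" for v d :: real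
  proof -
    have "(v^2 + 1) powr ((p - 1) / 2) * d \<le> (v^2 + 1) powr (p / 2) + d powr p"
    proof (cases "d \<le> (v^2 + 1) powr (1/2)")
      case True
      then have "(v^2 + 1) powr ((p - 1) / 2) * d \<le> (v^2 + 1) powr ((p - 1) / 2) * (v^2 + 1) powr (1/2)" by (intro mult_left_mono) auto
      also have "\<dots> = (v^2 + 1) powr (p / 2)" by (simp add: powr_add[symmetric] diff_divide_distrib)
      finally show ?thesis by (simp add: add_increasing2)
    next
      case False
      have dpos: "d > 0" using False powr_ge_zero[of "v^2+1" "1/2"] by linarith
      have "(v^2 + 1) powr ((p - 1) / 2) = ((v^2 + 1) powr (1/2)) powr (p - 1)" by (simp add: powr_powr)
      also have "\<dots> \<le> d powr (p - 1)" using False p by (intro powr_mono2) auto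
      finally have "(v^2 + 1) powr ((p - 1) / 2) * d \<le> d powr (p - 1) * d" using dpos by (intro mult_right_mono) auto
      also have "\<dots> = d powr p" using dpos powr_add[of d "p - 1" 1] by simp
      finally show ?thesis by (simp add: add_increasing)
    qed
    with le1[OF that(1)] show ?thesis by linarith
  qed
  show ?thesis
  proof (rule wder_limit[OF F_wder])
    show "loc_int (\<lambda>x. 2 powr p * (1 + \<phi> x powr p))" by (intro loc_int_cmult loc_int_add loc_int_const l)
    show "loc_int (\<lambda>x. (p + 2) * (2 powr p * (1 + \<phi> x powr p) + \<bar>D x\<bar> powr p))" by (intro loc_int_cmult loc_int_add loc_int_const l)
    show "AE x in lborel. \<bar>G m (trunc m (\<phi> x))\<bar> \<le> 2 powr p * (1 + \<phi> x powr p)" for m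
    proof (rule AE_I2)
      fix x
      let ?s = "trunc m (\<phi> x)"
      have "G m ?s \<le> (?s^2 + e m) * (?s^2 + e m) powr (p / 2 - 1)"
        unfolding G_def using e[of m] by (intro mult_right_mono) auto
      also have "\<dots> = (?s^2 + e m) powr (p / 2)" using pos[of ?s m] powr_add[of "?s^2 + e m" 1 "p / 2 - 1"] by simp
      also have "\<dots> \<le> ((\<phi> x)^2 + 1) powr (p / 2)"
        using p pos[of ?s m] e[of m] trunc_le[OF phi, of m x] by (intro powr_mono2 add_mono power_mono) auto
      also have "\<dots> \<le> 2 powr p * (1 + \<phi> x powr p)" by (rule le1[OF phi])
      finally show "\<bar>G m ?s\<bar> \<le> 2 powr p * (1 + \<phi> x powr p)" by (simp add: G_def abs_mult)
    qed
    show "AE x in lborel. (\<lambda>m. G m (trunc m (\<phi> x))) \<longlonglongrightarrow> \<phi> x powr p"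
    proof (rule AE_I2)
      fix x
      show "(\<lambda>m. G m (trunc m (\<phi> x))) \<longlonglongrightarrow> \<phi> x powr p"
      proof (cases "\<phi> x = 0")
        case False
        then have x: "\<phi> x > 0" using phi[of x] by simp
        have "(\<lambda>m. G m (trunc m (\<phi> x))) \<longlonglongrightarrow> (\<phi> x)^2 * ((\<phi> x)^2 + 0) powr (p / 2 - 1)"
          unfolding G_def by (intro tendsto_intros trunc_tendsto dtrunc_tendsto e0) (use x in auto)
        moreover have "(\<phi> x)^2 * ((\<phi> x)^2 + 0) powr (p / 2 - 1) = \<phi> x powr p"
          using x powr_powr[of "\<phi> x" 2 "p / 2 - 1"] powr_add[of "\<phi> x" 2 "p - 2"] by (simp add: powr_numeral right_diff_distrib)
        ultimately show ?thesis by simp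
      qed (simp add: G_def trunc_def)
    qed
    show "AE x in lborel. \<bar>G' m (trunc m (\<phi> x)) * dtrunc m (\<phi> x) * D x + 0 * D x\<bar> \<le> (p + 2) * (2 powr p * (1 + \<phi> x powr p) + \<bar>D x\<bar> powr p)" for m
    proof (rule AE_I2)
      fix x
      let ?s = "trunc m (\<phi> x)"
      have "\<bar>G' m ?s * dtrunc m (\<phi> x) * D x\<bar> \<le> (p + 2) * (?s^2 + 1) powr ((p - 1) / 2) * 1 * \<bar>D x\<bar>"
        unfolding abs_mult using dtrunc_bounds[of m "\<phi> x"] G'_bd[of m ?s] p by (intro mult_mono) auto
      also have "\<dots> \<le> (p + 2) * ((\<phi> x)^2 + 1) powr ((p - 1) / 2) * 1 * \<bar>D x\<bar>"
        using p trunc_le[OF phi, of m x] by (intro mult_right_mono mult_left_mono powr_mono2 add_right_mono power_mono) auto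
      also have "\<dots> = (p + 2) * (((\<phi> x)^2 + 1) powr ((p - 1) / 2) * \<bar>D x\<bar>)" by simp
      also have "\<dots> \<le> (p + 2) * (2 powr p * (1 + \<phi> x powr p) + \<bar>D x\<bar> powr p)"
        using p by (intro mult_left_mono le2 phi) auto
      finally show "\<bar>G' m ?s * dtrunc m (\<phi> x) * D x + 0 * D x\<bar> \<le> (p + 2) * (2 powr p * (1 + \<phi> x powr p) + \<bar>D x\<bar> powr p)" by simp
    qed
    show "AE x in lborel. (\<lambda>m. G' m (trunc m (\<phi> x)) * dtrunc m (\<phi> x) * D x + 0 * D x) \<longlonglongrightarrow> b x"
    proof (rule AE_I2)
      fix x
      show "(\<lambda>m. G' m (trunc m (\<phi> x)) * dtrunc m (\<phi> x) * D x + 0 * D x) \<longlonglongrightarrow> b x"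
      proof (cases "\<phi> x = 0")
        case False
        then have x: "\<phi> x > 0" using phi[of x] by simp
        have "(\<lambda>m. G' m (trunc m (\<phi> x)) * dtrunc m (\<phi> x) * D x + 0 * D x) \<longlonglongrightarrow>
          (\<phi> x * ((\<phi> x)^2 + 0) powr (p / 2 - 1) * (2 + (p - 2) * ((\<phi> x)^2 / ((\<phi> x)^2 + 0)))) * 1 * D x + 0 * D x"
          unfolding G'_def by (intro tendsto_intros trunc_tendsto dtrunc_tendsto e0) (use x in auto)
        moreover have "\<phi> x * ((\<phi> x)^2 + 0) powr (p / 2 - 1) = \<phi> x powr (p - 1)"
          using x powr_powr[of "\<phi> x" 2 "p / 2 - 1"] powr_add[of "\<phi> x" 1 "p - 2"] by (simp add: powr_numeral right_diff_distrib)
        ultimately show ?thesis using x by (simp add: b mult_ac)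
      qed (simp add: G'_def trunc_def b)
    qed
  qed measurable
qed

section \<open>Approximation by test functions\<close>

lemma cutoff_mult_finite:
  fixes u k :: "'a::euclidean_space \<Rightarrow> real"
  assumes p: "p \<ge> 1" and u[measurable]: "u \<in> borel_measurable borel" and l: "loc_int (\<lambda>x. \<bar>u x\<bar> powr p)"
    and k[measurable]: "k \<in> borel_measurable borel" and kb: "\<And>x. \<bar>k x\<bar> \<le> C * indicator (cball 0 R) x"
  shows "integrable lborel (\<lambda>x. k x * u x)" "pow_int p lborel (\<lambda>x. k x * u x) < \<infinity>"
proof -
  show "integrable lborel (\<lambda>x. k x * u x)"
    using loc_int_mult_support[OF loc_int_powr[OF p u l] k kb] by (simp add: mult.commute)
  have int: "integrable lborel (\<lambda>x. indicator (cball 0 R) x * \<bar>u x\<bar> powr p)" using l by (simp add: loc_int_def)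
  have "pow_int p lborel (\<lambda>x. k x * u x) \<le> (\<integral>\<^sup>+x. ennreal (\<bar>C\<bar> powr p) * ennreal (norm (indicator (cball 0 R) x * \<bar>u x\<bar> powr p)) \<partial>lborel)"
    unfolding pow_int_def
  proof (rule nn_integral_mono)
    fix x :: 'a
    show "ennreal (\<bar>k x * u x\<bar> powr p) \<le> ennreal (\<bar>C\<bar> powr p) * ennreal (norm (indicator (cball 0 R) x * \<bar>u x\<bar> powr p))"
    proof (cases "x \<in> cball 0 R")
      case True
      then have "\<bar>k x\<bar> \<le> \<bar>C\<bar>" using kb[of x] by simp
      then have "\<bar>k x * u x\<bar> powr p \<le> (\<bar>C\<bar> * \<bar>u x\<bar>) powr p"
        unfolding abs_mult using p by (intro powr_mono2 mult_right_mono) auto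
      then show ?thesis using True by (simp add: powr_mult ennreal_mult[symmetric] ennreal_leI)
    qed (use kb[of x] in auto)
  qed
  also have "\<dots> = ennreal (\<bar>C\<bar> powr p) * (\<integral>\<^sup>+x. ennreal (norm (indicator (cball 0 R) x * \<bar>u x\<bar> powr p)) \<partial>lborel)"
    by (rule nn_integral_cmult) measurable
  also have "\<dots> < \<infinity>" using int unfolding integrable_iff_bounded by (simp add: ennreal_mult_less_top)
  finally show "pow_int p lborel (\<lambda>x. k x * u x) < \<infinity>" .
qed

lemma pow_int_loc_int:
  fixes u :: "'a::euclidean_space \<Rightarrow> real"
  assumes [measurable]: "u \<in> borel_measurable borel" and "pow_int p lborel u < \<infinity>"
  shows "loc_int (\<lambda>x. \<bar>u x\<bar> powr p)"
  by (rule loc_int_integrable) (use assms in \<open>auto simp: integrable_iff_bounded pow_int_def\<close>)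

text \<open>Convergence of \<open>f\<close> truncated and cut off, and of the partial derivative that results if \<open>g\<close> is the
  one of \<open>f\<close>.\<close>

lemma truncation_converges:
  fixes \<phi> f :: "real ^ 'n::finite \<Rightarrow> real"
  assumes p: "p \<ge> 1" and [measurable]: "\<phi> \<in> borel_measurable borel" "f \<in> borel_measurable borel" "g \<in> borel_measurable borel"
    and h: "\<And>m x. h m x = (if \<phi> x = 0 then 0 else trunc m (f x))"
    and fin: "pow_int p lborel (\<lambda>x. f x * \<phi> x) < \<infinity>" "pow_int p lborel (\<lambda>x. g x * \<phi> x) < \<infinity>"
  shows "(\<lambda>m. pow_int p lborel (\<lambda>x. cutoff (real m) x * h m x * \<phi> x - f x * \<phi> x)) \<longlonglongrightarrow> 0"
    and "(\<lambda>m. pow_int p lborel (\<lambda>x. (cutoff (real m) x * (dtrunc m (f x) * g x) + partial i (cutoff (real m)) x * h m x) * \<phi> x - g x * \<phi> x)) \<longlonglongrightarrow> 0"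
proof -
  let ?g = "\<lambda>m x. (cutoff (real m) x * (dtrunc m (f x) * g x) + partial i (cutoff (real m)) x * h m x) * \<phi> x"
  let ?f = "\<lambda>m x. cutoff (real m) x * h m x * \<phi> x"
  note [measurable] = C0_infty_borel[OF C0_infty_cutoff] C0_infty_borel[OF C0_infty_partial[OF C0_infty_cutoff]]
    borel_measurable_continuous_onI[OF trunc_continuous] borel_measurable_continuous_onI[OF dtrunc_continuous]
  obtain C where C: "C > 0" "\<And>R x. \<bar>partial i (cutoff R) (x :: real ^ 'n)\<bar> \<le> C" using partial_cutoff_bounded[of i] by metis
  have ev: "eventually (\<lambda>m. cutoff (real m) x = 1 \<and> partial i (cutoff (real m)) x = 0) sequentially" for x :: "real ^ 'n"
  proof -
    obtain N :: nat where N: "norm x + 1 \<le> real N" using real_arch_simple by blast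
    show ?thesis using eventually_ge_at_top[of N]
    proof eventually_elim
      case (elim m)
      then have "real N \<le> real m" by simp
      with N have "norm x < real m" by linarith
      then show ?case by (simp add: cutoff_eq_1 partial_cutoff_eq_0)
    qed
  qed
  have [measurable]: "h m \<in> borel_measurable borel" for m unfolding h[abs_def] by measurable
  have h_le: "\<bar>h m x\<bar> \<le> \<bar>f x\<bar>" for m x using abs_trunc_le[of m "f x"] by (simp add: h)
  have cb: "\<bar>cutoff R x\<bar> \<le> 1" for R and x :: "real ^ 'n" using cutoff_bounds[of R x] by simp
  show "(\<lambda>m. pow_int p lborel (\<lambda>x. ?f m x - f x * \<phi> x)) \<longlonglongrightarrow> 0"
  proof (rule pow_int_dominated[OF p, where G="\<lambda>x. \<bar>f x * \<phi> x\<bar>"])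
    show "pow_int p lborel (\<lambda>x. \<bar>f x * \<phi> x\<bar>) < \<infinity>" using fin(1) by (simp add: pow_int_def)
    have "\<bar>?f m x\<bar> \<le> 1 * \<bar>f x\<bar> * \<bar>\<phi> x\<bar>" for m x
      unfolding abs_mult using cb h_le by (intro mult_right_mono mult_mono) auto
    then show "AE x in lborel. \<bar>?f m x\<bar> \<le> \<bar>f x * \<phi> x\<bar>" for m
      by (intro AE_I2) (simp add: abs_mult)
    show "AE x in lborel. (\<lambda>m. ?f m x) \<longlonglongrightarrow> f x * \<phi> x"
    proof (rule AE_I2)
      fix x
      have "(\<lambda>m. trunc m (f x) * \<phi> x) \<longlonglongrightarrow> f x * \<phi> x" by (intro tendsto_intros trunc_tendsto)
      then show "(\<lambda>m. ?f m x) \<longlonglongrightarrow> f x * \<phi> x"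
        by (rule Lim_transform_eventually, intro eventually_mono[OF ev[of x]]) (auto simp: h)
    qed
  qed measurable
  show "(\<lambda>m. pow_int p lborel (\<lambda>x. ?g m x - g x * \<phi> x)) \<longlonglongrightarrow> 0"
  proof (rule pow_int_dominated[OF p, where G="\<lambda>x. \<bar>g x * \<phi> x\<bar> + C * \<bar>f x * \<phi> x\<bar>"])
    show "pow_int p lborel (\<lambda>x. \<bar>g x * \<phi> x\<bar> + C * \<bar>f x * \<phi> x\<bar>) < \<infinity>"
    proof (rule pow_int_add_finite[OF p])
      show "pow_int p lborel (\<lambda>x. \<bar>g x * \<phi> x\<bar>) < \<infinity>" using fin(2) by (simp add: pow_int_def)
      show "pow_int p lborel (\<lambda>x. C * \<bar>f x * \<phi> x\<bar>) < \<infinity>"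
        by (rule pow_int_bounded_mult[OF p _ fin(1), where C=C]) (use C in \<open>auto simp: abs_mult\<close>)
    qed measurable
    show "AE x in lborel. \<bar>?g m x\<bar>
       \<le> \<bar>g x * \<phi> x\<bar> + C * \<bar>f x * \<phi> x\<bar>" for m
    proof (rule AE_I2)
      fix x
      have d: "\<bar>dtrunc m (f x)\<bar> \<le> 1" using dtrunc_bounds[of m "f x"] by simp
      have "\<bar>cutoff (real m) x * (dtrunc m (f x) * g x)\<bar> \<le> 1 * (1 * \<bar>g x\<bar>)"
        unfolding abs_mult using cb d by (intro mult_mono) auto
      moreover have "\<bar>partial i (cutoff (real m)) x * h m x\<bar> \<le> C * \<bar>f x\<bar>"
        unfolding abs_mult using C h_le by (intro mult_mono) auto
      ultimately have "\<bar>cutoff (real m) x * (dtrunc m (f x) * g x) + partial i (cutoff (real m)) x * h m x\<bar> \<le> \<bar>g x\<bar> + C * \<bar>f x\<bar>"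
        by linarith
      then have "\<bar>?g m x\<bar> \<le> (\<bar>g x\<bar> + C * \<bar>f x\<bar>) * \<bar>\<phi> x\<bar>"
        unfolding abs_mult[of _ "\<phi> x"] by (rule mult_right_mono) simp
      then show "\<bar>?g m x\<bar>
       \<le> \<bar>g x * \<phi> x\<bar> + C * \<bar>f x * \<phi> x\<bar>" by (simp add: abs_mult algebra_simps)
    qed
    show "AE x in lborel. (\<lambda>m. ?g m x)
       \<longlonglongrightarrow> g x * \<phi> x"
    proof (rule AE_I2)
      fix x
      have "(\<lambda>m. dtrunc m (f x) * g x * \<phi> x) \<longlonglongrightarrow> 1 * g x * \<phi> x" by (intro tendsto_intros dtrunc_tendsto)
      then have "(\<lambda>m. dtrunc m (f x) * g x * \<phi> x) \<longlonglongrightarrow> g x * \<phi> x" by simp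
      then show "(\<lambda>m. ?g m x)
       \<longlonglongrightarrow> g x * \<phi> x"
        by (rule Lim_transform_eventually, intro eventually_mono[OF ev[of x]]) (auto simp: h)
    qed
  qed measurable
qed

text \<open>Density of test functions in terms of Borel functions: \<open>\<phi>\<^sup>p\<close> is the weight, \<open>b i\<close> its derivative, and \<open>g i\<close>
  the components of the gradient of \<open>f\<close>.\<close>

lemma weighted_approx:
  fixes \<phi> f :: "real ^ 'n::finite \<Rightarrow> real" and D g b :: "'n \<Rightarrow> real ^ 'n \<Rightarrow> real"
  assumes p: "p \<ge> 1" and phi: "\<And>x. \<phi> x \<ge> 0" and w\<phi>: "\<And>i. wder i \<phi> (D i)"
    and l: "loc_int (\<lambda>x. \<phi> x powr p)" "\<And>i. loc_int (\<lambda>x. \<bar>D i x\<bar> powr p)"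
    and b: "\<And>i x. b i x = (if \<phi> x = 0 then 0 else p * \<phi> x powr (p - 1) * D i x)"
    and f[measurable]: "f \<in> borel_measurable borel" and g[measurable]: "\<And>i. g i \<in> borel_measurable borel"
    and wf: "\<And>i. wder i (\<lambda>x. f x * \<phi> x powr p) (\<lambda>x. g i x * \<phi> x powr p + f x * b i x)"
    and fin: "pow_int p lborel (\<lambda>x. f x * \<phi> x) < \<infinity>" "\<And>i. pow_int p lborel (\<lambda>x. g i x * \<phi> x) < \<infinity>"
    and e: "e > 0"
  shows "\<exists>U\<in>C0_infty. pow_int p lborel (\<lambda>x. (U x - f x) * \<phi> x) \<le> ennreal e \<and>
    (\<forall>i. pow_int p lborel (\<lambda>x. (partial i U x - g i x) * \<phi> x) \<le> ennreal e)"
proof -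
  note [measurable] = wder_measurable[OF w\<phi>]
  define e' where "e' = e / (2 powr p * 2)"
  have e': "e' > 0" using e by (simp add: e'_def)
  have ee: "ennreal (2 powr p) * (ennreal e' + ennreal e') = ennreal e"
    using e' by (simp add: ennreal_plus[symmetric] ennreal_mult[symmetric] e'_def del: ennreal_plus)
  let ?h = "\<lambda>m x. if \<phi> x = 0 then 0 else trunc m (f x)"
  let ?F = "\<lambda>m x. cutoff (real m) x * ?h m x * \<phi> x - f x * \<phi> x"
  let ?G = "\<lambda>i m x. (cutoff (real m) x * (dtrunc m (f x) * g i x) + partial i (cutoff (real m)) x * ?h m x) * \<phi> x - g i x * \<phi> x"
  note conv = truncation_converges[OF p wder_measurable(1)[OF w\<phi>] f g, of ?h, OF refl fin]
  have "eventually (\<lambda>m. pow_int p lborel (?F m) < ennreal e' \<and> (\<forall>i. pow_int p lborel (?G i m) < ennreal e')) sequentially"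
    by (rule eventually_conj[OF tendsto_0_ennrealD[OF conv(1) e'] eventually_all_finite[OF tendsto_0_ennrealD[OF conv(2) e']]])
  then obtain m where m: "pow_int p lborel (?F m) < ennreal e'" "\<And>i. pow_int p lborel (?G i m) < ennreal e'"
    by (auto simp: eventually_sequentially)
  define A where "A = real (Suc m) * 2"
  define h where "h x = (if \<phi> x = 0 then 0 else trunc m (f x))" for x
  define z where "z = (cutoff (real m) :: real ^ 'n \<Rightarrow> real)"
  \<comment> \<open>The second cut-off function equals \<open>1\<close> near the support of all the mollified functions.\<close>
  define y where "y = (cutoff (real m + 4) :: real ^ 'n \<Rightarrow> real)"
  have zC: "z \<in> C0_infty" and yC: "y \<in> C0_infty" unfolding z_def y_def by (rule C0_infty_cutoff)+
  note [measurable] = C0_infty_borel[OF zC] C0_infty_borel[OF yC] C0_infty_borel[OF C0_infty_partial[OF zC]] C0_infty_borel[OF C0_infty_partial[OF yC]]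
    borel_measurable_continuous_onI[OF trunc_continuous] borel_measurable_continuous_onI[OF dtrunc_continuous]
  have [measurable]: "h \<in> borel_measurable borel" unfolding h_def[abs_def] by measurable
  have hA: "\<bar>h x\<bar> \<le> A" for x unfolding h_def A_def using trunc_bounded[of m] by (auto simp del: of_nat_Suc)
  have z0: "z x = 0" if "norm x > real m + 2" for x unfolding z_def using that by (rule cutoff_support)
  have dz0: "partial i z x = 0" if "norm x > real m + 2" for i x
    by (rule partial_eq_0_if_const[of "- cball 0 (real m + 2)" _ _ 0]) (use that z0 in auto)
  have y1: "y x = 1" "partial i y x = 0" if "norm x < real m + 4" for x i
    unfolding y_def using that by (auto intro: cutoff_eq_1 partial_cutoff_eq_0)
  have zb: "\<bar>z x\<bar> \<le> 1" for x unfolding z_def using cutoff_bounds[of "real m" x] by simp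
  define H where "H x = z x * h x" for x
  define P where "P x = y x * \<phi> x" for x
  define DP where "DP j x = y x * D j x + partial j y x * \<phi> x" for j x
  define G where "G i x = z x * (dtrunc m (f x) * (g i x * \<phi> x) + h x * D i x) + partial i z x * (h x * \<phi> x)" for i x
  have lphi: "loc_int (\<lambda>x. \<bar>\<phi> x\<bar> powr p)" using l(1) phi by (simp add: abs_of_nonneg)
  have cut: "integrable lborel (\<lambda>x. k x * u x)" "pow_int p lborel (\<lambda>x. k x * u x) < \<infinity>"
    if kC: "k \<in> C0_infty" and u: "u \<in> borel_measurable borel" "loc_int (\<lambda>x. \<bar>u x\<bar> powr p)" for k u :: "real ^ 'n \<Rightarrow> real"
  proof -
    obtain B R where B: "\<And>x. \<bar>k x\<bar> \<le> B * indicator (cball 0 R) x" using C0_infty_bound_indicator[OF kC] by metis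
    show "integrable lborel (\<lambda>x. k x * u x)" "pow_int p lborel (\<lambda>x. k x * u x) < \<infinity>"
      by (rule cutoff_mult_finite[OF p u C0_infty_borel[OF kC] B])+
  qed
  have wP: "wder j P (DP j)" for j unfolding P_def[abs_def] DP_def[abs_def] by (rule wder_mult_C0[OF w\<phi> yC])
  have P: "integrable lborel P" "pow_int p lborel P < \<infinity>"
    unfolding P_def[abs_def] by (intro cut yC lphi; measurable)+
  have DP: "integrable lborel (DP j)" "pow_int p lborel (DP j) < \<infinity>" for j
    unfolding DP_def[abs_def]
    by (intro Bochner_Integration.integrable_add pow_int_add_finite p cut yC C0_infty_partial lphi l; measurable)+
  have H: "integrable lborel H" "\<bar>H x\<bar> \<le> A" for x
  proof -
    have "integrable lborel (\<lambda>x. z x * h x)"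
      by (rule integrable_mult_bounded[OF C0_infty_integrable[OF zC] _ hA]) measurable
    then show "integrable lborel H" by (simp add: H_def[abs_def])
    have "\<bar>z x * h x\<bar> \<le> 1 * A" unfolding abs_mult using zb hA by (intro mult_mono) auto
    then show "\<bar>H x\<bar> \<le> A" by (simp add: H_def)
  qed
  have lg: "loc_int (\<lambda>x. \<bar>g i x * \<phi> x\<bar> powr p)" for i by (rule pow_int_loc_int[OF _ fin(2)]) measurable
  have wh: "wder i (\<lambda>x. h x * \<phi> x) (\<lambda>x. dtrunc m (f x) * (g i x * \<phi> x) + h x * D i x)" for i
    unfolding h_def
  proof (rule truncated_wder[OF p phi w\<phi> f g b wf])
    show "loc_int (\<lambda>x. g i x * \<phi> x)" by (rule loc_int_powr[OF p _ lg]) measurable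
    show "\<bar>trunc m s\<bar> \<le> A" "\<bar>dtrunc m s * s\<bar> \<le> A" for s unfolding A_def by (rule trunc_bounded dtrunc_mult_bounded)+
    show "\<bar>dtrunc m s\<bar> \<le> 1" for s using dtrunc_bounds[of m s] by simp
    show "trunc m 0 = 0" by (simp add: trunc_def)
  qed (rule trunc_deriv dtrunc_continuous)+
  have HP: "H x * P x = z x * (h x * \<phi> x)" for x
    using z0[of x] y1[of x] by (cases "norm x > real m + 2") (auto simp: H_def P_def)
  have wHP: "wder i (\<lambda>x. H x * P x) (G i)" for i
    unfolding HP G_def[abs_def] by (rule wder_mult_C0[OF wh zC])
  have bnd: "loc_int (\<lambda>x. \<bar>k x * u x\<bar> powr p)" if lu: "loc_int (\<lambda>x. \<bar>u x\<bar> powr p)" "k \<in> borel_measurable borel" "u \<in> borel_measurable borel" "\<And>x. \<bar>k x\<bar> \<le> B"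
    for k u :: "real ^ 'n \<Rightarrow> real" and B
  proof (rule loc_int_bound[OF loc_int_cmult[OF lu(1), of "B powr p"]])
    note [measurable] = lu(2,3)
    show "(\<lambda>x. \<bar>k x * u x\<bar> powr p) \<in> borel_measurable borel" by measurable
    show "AE x in lborel. \<bar>\<bar>k x * u x\<bar> powr p\<bar> \<le> \<bar>B powr p * \<bar>u x\<bar> powr p\<bar>"
      using lu(4) p by (intro AE_I2) (auto simp: abs_mult powr_mult intro!: mult_right_mono powr_mono2)
  qed
  have dt: "\<bar>dtrunc m s\<bar> \<le> 1" for s using dtrunc_bounds[of m s] by simp
  have G: "integrable lborel (G i)" "pow_int p lborel (G i) < \<infinity>" for i
    unfolding G_def[abs_def] distrib_left
    by (intro Bochner_Integration.integrable_add pow_int_add_finite p cut zC C0_infty_partial bnd[OF lg _ _ dt] bnd[OF l(2) _ _ hA] bnd[OF lphi _ _ hA]; measurable)+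
  have GD: "G i x - H x * DP i x = (z x * (dtrunc m (f x) * g i x) + partial i z x * h x) * \<phi> x" for i x
  proof (cases "norm x > real m + 2")
    case True
    then show ?thesis by (simp add: G_def H_def z0 dz0)
  next
    case False
    then have "y x = 1" "partial i y x = 0" by (auto intro: y1)
    then show ?thesis by (simp add: G_def H_def DP_def algebra_simps)
  qed
  obtain s :: "nat \<Rightarrow> nat" where s: "strict_mono s"
    "(\<lambda>n. pow_int p lborel (\<lambda>x. P x * conv H (dil (s n) rho) x - H x * P x)) \<longlonglongrightarrow> 0"
    "\<And>i. (\<lambda>n. pow_int p lborel (\<lambda>x. P x * partial i (conv H (dil (s n) rho)) x - (G i x - H x * DP i x))) \<longlonglongrightarrow> 0"
    using mollify[OF p P DP wP H G wHP] by blast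
  have "eventually (\<lambda>n. pow_int p lborel (\<lambda>x. P x * conv H (dil (s n) rho) x - H x * P x) < ennreal e' \<and>
     (\<forall>i. pow_int p lborel (\<lambda>x. P x * partial i (conv H (dil (s n) rho)) x - (G i x - H x * DP i x)) < ennreal e')) sequentially"
    by (rule eventually_conj[OF tendsto_0_ennrealD[OF s(2) e'] eventually_all_finite[OF tendsto_0_ennrealD[OF s(3) e']]])
  then obtain n where n: "pow_int p lborel (\<lambda>x. P x * conv H (dil (s n) rho) x - H x * P x) < ennreal e'"
     "\<And>i. pow_int p lborel (\<lambda>x. P x * partial i (conv H (dil (s n) rho)) x - (G i x - H x * DP i x)) < ennreal e'"
    by (auto simp: eventually_sequentially)
  define U where "U = conv H (dil (s n) rho)"
  have H0: "H x = 0" if "norm x > real m + 2" for x using z0[OF that] by (simp add: H_def)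
  have UC: "U \<in> C0_infty" unfolding U_def by (rule C0_infty_conv[OF H(1) H0 C0_infty_dil[OF C0_infty_rho]])
  note [measurable] = C0_infty_borel[OF UC] C0_infty_borel[OF C0_infty_partial[OF UC]]
  have U0: "U x = 0" if "norm x > real m + 3" for x
    unfolding U_def
  proof (rule conv_support[where R="real m + 2" and S=1, OF H0])
    show "dil (s n) rho x = 0" if "norm x > 1" for x :: "real ^ 'n"
    proof (rule ccontr)
      assume "dil (s n) rho x \<noteq> 0"
      then have "norm x \<le> 1 / real (Suc (s n))" by (intro dil_support[of rho]) (auto simp: rho_support)
      also have "\<dots> \<le> 1" by simp
      finally show False using that by simp
    qed
  qed (use that in auto)
  have dU0: "partial i U x = 0" if "norm x > real m + 3" for i x
    by (rule partial_eq_0_if_const[of "- cball 0 (real m + 3)" _ _ 0]) (use that U0 in auto)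
  have PU: "P x * U x = U x * \<phi> x" "P x * partial i U x = partial i U x * \<phi> x" for i x
    using U0[of x] dU0[of x] y1[of x] by (cases "norm x > real m + 3"; simp add: P_def)+
  show ?thesis
  proof (intro bexI[OF _ UC] conjI allI)
    have "pow_int p lborel (\<lambda>x. (U x - f x) * \<phi> x) = pow_int p lborel (\<lambda>x. (U x * \<phi> x - z x * (h x * \<phi> x)) + (z x * h x * \<phi> x - f x * \<phi> x))"
      by (rule arg_cong[where f="pow_int p lborel"]) (auto simp: algebra_simps)
    also have "\<dots> \<le> ennreal (2 powr p) * (pow_int p lborel (\<lambda>x. U x * \<phi> x - z x * (h x * \<phi> x)) + pow_int p lborel (\<lambda>x. z x * h x * \<phi> x - f x * \<phi> x))"
      by (rule pow_int_add[OF p]) measurable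
    also have "\<dots> \<le> ennreal (2 powr p) * (ennreal e' + ennreal e')"
    proof (intro mult_left_mono add_mono)
      show "pow_int p lborel (\<lambda>x. U x * \<phi> x - z x * (h x * \<phi> x)) \<le> ennreal e'"
        using n(1) unfolding U_def[symmetric] HP PU by simp
      show "pow_int p lborel (\<lambda>x. z x * h x * \<phi> x - f x * \<phi> x) \<le> ennreal e'"
        using m(1) unfolding z_def h_def by simp
    qed simp
    finally show "pow_int p lborel (\<lambda>x. (U x - f x) * \<phi> x) \<le> ennreal e" unfolding ee .
    fix i
    let ?G = "\<lambda>x. (z x * (dtrunc m (f x) * g i x) + partial i z x * h x) * \<phi> x"
    have "pow_int p lborel (\<lambda>x. (partial i U x - g i x) * \<phi> x) = pow_int p lborel (\<lambda>x. (partial i U x * \<phi> x - ?G x) + (?G x - g i x * \<phi> x))"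
      by (rule arg_cong[where f="pow_int p lborel"]) (auto simp: algebra_simps)
    also have "\<dots> \<le> ennreal (2 powr p) * (pow_int p lborel (\<lambda>x. partial i U x * \<phi> x - ?G x) + pow_int p lborel (\<lambda>x. ?G x - g i x * \<phi> x))"
      by (rule pow_int_add[OF p]) measurable
    also have "\<dots> \<le> ennreal (2 powr p) * (ennreal e' + ennreal e')"
    proof (intro mult_left_mono add_mono)
      show "pow_int p lborel (\<lambda>x. partial i U x * \<phi> x - ?G x) \<le> ennreal e'"
        using n(2)[of i] unfolding U_def[symmetric] GD PU by simp
      show "pow_int p lborel (\<lambda>x. ?G x - g i x * \<phi> x) \<le> ennreal e'"
        using m(2)[of i] unfolding z_def h_def by simp
    qed simp
    finally show "pow_int p lborel (\<lambda>x. (partial i U x - g i x) * \<phi> x) \<le> ennreal e" unfolding ee .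
  qed
qed

section \<open>Completeness\<close>

text \<open>Completeness of \<open>L\<^sup>p\<close>: a subsequence with summable increments converges almost everywhere.\<close>

lemma pow_int_complete:
  fixes h :: "nat \<Rightarrow> 'a \<Rightarrow> real"
  assumes p: "p \<ge> 1" and [measurable]: "\<And>n. h n \<in> borel_measurable M"
    and Cauchy: "\<And>e. e > 0 \<Longrightarrow> \<exists>N. \<forall>m\<ge>N. \<forall>n\<ge>N. pow_int p M (\<lambda>x. h m x - h n x) \<le> ennreal e"
  shows "\<exists>H\<in>borel_measurable M. (\<lambda>n. pow_int p M (\<lambda>x. h n x - H x)) \<longlonglongrightarrow> 0"
proof -
  define a where "a k = (1/2) ^ k * ((1/2) ^ k) powr p" for k :: nat
  have a: "a k > 0" for k by (simp add: a_def)
  have "\<forall>k. \<exists>N. \<forall>m\<ge>N. \<forall>n\<ge>N. pow_int p M (\<lambda>x. h m x - h n x) \<le> ennreal (a k)"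
    using Cauchy a by blast
  then obtain N where N: "\<And>k m n. m \<ge> N k \<Longrightarrow> n \<ge> N k \<Longrightarrow> pow_int p M (\<lambda>x. h m x - h n x) \<le> ennreal (a k)" by metis
  define r where "r k = (\<Sum>j\<le>k. N j) + k" for k
  have rN: "r k \<ge> N k" "r (Suc k) \<ge> N k" "r k \<ge> k" for k
    using member_le_sum[of k "{..k}" N] by (auto simp: r_def)
  define d where "d k x = h (r k) x - h (r (Suc k)) x" for k x
  have [measurable]: "d k \<in> borel_measurable M" for k unfolding d_def[abs_def] by measurable
  have d_le: "pow_int p M (d k) \<le> ennreal (a k)" for k
    unfolding d_def[abs_def] by (rule N) (use rN in auto)
  define q where "q k x = ennreal ((2 ^ k) powr p) * ennreal (\<bar>d k x\<bar> powr p)" for k x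
  have "(\<integral>\<^sup>+x. (\<Sum>k. q k x) \<partial>M) = (\<Sum>k. \<integral>\<^sup>+x. q k x \<partial>M)"
    unfolding q_def by (rule nn_integral_suminf) measurable
  also have "\<dots> \<le> (\<Sum>k. ennreal ((1/2) ^ k))"
  proof (rule suminf_le)
    show "(\<integral>\<^sup>+x. q k x \<partial>M) \<le> ennreal ((1/2) ^ k)" for k
    proof -
      have "(\<integral>\<^sup>+x. q k x \<partial>M) = ennreal ((2 ^ k) powr p) * pow_int p M (d k)"
        unfolding q_def pow_int_def by (rule nn_integral_cmult) measurable
      also have "\<dots> \<le> ennreal ((2 ^ k) powr p) * ennreal (a k)" by (intro mult_left_mono d_le) auto
      also have "\<dots> = ennreal ((1/2) ^ k * ((2 ^ k) powr p * ((1/2) ^ k) powr p))"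
        by (simp add: a_def ennreal_mult[symmetric] mult_ac)
      also have "(2 ^ k) powr p * ((1/2) ^ k) powr p = 1"
        by (simp add: powr_mult[symmetric] power_mult_distrib[symmetric])
      finally show ?thesis by simp
    qed
  qed auto
  also have "(\<Sum>k. ennreal ((1/2) ^ k)) = ennreal (\<Sum>k. (1/2) ^ k)"
    by (rule suminf_ennreal2[OF _ summable_geometric]) simp_all
  also have "\<dots> < \<infinity>" by simp
  finally have "AE x in M. (\<Sum>k. q k x) \<noteq> \<infinity>"
    by (intro nn_integral_PInf_AE) (auto simp: q_def)
  then have conv: "AE x in M. convergent (\<lambda>k. h (r k) x)"
  proof eventually_elim
    fix x assume fin: "(\<Sum>k. q k x) \<noteq> \<infinity>"
    have eq: "q k x = ennreal ((2 ^ k * \<bar>d k x\<bar>) powr p)" for k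
      by (simp add: q_def ennreal_mult[symmetric] powr_mult)
    have "summable (\<lambda>k. (2 ^ k * \<bar>d k x\<bar>) powr p)"
      by (rule summable_suminf_not_top) (use fin in \<open>auto simp: eq\<close>)
    then have "(\<lambda>k. (2 ^ k * \<bar>d k x\<bar>) powr p) \<longlonglongrightarrow> 0" by (rule summable_LIMSEQ_zero)
    then have "eventually (\<lambda>k. (2 ^ k * \<bar>d k x\<bar>) powr p < 1) sequentially" by (rule order_tendstoD) simp
    then have "eventually (\<lambda>k. norm (d k x) \<le> (1/2) ^ k) sequentially"
    proof eventually_elim
      fix k assume 1: "(2 ^ k * \<bar>d k x\<bar>) powr p < 1"
      have "2 ^ k * \<bar>d k x\<bar> \<le> 1"
      proof (rule ccontr)
        assume "\<not> ?thesis"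
        then have "(2 ^ k * \<bar>d k x\<bar>) powr p \<ge> 1" using p by (intro ge_one_powr_ge_zero) auto
        then show False using 1 by simp
      qed
      then show "norm (d k x) \<le> (1/2) ^ k" by (simp add: field_simps power_one_over)
    qed
    then have "summable (\<lambda>k. d k x)"
      by (rule summable_comparison_test_ev) (rule summable_geometric, simp)
    then have "convergent (\<lambda>n. \<Sum>k<n. d k x)" by (simp add: summable_iff_convergent)
    moreover have "(\<Sum>k<n. d k x) = h (r 0) x - h (r n) x" for n
      unfolding d_def by (induction n) auto
    ultimately have "convergent (\<lambda>n. h (r 0) x - h (r n) x)" by simp
    from convergent_diff[OF convergent_const[of "h (r 0) x"] this]
    show "convergent (\<lambda>k. h (r k) x)" by simp
  qed
  define H where "H x = lim (\<lambda>k. h (r k) x)" for x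
  have [measurable]: "H \<in> borel_measurable M" unfolding H_def[abs_def] by measurable
  have lim: "AE x in M. (\<lambda>k. h (r k) x) \<longlonglongrightarrow> H x"
    using conv by eventually_elim (simp add: H_def convergent_LIMSEQ_iff)
  have "(\<lambda>n. pow_int p M (\<lambda>x. h n x - H x)) \<longlonglongrightarrow> 0"
  proof (rule tendsto_0_ennrealI)
    fix e :: real assume "e > 0"
    then obtain K where K: "\<And>m n. m \<ge> K \<Longrightarrow> n \<ge> K \<Longrightarrow> pow_int p M (\<lambda>x. h m x - h n x) \<le> ennreal e" using Cauchy by blast
    show "eventually (\<lambda>n. pow_int p M (\<lambda>x. h n x - H x) \<le> ennreal e) sequentially"
      using eventually_ge_at_top[of K]
    proof eventually_elim
      case (elim n)
      show ?case
      proof (rule pow_int_Fatou[OF p])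
        show "AE x in M. (\<lambda>k. h n x - h (r (k + K)) x) \<longlonglongrightarrow> h n x - H x"
          using lim by eventually_elim (intro tendsto_intros LIMSEQ_ignore_initial_segment)
        show "pow_int p M (\<lambda>x. h n x - h (r (k + K)) x) \<le> ennreal e" for k
          using elim rN(3)[of "k + K"] by (intro K) auto
      qed measurable
    qed
  qed
  then show ?thesis by (intro bexI[of _ H]) auto
qed

section \<open>Duality pairings\<close>

text \<open>The functions \<open>c\<close> for which \<open>f \<mapsto> \<integral> f c dM\<close> is continuous on \<open>L\<^sup>p\<close>, described by Young's
  inequality instead of membership in \<open>L\<^sup>q\<close>: in this form \<open>p = 1\<close>, \<open>q = \<infinity>\<close> is no special case.\<close>

definition dual :: "real \<Rightarrow> 'a measure \<Rightarrow> ('a \<Rightarrow> real) \<Rightarrow> bool" where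
  "dual p M c \<longleftrightarrow> c \<in> borel_measurable M \<and> (\<exists>k. integrable M k \<and> (\<forall>x. 0 \<le> k x) \<and>
     (\<forall>\<delta>>0. \<exists>C\<ge>0. AE x in M. \<forall>a\<ge>0. a * \<bar>c x\<bar> \<le> C * a powr p + \<delta> * k x))"

lemma dual_1: "c \<in> borel_measurable M \<Longrightarrow> AE x in M. \<bar>c x\<bar> \<le> B \<Longrightarrow> dual 1 M c"
  unfolding dual_def
proof (intro conjI exI[of _ "\<lambda>x. 0"] allI impI)
  assume B: "AE x in M. \<bar>c x\<bar> \<le> B"
  show "\<exists>C\<ge>0. AE x in M. \<forall>a\<ge>0. a * \<bar>c x\<bar> \<le> C * a powr 1 + \<delta> * 0" for \<delta>
  proof (intro exI[of _ "\<bar>B\<bar>"] conjI)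
    show "AE x in M. \<forall>a\<ge>0. a * \<bar>c x\<bar> \<le> \<bar>B\<bar> * a powr 1 + \<delta> * 0"
      using B
    proof (eventually_elim, intro allI impI)
      fix x and a :: real assume "\<bar>c x\<bar> \<le> B" "a \<ge> 0"
      then have "a * \<bar>c x\<bar> \<le> a * \<bar>B\<bar>" by (intro mult_left_mono) auto
      then show "a * \<bar>c x\<bar> \<le> \<bar>B\<bar> * a powr 1 + \<delta> * 0" using \<open>a \<ge> 0\<close> by (simp add: mult.commute)
    qed
  qed simp
qed auto

lemma dual_gt_1:
  assumes p: "p > 1" and c: "c \<in> borel_measurable M" "integrable M (\<lambda>x. \<bar>c x\<bar> powr (p / (p - 1)))"
  shows "dual p M c"
  unfolding dual_def
proof (intro conjI exI[of _ "\<lambda>x. \<bar>c x\<bar> powr (p / (p - 1))"] allI impI)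
  define q where "q = p / (p - 1)"
  have q: "q > 1" "1 / p + 1 / q = 1" using p by (auto simp: q_def field_simps)
  fix \<delta> :: real assume d: "\<delta> > 0"
  define t where "t = \<delta> powr (1 / q)"
  have t: "t > 0" "t powr q = \<delta>" using d q by (auto simp: t_def powr_powr)
  have "a * y \<le> (1 / t) powr p * a powr p + \<delta> * y powr q" if "a \<ge> 0" "y \<ge> 0" for a y :: real
  proof -
    have "(a / t) * (t * y) \<le> (a / t) powr p / p + (t * y) powr q / q"
      by (rule Youngs_inequality) (use p q that t in auto)
    also have "\<dots> \<le> (a / t) powr p + (t * y) powr q"
    proof (rule add_mono)
      have "x / r \<le> x" if "0 \<le> x" "1 < r" for x r :: real
        using that by (simp add: divide_le_eq mult_le_cancel_left1)
      then show "(a / t) powr p / p \<le> (a / t) powr p" "(t * y) powr q / q \<le> (t * y) powr q" using p q by auto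
    qed
    also have "(a / t) powr p = (1 / t) powr p * a powr p"
      using powr_mult[of "1 / t" a p] by simp
    also have "(t * y) powr q = \<delta> * y powr q" by (simp add: powr_mult t)
    finally show ?thesis using t by simp
  qed
  then show "\<exists>C\<ge>0. AE x in M. \<forall>a\<ge>0. a * \<bar>c x\<bar> \<le> C * a powr p + \<delta> * \<bar>c x\<bar> powr (p / (p - 1))"
    unfolding q_def[symmetric] by (intro exI[of _ "(1 / t) powr p"]) auto
qed (use c in auto)

lemma dual_integrable:
  assumes c: "dual p M c" and f[measurable]: "f \<in> borel_measurable M" and fin: "pow_int p M f < \<infinity>"
  shows "integrable M (\<lambda>x. f x * c x)"
proof -
  have [measurable]: "c \<in> borel_measurable M" using c by (simp add: dual_def)
  obtain k where k: "integrable M k" "\<And>x. 0 \<le> k x" and kC: "\<And>\<delta>. \<delta> > 0 \<Longrightarrow> \<exists>C\<ge>0. AE x in M. \<forall>a\<ge>0. a * \<bar>c x\<bar> \<le> C * a powr p + \<delta> * k x"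
    using c unfolding dual_def by blast
  obtain C where C: "C \<ge> 0" "AE x in M. \<forall>a\<ge>0. a * \<bar>c x\<bar> \<le> C * a powr p + 1 * k x"
    using kC[of 1] by auto
  have int: "integrable M (\<lambda>x. \<bar>f x\<bar> powr p)" using fin by (simp add: integrable_iff_bounded pow_int_def)
  show ?thesis
  proof (rule Bochner_Integration.integrable_bound)
    show "integrable M (\<lambda>x. C * \<bar>f x\<bar> powr p + k x)" using int k by auto
    show "AE x in M. norm (f x * c x) \<le> norm (C * \<bar>f x\<bar> powr p + k x)"
      using C(2)
    proof eventually_elim
      fix x assume "\<forall>a\<ge>0. a * \<bar>c x\<bar> \<le> C * a powr p + 1 * k x"
      from this[rule_format, of "\<bar>f x\<bar>"] show "norm (f x * c x) \<le> norm (C * \<bar>f x\<bar> powr p + k x)"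
        by (simp add: abs_mult)
    qed
  qed measurable
qed

lemma dual_limit:
  assumes c: "dual p M c" and f[measurable]: "\<And>n. f n \<in> borel_measurable M" "F \<in> borel_measurable M"
    and fin: "\<And>n. pow_int p M (f n) < \<infinity>" "pow_int p M F < \<infinity>"
    and lim: "(\<lambda>n. pow_int p M (\<lambda>x. f n x - F x)) \<longlonglongrightarrow> 0"
  shows "(\<lambda>n. \<integral>x. f n x * c x \<partial>M) \<longlonglongrightarrow> (\<integral>x. F x * c x \<partial>M)"
proof (rule LIMSEQ_I)
  fix e :: real assume e: "e > 0"
  have [measurable]: "c \<in> borel_measurable M" using c by (simp add: dual_def)
  obtain k where k: "integrable M k" "\<And>x. 0 \<le> k x" and kC: "\<And>\<delta>. \<delta> > 0 \<Longrightarrow> \<exists>C\<ge>0. AE x in M. \<forall>a\<ge>0. a * \<bar>c x\<bar> \<le> C * a powr p + \<delta> * k x"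
    using c unfolding dual_def by blast
  define I where "I = (\<integral>x. k x \<partial>M) + 1"
  have I: "I > 0" unfolding I_def using k by (intro add_nonneg_pos integral_nonneg_AE) auto
  have "e / (2 * I) > 0" using e I by simp
  then obtain C where C: "C \<ge> 0" "AE x in M. \<forall>a\<ge>0. a * \<bar>c x\<bar> \<le> C * a powr p + e / (2 * I) * k x" using kC by blast
  have "eventually (\<lambda>n. pow_int p M (\<lambda>x. f n x - F x) < ennreal (e / (2 * (C + 1)))) sequentially"
    using e C(1) by (intro tendsto_0_ennrealD[OF lim]) auto
  then obtain N where N: "\<And>n. n \<ge> N \<Longrightarrow> pow_int p M (\<lambda>x. f n x - F x) < ennreal (e / (2 * (C + 1)))"
    by (auto simp: eventually_sequentially)
  show "\<exists>N. \<forall>n\<ge>N. norm ((\<integral>x. f n x * c x \<partial>M) - (\<integral>x. F x * c x \<partial>M)) < e"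
  proof (intro exI[of _ N] allI impI)
    fix n assume n: "n \<ge> N"
    let ?d = "\<lambda>x. \<bar>f n x - F x\<bar> powr p"
    have int: "integrable M ?d" using less_trans[OF N[OF n] ennreal_less_top] by (simp add: integrable_iff_bounded pow_int_def)
    have "ennreal (\<integral>x. ?d x \<partial>M) < ennreal (e / (2 * (C + 1)))"
      using N[OF n] nn_integral_eq_integral[OF int] by (simp add: pow_int_def)
    then have d: "(\<integral>x. ?d x \<partial>M) < e / (2 * (C + 1))" by (rule ennreal_less_iff[THEN iffD1, rotated]) (auto intro: integral_nonneg_AE)
    have i: "integrable M (\<lambda>x. f n x * c x)" "integrable M (\<lambda>x. F x * c x)"
      by (rule dual_integrable[OF c]; use fin in simp)+
    have "(\<integral>x. f n x * c x \<partial>M) - (\<integral>x. F x * c x \<partial>M) = (\<integral>x. f n x * c x - F x * c x \<partial>M)" using i by simp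
    also have "norm \<dots> \<le> (\<integral>x. C * ?d x + e / (2 * I) * k x \<partial>M)"
    proof (rule order.trans[OF integral_norm_bound], rule integral_mono_AE)
      show "AE x in M. norm (f n x * c x - F x * c x) \<le> C * ?d x + e / (2 * I) * k x"
        using C(2)
      proof eventually_elim
        fix x assume "\<forall>a\<ge>0. a * \<bar>c x\<bar> \<le> C * a powr p + e / (2 * I) * k x"
        from this[rule_format, of "\<bar>f n x - F x\<bar>"] show "norm (f n x * c x - F x * c x) \<le> C * ?d x + e / (2 * I) * k x"
          by (simp add: left_diff_distrib[symmetric] abs_mult)
      qed
    qed (use i int k in auto)
    also have "\<dots> = C * (\<integral>x. ?d x \<partial>M) + e / (2 * I) * (I - 1)"
      unfolding I_def using int k by simp
    also have "\<dots> \<le> (C + 1) * (\<integral>x. ?d x \<partial>M) + e / (2 * I) * I"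
      using e I by (intro add_mono mult_right_mono mult_left_mono integral_nonneg_AE) auto
    also have "\<dots> < (C + 1) * (e / (2 * (C + 1))) + e / (2 * I) * I"
      using d C(1) by (intro add_strict_right_mono mult_strict_left_mono) auto
    also have "\<dots> = e" using I C(1) by (simp add: field_simps)
    finally show "norm ((\<integral>x. f n x * c x \<partial>M) - (\<integral>x. F x * c x \<partial>M)) < e" .
  qed
qed

section \<open>The spaces \<open>V\<close> and \<open>H\<close>\<close>

lemma borel_measurable_vec_iff:
  fixes g :: "'a \<Rightarrow> real ^ 'n::finite"
  shows "g \<in> borel_measurable M \<longleftrightarrow> (\<forall>i. (\<lambda>x. g x $ i) \<in> borel_measurable M)"
  unfolding borel_measurable_euclidean_space[of g] by (auto simp: Basis_vec_def inner_axis)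

lemma pow_int_component:
  fixes g :: "'a \<Rightarrow> real ^ 'n::finite"
  assumes "p \<ge> 1" shows "pow_int p M (\<lambda>x. g x $ i) \<le> pow_int p M (\<lambda>x. norm (g x))"
  by (rule pow_int_mono_AE[OF assms]) (simp add: component_le_norm_cart)

lemma pow_int_norm:
  fixes g :: "'a \<Rightarrow> real ^ 'n::finite"
  assumes p: "p \<ge> 1" and g: "\<And>i. (\<lambda>x. g x $ i) \<in> borel_measurable M"
  shows "pow_int p M (\<lambda>x. norm (g x)) \<le> ennreal (real CARD('n) powr p) * (\<Sum>i\<in>UNIV. pow_int p M (\<lambda>x. g x $ i))"
proof -
  have "pow_int p M (\<lambda>x. norm (g x)) \<le> pow_int p M (\<lambda>x. \<Sum>i\<in>UNIV. \<bar>g x $ i\<bar>)"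
    by (rule pow_int_mono_AE[OF p], rule AE_I2) (simp add: norm_le_l1_cart)
  also have "\<dots> \<le> ennreal (real CARD('n) powr p) * (\<Sum>i\<in>UNIV. pow_int p M (\<lambda>x. \<bar>g x $ i\<bar>))"
    by (rule pow_int_sum[OF p]) (use g in auto)
  finally show ?thesis by (simp add: pow_int_def)
qed

lemma Lp_iff:
  fixes f :: "'a \<Rightarrow> 'b::euclidean_space"
  shows "f \<in> Lp p M \<longleftrightarrow> f \<in> borel_measurable M \<and> pow_int p M (\<lambda>x. norm (f x)) < \<infinity>"
  by (auto simp: Lp_def pow_int_def integrable_iff_bounded)

lemma Lp_real_iff: "f \<in> Lp p M \<longleftrightarrow> f \<in> borel_measurable M \<and> pow_int p M f < \<infinity>" for f :: "'a \<Rightarrow> real"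
  unfolding Lp_iff by (simp add: pow_int_def)

lemma Lp_vec_iff:
  fixes g :: "'a \<Rightarrow> real ^ 'n::finite"
  assumes p: "p \<ge> 1"
  shows "g \<in> Lp p M \<longleftrightarrow> (\<forall>i. (\<lambda>x. g x $ i) \<in> borel_measurable M \<and> pow_int p M (\<lambda>x. g x $ i) < \<infinity>)"
proof
  assume g: "g \<in> Lp p M"
  then have "pow_int p M (\<lambda>x. g x $ i) < \<infinity>" for i
    using pow_int_component[OF p, of M g i] by (auto simp: Lp_iff intro: le_less_trans)
  then show "\<forall>i. (\<lambda>x. g x $ i) \<in> borel_measurable M \<and> pow_int p M (\<lambda>x. g x $ i) < \<infinity>"
    using g by (auto simp: Lp_iff borel_measurable_vec_iff[of g])
next
  assume g: "\<forall>i. (\<lambda>x. g x $ i) \<in> borel_measurable M \<and> pow_int p M (\<lambda>x. g x $ i) < \<infinity>"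
  have "pow_int p M (\<lambda>x. norm (g x)) \<le> ennreal (real CARD('n) powr p) * (\<Sum>i\<in>UNIV. pow_int p M (\<lambda>x. g x $ i))"
    by (rule pow_int_norm[OF p]) (use g in auto)
  also have "\<dots> < \<infinity>" using g by (auto simp: ennreal_mult_less_top)
  finally show "g \<in> Lp p M" using g by (auto simp: Lp_iff borel_measurable_vec_iff[of g])
qed

lemma Lp_norm_eq:
  fixes f :: "'a \<Rightarrow> 'b::euclidean_space"
  assumes [measurable]: "f \<in> borel_measurable M"
  shows "Lp_norm p M f = enn2real (pow_int p M (\<lambda>x. norm (f x))) powr (1 / p)"
  unfolding Lp_norm_def pow_int_def by (subst integral_eq_nn_integral) auto

lemma Lp_norm_le:
  fixes f :: "'a \<Rightarrow> 'b::euclidean_space"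
  assumes "p \<ge> 1" "f \<in> borel_measurable M" "e \<ge> 0" "pow_int p M (\<lambda>x. norm (f x)) \<le> ennreal (e powr p)"
  shows "Lp_norm p M f \<le> e"
proof -
  have "enn2real (pow_int p M (\<lambda>x. norm (f x))) \<le> e powr p" using assms(4) by (intro enn2real_leI) auto
  then have "enn2real (pow_int p M (\<lambda>x. norm (f x))) powr (1 / p) \<le> (e powr p) powr (1 / p)"
    using assms(1) by (intro powr_mono2) auto
  also have "\<dots> = e" using assms(1,3) by (simp add: powr_powr)
  finally show ?thesis unfolding Lp_norm_eq[OF assms(2)] .
qed

lemma pow_int_le_Lp_norm:
  fixes f :: "'a \<Rightarrow> 'b::euclidean_space"
  assumes "p \<ge> 1" "f \<in> borel_measurable M" "pow_int p M (\<lambda>x. norm (f x)) < \<infinity>"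
  shows "pow_int p M (\<lambda>x. norm (f x)) = ennreal (Lp_norm p M f powr p)"
  unfolding Lp_norm_eq[OF assms(2)] using assms(1,3) by (simp add: powr_powr ennreal_enn2real less_top)

lemma Lp_norm_tendsto_0_iff:
  fixes f :: "nat \<Rightarrow> 'a \<Rightarrow> 'b::euclidean_space"
  assumes p: "p \<ge> 1" and f: "\<And>n. f n \<in> borel_measurable M" "\<And>n. pow_int p M (\<lambda>x. norm (f n x)) < \<infinity>"
  shows "(\<lambda>n. Lp_norm p M (f n)) \<longlonglongrightarrow> 0 \<longleftrightarrow> (\<lambda>n. pow_int p M (\<lambda>x. norm (f n x))) \<longlonglongrightarrow> 0"
proof
  assume a: "(\<lambda>n. Lp_norm p M (f n)) \<longlonglongrightarrow> 0"
  have "(\<lambda>n. Lp_norm p M (f n) powr p) \<longlonglongrightarrow> 0 powr p"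
    using a p by (intro tendsto_powr2 tendsto_const always_eventually) (auto simp: Lp_norm_def)
  then have "(\<lambda>n. ennreal (Lp_norm p M (f n) powr p)) \<longlonglongrightarrow> ennreal 0" using p by (intro tendsto_ennrealI) auto
  then show "(\<lambda>n. pow_int p M (\<lambda>x. norm (f n x))) \<longlonglongrightarrow> 0"
    using pow_int_le_Lp_norm[OF p f(1) f(2)] by simp
next
  assume a: "(\<lambda>n. pow_int p M (\<lambda>x. norm (f n x))) \<longlonglongrightarrow> 0"
  have "(\<lambda>n. enn2real (pow_int p M (\<lambda>x. norm (f n x)))) \<longlonglongrightarrow> enn2real 0" using a by (intro tendsto_enn2real) auto
  then have "(\<lambda>n. enn2real (pow_int p M (\<lambda>x. norm (f n x))) powr (1 / p)) \<longlonglongrightarrow> 0 powr (1 / p)"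
    using p by (intro tendsto_powr2 tendsto_const always_eventually) auto
  then show "(\<lambda>n. Lp_norm p M (f n)) \<longlonglongrightarrow> 0" unfolding Lp_norm_eq[OF f(1)] by simp
qed

lemma borel_representative:
  fixes u :: "'a::euclidean_space \<Rightarrow> real"
  assumes "u \<in> borel_measurable lebesgue"
  obtains u0 where "u0 \<in> borel_measurable borel" "AE x in lborel. u x = u0 x"
  using completion_ex_borel_measurable_real[OF assms] by auto

lemma borel_lebesgue: "u \<in> borel_measurable borel \<Longrightarrow> u \<in> borel_measurable lebesgue" for u :: "'a::euclidean_space \<Rightarrow> real"
  by (rule measurable_completion) simp

lemma integral_lebesgue_AE:
  fixes u u0 :: "'a::euclidean_space \<Rightarrow> real"
  assumes u: "u \<in> borel_measurable lebesgue" "u0 \<in> borel_measurable borel" "AE x in lborel. u x = u0 x"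
  shows "integrable lebesgue u \<longleftrightarrow> integrable lborel u0" "integral\<^sup>L lebesgue u = integral\<^sup>L lborel u0"
proof -
  have AE: "AE x in lebesgue. u x = u0 x" using u(3) by (rule AE_completion)
  show "integrable lebesgue u \<longleftrightarrow> integrable lborel u0"
    using integrable_cong_AE[OF u(1) borel_lebesgue[OF u(2)] AE] u(2) by (simp add: integrable_completion)
  show "integral\<^sup>L lebesgue u = integral\<^sup>L lborel u0"
    using integral_cong_AE[OF u(1) borel_lebesgue[OF u(2)] AE] u(2) by (simp add: integral_completion)
qed

lemma Lp_loc_loc_int:
  fixes u :: "'a::euclidean_space \<Rightarrow> 'b::euclidean_space"
  assumes u: "u \<in> Lp_loc q lebesgue" and v: "v \<in> borel_measurable borel" "AE x in lborel. \<bar>v x\<bar> \<le> norm (u x)" and q: "q \<ge> 0"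
  shows "loc_int (\<lambda>x. \<bar>v x\<bar> powr q)"
  unfolding loc_int_def
proof (intro conjI allI)
  note [measurable] = v(1)
  show "(\<lambda>x. \<bar>v x\<bar> powr q) \<in> borel_measurable borel" by measurable
  fix R
  have "integrable lebesgue (\<lambda>x. indicator (cball 0 R) x *\<^sub>R norm (u x) powr q)"
    using u by (simp add: Lp_loc_def set_integrable_def)
  then have "integrable lebesgue (\<lambda>x. indicator (cball 0 R) x * \<bar>v x\<bar> powr q)"
  proof (rule Bochner_Integration.integrable_bound)
    show "(\<lambda>x. indicator (cball 0 R) x * \<bar>v x\<bar> powr q) \<in> borel_measurable lebesgue" by (rule borel_lebesgue) measurable
    show "AE x in lebesgue. norm (indicator (cball 0 R) x * \<bar>v x\<bar> powr q) \<le> norm (indicator (cball 0 R) x *\<^sub>R norm (u x) powr q)"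
      using AE_completion[OF v(2)] by eventually_elim (use q in \<open>auto simp: indicator_def intro!: powr_mono2\<close>)
  qed
  then show "integrable lborel (\<lambda>x. indicator (cball 0 R) x * \<bar>v x\<bar> powr q)"
    by (subst (asm) integrable_completion) measurable
qed

lemma wder_unique:
  assumes "wder i u g" "wder i u h" shows "AE x in lborel. g x = h x"
proof -
  have l: "loc_int g" "loc_int h" using assms by (auto simp: wder_def)
  have "AE x in lborel. g x + (- 1) * h x = 0"
  proof (rule AE_0_if_orthogonal[OF loc_int_add[OF l(1) loc_int_cmult[OF l(2)]]])
    fix \<eta> :: "real ^ 'a \<Rightarrow> real" assume e: "\<eta> \<in> C0_infty"
    have "(\<integral>x. g x * \<eta> x \<partial>lborel) = (\<integral>x. h x * \<eta> x \<partial>lborel)" using assms e by (auto simp: wder_def)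
    then show "(\<integral>x. (g x + (- 1) * h x) * \<eta> x \<partial>lborel) = 0"
      using loc_int_mult_C0[OF l(1) e] loc_int_mult_C0[OF l(2) e] by (simp add: left_diff_distrib)
  qed
  then show ?thesis by (auto elim!: eventually_mono)
qed

text \<open>Here \<open>\<phi>\<close> and \<open>D\<close> are Borel representatives of \<open>phi p w\<close> and of its weak gradient, so that
  \<open>\<phi> powr p\<close> represents \<open>w\<close>.\<close>

locale diff_weight =
  fixes p :: real and w :: "real ^ 'n::finite \<Rightarrow> real" and \<phi> :: "real ^ 'n \<Rightarrow> real" and D :: "'n \<Rightarrow> real ^ 'n \<Rightarrow> real"
  assumes p: "1 \<le> p" and weight: "weight w" and diff: "Diff_cond p w"
    and phi_borel: "\<phi> \<in> borel_measurable borel" and phi_nonneg: "\<And>x. \<phi> x \<ge> 0" and phi_AE: "AE x in lborel. phi p w x = \<phi> x"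
    and D_borel: "\<And>i. D i \<in> borel_measurable borel" and D_AE: "\<And>i. AE x in lborel. weak_gradient (phi p w) x $ i = D i x"
begin

text \<open>The weak derivative of the weight; it represents \<open>beta p w x $ i * w x\<close> (see \<open>beta_AE\<close>).\<close>

definition b :: "'n \<Rightarrow> real ^ 'n \<Rightarrow> real" where
  "b i x = (if \<phi> x = 0 then 0 else p * \<phi> x powr (p - 1) * D i x)"

abbreviation M :: "(real ^ 'n) measure" where "M \<equiv> mu w"

lemma b_borel: "b i \<in> borel_measurable borel"
proof -
  note [measurable] = phi_borel D_borel
  show ?thesis unfolding b_def[abs_def] by measurable
qed

lemma w_lebesgue: "w \<in> borel_measurable lebesgue"
  using weight by (simp add: weight_def Lp_loc_def)

lemma w_AE: "AE x in lborel. w x = \<phi> x powr p"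
proof -
  have "AE x in lborel. 0 \<le> w x" using weight by (simp add: weight_def AE_completion_iff)
  then show ?thesis using phi_AE
    by eventually_elim (use p in \<open>auto simp: phi_def powr_powr dest!: sym[of _ "\<phi> _"]\<close>)
qed

lemma sets_M [simp]: "sets M = sets lebesgue" and space_M [simp]: "space M = UNIV"
  by (simp_all add: mu_def)

lemma measurable_M [simp]: "borel_measurable M = borel_measurable lebesgue"
  by (rule measurable_cong_sets) simp_all

lemma M_eq: "M = density lebesgue (\<lambda>x. ennreal (\<phi> x powr p))"
proof -
  have "(\<lambda>x. \<phi> x powr p) \<in> borel_measurable lebesgue"
    by (rule borel_lebesgue) (use phi_borel in measurable)
  then show ?thesis unfolding mu_def
    by (intro density_cong) (use w_lebesgue AE_completion[OF w_AE] in \<open>auto elim!: eventually_mono\<close>)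
qed

lemma phi_powr_lebesgue: "(\<lambda>x. \<phi> x powr p) \<in> borel_measurable lebesgue"
  by (rule borel_lebesgue) (use phi_borel in measurable)

lemma AE_M_iff: "(AE x in M. P x) \<longleftrightarrow> (AE x in lborel. \<phi> x \<noteq> 0 \<longrightarrow> P x)"
  unfolding M_eq using phi_powr_lebesgue phi_nonneg
  by (subst AE_density) (auto simp: AE_completion_iff less_le)

lemma integral_M:
  assumes u: "u \<in> borel_measurable lebesgue" "u0 \<in> borel_measurable borel" "AE x in lborel. u x * \<phi> x powr p = u0 x"
  shows "integrable M u \<longleftrightarrow> integrable lborel u0" "integral\<^sup>L M u = integral\<^sup>L lborel u0"
proof -
  have m: "(\<lambda>x. u x * \<phi> x powr p) \<in> borel_measurable lebesgue" using u(1) phi_powr_lebesgue by (rule borel_measurable_times)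
  show "integrable M u \<longleftrightarrow> integrable lborel u0"
    unfolding M_eq using u(1) phi_powr_lebesgue integral_lebesgue_AE(1)[OF m u(2,3)]
    by (subst integrable_density) (auto simp: mult.commute)
  show "integral\<^sup>L M u = integral\<^sup>L lborel u0"
    unfolding M_eq using u(1) phi_powr_lebesgue integral_lebesgue_AE(2)[OF m u(2,3)]
    by (subst integral_density) (auto simp: mult.commute)
qed

lemma pow_int_M:
  assumes u: "u \<in> borel_measurable lebesgue" "AE x in lborel. u x = u0 x"
  shows "pow_int p M u = pow_int p lborel (\<lambda>x. u0 x * \<phi> x)"
proof -
  note [measurable] = u(1) phi_powr_lebesgue
  have "pow_int p M u = (\<integral>\<^sup>+x. ennreal (\<phi> x powr p) * ennreal (\<bar>u x\<bar> powr p) \<partial>lebesgue)"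
    unfolding pow_int_def M_eq by (rule nn_integral_density) measurable
  also have "\<dots> = (\<integral>\<^sup>+x. ennreal (\<bar>u0 x * \<phi> x\<bar> powr p) \<partial>lborel)"
    unfolding nn_integral_completion
    by (rule nn_integral_cong_AE) (use u(2) phi_nonneg in \<open>auto elim!: eventually_mono simp: abs_mult powr_mult ennreal_mult[symmetric] mult.commute\<close>)
  finally show ?thesis by (simp add: pow_int_def)
qed

lemma weak_gradient_phi: "has_weak_gradient (phi p w) (weak_gradient (phi p w))"
  unfolding weak_gradient_def by (rule someI_ex[where P="has_weak_gradient (phi p w)"]) (use diff in \<open>simp add: Diff_cond_def W1p_loc_def\<close>)

lemma D_loc: "loc_int (\<lambda>x. \<bar>D i x\<bar> powr p)"
proof (rule Lp_loc_loc_int)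
  show "weak_gradient (phi p w) \<in> Lp_loc p lebesgue" using diff by (simp add: Diff_cond_def W1p_loc_def)
  show "AE x in lborel. \<bar>D i x\<bar> \<le> norm (weak_gradient (phi p w) x)"
    using D_AE[of i] by eventually_elim (metis component_le_norm_cart)
qed (use p D_borel in auto)

lemma phi_loc: "loc_int (\<lambda>x. \<phi> x powr p)"
proof -
  have "loc_int (\<lambda>x. \<bar>\<phi> x\<bar> powr p)"
  proof (rule Lp_loc_loc_int)
    show "phi p w \<in> Lp_loc p lebesgue" using diff by (simp add: Diff_cond_def W1p_loc_def)
    show "AE x in lborel. \<bar>\<phi> x\<bar> \<le> norm (phi p w x)" using phi_AE by eventually_elim simp
  qed (use p phi_borel in auto)
  then show ?thesis using phi_nonneg by (simp add: abs_of_nonneg)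
qed

lemma wder_phi: "wder i \<phi> (D i)"
  unfolding wder_def
proof (intro conjI ballI)
  note [measurable] = phi_borel D_borel
  have wg: "phi p w \<in> borel_measurable lebesgue" "weak_gradient (phi p w) \<in> borel_measurable lebesgue"
    using weak_gradient_phi by (auto simp: has_weak_gradient_def Lp_loc_def)
  show "loc_int \<phi>" by (rule loc_int_powr[OF p phi_borel]) (use phi_loc phi_nonneg in \<open>simp add: abs_of_nonneg\<close>)
  show "loc_int (D i)" by (rule loc_int_powr[OF p D_borel D_loc])
  fix \<eta> :: "real ^ 'n \<Rightarrow> real" assume e: "\<eta> \<in> C0_infty"
  note [measurable] = C0_infty_borel[OF e] C0_infty_borel[OF C0_infty_partial[OF e]]
  have "(\<integral>x. phi p w x * partial i \<eta> x \<partial>lebesgue) = (\<integral>x. \<phi> x * partial i \<eta> x \<partial>lborel)"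
    by (rule integral_lebesgue_AE(2))
       (use phi_AE in \<open>auto intro!: borel_measurable_times wg borel_lebesgue[OF C0_infty_borel[OF C0_infty_partial[OF e]]]\<close>)
  moreover have "(\<integral>x. weak_gradient (phi p w) x $ i * \<eta> x \<partial>lebesgue) = (\<integral>x. D i x * \<eta> x \<partial>lborel)"
    by (rule integral_lebesgue_AE(2))
       (use D_AE[of i] wg(2) in \<open>auto intro!: borel_measurable_times borel_lebesgue[OF C0_infty_borel[OF e]] simp: borel_measurable_vec_iff[of "weak_gradient _"]\<close>)
  ultimately show "(\<integral>x. \<phi> x * partial i \<eta> x \<partial>lborel) = - (\<integral>x. D i x * \<eta> x \<partial>lborel)"
    using weak_gradient_phi e by (auto simp: has_weak_gradient_def)
qed

lemma wder_weight: "wder i (\<lambda>x. \<phi> x powr p) (b i)"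
  by (rule wder_powr[OF p phi_nonneg wder_phi phi_loc D_loc b_def])

lemma beta_lebesgue: "(\<lambda>x. beta p w x $ i) \<in> borel_measurable lebesgue"
proof -
  have "beta p w \<in> borel_measurable M"
    using diff by (auto simp: Diff_cond_def Lconj_loc_def Linfty_loc_def Lp_loc_def split: if_splits)
  then show ?thesis by (simp add: borel_measurable_vec_iff[of "beta p w"])
qed

lemma beta_AE: "AE x in lborel. beta p w x $ i * \<phi> x powr p = b i x"
  using phi_AE D_AE[of i]
proof eventually_elim
  fix x assume 1: "phi p w x = \<phi> x" "weak_gradient (phi p w) x $ i = D i x"
  show "beta p w x $ i * \<phi> x powr p = b i x"
  proof (cases "\<phi> x = 0")
    case False
    then have x: "\<phi> x > 0" using phi_nonneg[of x] by simp
    have "\<phi> x powr p = \<phi> x powr (p - 1) * \<phi> x" using x powr_add[of "\<phi> x" "p - 1" 1] by simp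
    then show ?thesis using x 1 by (simp add: beta_def b_def field_simps)
  qed (simp add: beta_def b_def 1)
qed

lemma C0_lebesgue: "\<eta> \<in> C0_infty \<Longrightarrow> \<eta> \<in> borel_measurable lebesgue" for \<eta> :: "real ^ 'n \<Rightarrow> real"
  by (rule borel_lebesgue[OF C0_infty_borel])

lemma emeasure_cball_M: "emeasure M (cball 0 R) < \<infinity>"
proof -
  have "integrable lborel (\<lambda>x. indicator (cball 0 R) x * \<phi> x powr p)" using phi_loc by (simp add: loc_int_def)
  moreover have "(\<lambda>x. indicator (cball 0 R) x * \<phi> x powr p) \<in> borel_measurable borel"
    using phi_borel by measurable
  ultimately have "integrable M (indicator (cball 0 R) :: real ^ 'n \<Rightarrow> real)"
    by (subst integral_M(1)[of _ "\<lambda>x. indicator (cball 0 R) x * \<phi> x powr p"])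
       (auto intro!: borel_lebesgue indicator_cball_measurable)
  then show ?thesis by (subst (asm) integrable_indicator_iff) auto
qed

lemma dual_bounded:
  fixes c :: "real ^ 'n \<Rightarrow> real"
  assumes c: "c \<in> borel_measurable lebesgue" "\<And>x. \<bar>c x\<bar> \<le> B * indicator (cball 0 R) x"
  shows "dual p M c"
proof (cases "p = 1")
  case True
  have "\<bar>c x\<bar> \<le> \<bar>B\<bar>" for x using c(2)[of x] by (cases "x \<in> cball 0 R") auto
  then show ?thesis unfolding True using c(1) by (intro dual_1[of _ _ "\<bar>B\<bar>"]) auto
next
  case False
  show ?thesis
  proof (rule dual_gt_1)
    show "integrable M (\<lambda>x. \<bar>c x\<bar> powr (p / (p - 1)))"
    proof (rule Bochner_Integration.integrable_bound)
      show "integrable M (\<lambda>x. \<bar>B\<bar> powr (p / (p - 1)) * indicator (cball 0 R) x)"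
        using emeasure_cball_M by (intro integrable_mult_right integrable_real_indicator) auto
      have "\<bar>c x\<bar> powr (p / (p - 1)) \<le> \<bar>B\<bar> powr (p / (p - 1)) * indicator (cball 0 R) x" for x
        using c(2)[of x] p False by (cases "x \<in> cball 0 R") (auto intro!: powr_mono2)
      then show "AE x in M. norm (\<bar>c x\<bar> powr (p / (p - 1))) \<le> norm (\<bar>B\<bar> powr (p / (p - 1)) * indicator (cball 0 R) x)" by simp
    qed (use c(1) in simp)
  qed (use False p c(1) in auto)
qed

lemma dual_C0: "\<eta> \<in> C0_infty \<Longrightarrow> dual p M \<eta>"
  by (rule C0_infty_bound_indicator, assumption, rule dual_bounded) (auto intro: C0_lebesgue)

text \<open>Here the assumption on \<open>beta\<close> enters: it makes the last term in the definition of the gradient continuous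
  on \<open>L\<^sup>p(\<mu>)\<close>.\<close>

lemma dual_beta:
  assumes e: "\<eta> \<in> C0_infty" shows "dual p M (\<lambda>x. \<eta> x * beta p w x $ i)"
proof -
  obtain B R where B: "B > 0" "\<And>x. \<bar>\<eta> x\<bar> \<le> B * indicator (cball 0 R) x" using C0_infty_bound_indicator[OF e] by metis
  have m: "(\<lambda>x. \<eta> x * beta p w x $ i) \<in> borel_measurable M"
    using borel_measurable_times[OF C0_lebesgue[OF e] beta_lebesgue] by simp
  have le: "\<bar>\<eta> x * beta p w x $ i\<bar> \<le> B * (indicator (cball 0 R) x * norm (beta p w x))" for x
    unfolding abs_mult using mult_mono[OF B(2)[of x] component_le_norm_cart[of "beta p w x" i]] B(1) by (simp add: mult.assoc)
  show ?thesis
  proof (cases "p = 1")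
    case True
    then have "beta p w \<in> Linfty_loc M" using diff by (simp add: Diff_cond_def Lconj_loc_def)
    then obtain C where C: "AE x in M. x \<in> cball 0 R \<longrightarrow> norm (beta p w x) \<le> C"
      unfolding Linfty_loc_def using compact_cball by blast
    have "dual 1 M (\<lambda>x. \<eta> x * beta p w x $ i)"
    proof (rule dual_1[OF m, of "B * \<bar>C\<bar>"])
      show "AE x in M. \<bar>\<eta> x * beta p w x $ i\<bar> \<le> B * \<bar>C\<bar>"
        using C
      proof eventually_elim
        fix x assume "x \<in> cball 0 R \<longrightarrow> norm (beta p w x) \<le> C"
        then have "indicator (cball 0 R) x * norm (beta p w x) \<le> \<bar>C\<bar>" by (cases "x \<in> cball 0 R") auto
        then show "\<bar>\<eta> x * beta p w x $ i\<bar> \<le> B * \<bar>C\<bar>"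
          using B(1) by (intro order.trans[OF le] mult_left_mono) auto
      qed
    qed
    then show ?thesis using True by simp
  next
    case False
    let ?q = "p / (p - 1)"
    have q: "?q > 0" using p False by simp
    show ?thesis
    proof (rule dual_gt_1[OF _ m])
      have int: "integrable M (\<lambda>x. indicator (cball 0 R) x *\<^sub>R norm (beta p w x) powr ?q)"
        using diff False by (auto simp: Diff_cond_def Lconj_loc_def Lp_loc_def set_integrable_def)
      show "integrable M (\<lambda>x. \<bar>\<eta> x * beta p w x $ i\<bar> powr ?q)"
      proof (rule Bochner_Integration.integrable_bound)
        show "integrable M (\<lambda>x. B powr ?q * (indicator (cball 0 R) x *\<^sub>R norm (beta p w x) powr ?q))"
          by (rule integrable_mult_right[OF int])
        show "(\<lambda>x. \<bar>\<eta> x * beta p w x $ i\<bar> powr ?q) \<in> borel_measurable M" using m by measurable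
        have "\<bar>\<eta> x * beta p w x $ i\<bar> powr ?q \<le> (B * (indicator (cball 0 R) x * norm (beta p w x))) powr ?q" for x
          using q by (intro powr_mono2 le) auto
        also have "(B * (indicator (cball 0 R) x * norm (beta p w x))) powr ?q = B powr ?q * (indicator (cball 0 R) x *\<^sub>R norm (beta p w x) powr ?q)" for x
          using B(1) q by (auto simp: powr_mult indicator_def)
        finally show "AE x in M. norm (\<bar>\<eta> x * beta p w x $ i\<bar> powr ?q) \<le> norm (B powr ?q * (indicator (cball 0 R) x *\<^sub>R norm (beta p w x) powr ?q))"
          by simp
      qed
    qed (use False p in auto)
  qed
qed

lemma loc_intI:
  assumes u: "u \<in> borel_measurable borel" and int: "\<And>\<eta>. \<eta> \<in> C0_infty \<Longrightarrow> integrable lborel (\<lambda>x. u x * \<eta> x)"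
  shows "loc_int (u :: real ^ 'n \<Rightarrow> real)"
  unfolding loc_int_def
proof (intro conjI allI u)
  fix R
  note [measurable] = u
  show "integrable lborel (\<lambda>x. indicator (cball 0 R) x * u x)"
  proof (rule Bochner_Integration.integrable_bound[OF int[OF C0_infty_cutoff[of R]]])
    show "AE x in lborel. norm (indicator (cball 0 R) x * u x) \<le> norm (u x * cutoff R x)"
      by (intro AE_I2) (auto simp: indicator_def cutoff_eq_1)
  qed measurable
qed

text \<open>In terms of Borel representatives, \<open>g\<close> is the gradient of \<open>f\<close> in \<open>V\<close> if and only if \<open>f w\<close> is weakly
  differentiable with gradient \<open>g w + f \<beta> w\<close>.\<close>

lemma mu_gradient_iff_wder:
  assumes f: "f \<in> Lp p M" and g: "g \<in> Lp p M"
    and f0: "f0 \<in> borel_measurable borel" "AE x in lborel. f x = f0 x"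
    and g0: "\<And>i. g0 i \<in> borel_measurable borel" "\<And>i. AE x in lborel. g x $ i = g0 i x"
  shows "has_mu_gradient p w f g \<longleftrightarrow> (\<forall>i. wder i (\<lambda>x. f0 x * \<phi> x powr p) (\<lambda>x. g0 i x * \<phi> x powr p + f0 x * b i x))"
proof -
  note [measurable] = f0(1) g0(1) phi_borel b_borel
  have f': "f \<in> borel_measurable lebesgue" "pow_int p M f < \<infinity>" using f by (auto simp: Lp_real_iff)
  have g': "(\<lambda>x. g x $ i) \<in> borel_measurable lebesgue" "pow_int p M (\<lambda>x. g x $ i) < \<infinity>" for i using g by (auto simp: Lp_vec_iff[OF p])
  have T: "integrable lborel (\<lambda>x. f0 x * \<phi> x powr p * \<eta> x)" "(\<integral>x. f x * \<eta> x \<partial>M) = (\<integral>x. f0 x * \<phi> x powr p * \<eta> x \<partial>lborel)"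
    "integrable lborel (\<lambda>x. g0 i x * \<phi> x powr p * \<eta> x)" "(\<integral>x. g x $ i * \<eta> x \<partial>M) = (\<integral>x. g0 i x * \<phi> x powr p * \<eta> x \<partial>lborel)"
    "integrable lborel (\<lambda>x. f0 x * b i x * \<eta> x)" "(\<integral>x. f x * \<eta> x * beta p w x $ i \<partial>M) = (\<integral>x. f0 x * b i x * \<eta> x \<partial>lborel)"
    if e: "\<eta> \<in> C0_infty" for \<eta> i
  proof -
    note [measurable] = C0_infty_borel[OF e]
    have m: "(\<lambda>x. f x * \<eta> x) \<in> borel_measurable lebesgue" "(\<lambda>x. g x $ i * \<eta> x) \<in> borel_measurable lebesgue"
      "(\<lambda>x. f x * \<eta> x * beta p w x $ i) \<in> borel_measurable lebesgue"
      by (intro borel_measurable_times f' g' C0_lebesgue[OF e] beta_lebesgue)+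
    have "AE x in lborel. f x * \<eta> x * \<phi> x powr p = f0 x * \<phi> x powr p * \<eta> x" using f0(2) by eventually_elim simp
    note 1 = integral_M[OF m(1) _ this]
    show "integrable lborel (\<lambda>x. f0 x * \<phi> x powr p * \<eta> x)" "(\<integral>x. f x * \<eta> x \<partial>M) = (\<integral>x. f0 x * \<phi> x powr p * \<eta> x \<partial>lborel)"
      using 1 dual_integrable[OF dual_C0[OF e], of f] f' by auto
    have "AE x in lborel. g x $ i * \<eta> x * \<phi> x powr p = g0 i x * \<phi> x powr p * \<eta> x" using g0(2)[of i] by eventually_elim simp
    note 2 = integral_M[OF m(2) _ this]
    show "integrable lborel (\<lambda>x. g0 i x * \<phi> x powr p * \<eta> x)" "(\<integral>x. g x $ i * \<eta> x \<partial>M) = (\<integral>x. g0 i x * \<phi> x powr p * \<eta> x \<partial>lborel)"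
      using 2 dual_integrable[OF dual_C0[OF e], of "\<lambda>x. g x $ i"] g'[of i] by auto
    have "AE x in lborel. f x * \<eta> x * beta p w x $ i * \<phi> x powr p = f0 x * b i x * \<eta> x"
      using f0(2) beta_AE[of i]
    proof eventually_elim
      fix x assume 1: "f x = f0 x" and 2: "beta p w x $ i * \<phi> x powr p = b i x"
      show "f x * \<eta> x * beta p w x $ i * \<phi> x powr p = f0 x * b i x * \<eta> x" unfolding 1 2[symmetric] by (simp add: mult_ac)
    qed
    note 3 = integral_M[OF m(3) _ this]
    show "integrable lborel (\<lambda>x. f0 x * b i x * \<eta> x)" "(\<integral>x. f x * \<eta> x * beta p w x $ i \<partial>M) = (\<integral>x. f0 x * b i x * \<eta> x \<partial>lborel)"
      using 3 dual_integrable[OF dual_beta[OF e, of i], of f] f' by (auto simp: mult.assoc)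
  qed
  have l: "loc_int (\<lambda>x. f0 x * \<phi> x powr p)" "loc_int (\<lambda>x. g0 i x * \<phi> x powr p + f0 x * b i x)" for i
    by (intro loc_int_add loc_intI T; measurable)+
  have sum: "(\<integral>x. (g0 i x * \<phi> x powr p + f0 x * b i x) * \<eta> x \<partial>lborel)
     = (\<integral>x. g0 i x * \<phi> x powr p * \<eta> x \<partial>lborel) + (\<integral>x. f0 x * b i x * \<eta> x \<partial>lborel)" if "\<eta> \<in> C0_infty" for \<eta> i
    unfolding distrib_right using T(3)[OF that] T(5)[OF that] by simp
  have "has_mu_gradient p w f g \<longleftrightarrow> (\<forall>i. \<forall>\<eta>\<in>C0_infty.
      (\<integral>x. g0 i x * \<phi> x powr p * \<eta> x \<partial>lborel) = - (\<integral>x. f0 x * \<phi> x powr p * partial i \<eta> x \<partial>lborel) - (\<integral>x. f0 x * b i x * \<eta> x \<partial>lborel))"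
    unfolding has_mu_gradient_def using g T(2)[OF C0_infty_partial] T(4,6) by simp
  also have "\<dots> \<longleftrightarrow> (\<forall>i. \<forall>\<eta>\<in>C0_infty. (\<integral>x. f0 x * \<phi> x powr p * partial i \<eta> x \<partial>lborel)
      = - (\<integral>x. (g0 i x * \<phi> x powr p + f0 x * b i x) * \<eta> x \<partial>lborel))"
    by (intro arg_cong[where f=All] ext ball_cong refl) (subst sum, assumption, linarith)
  also have "\<dots> \<longleftrightarrow> (\<forall>i. wder i (\<lambda>x. f0 x * \<phi> x powr p) (\<lambda>x. g0 i x * \<phi> x powr p + f0 x * b i x))"
    unfolding wder_def using l by simp
  finally show ?thesis .
qed

lemma borel_representatives:
  fixes g :: "real ^ 'n \<Rightarrow> real ^ 'n"
  assumes "g \<in> Lp p M"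
  obtains g0 where "\<And>i. g0 i \<in> borel_measurable borel" "\<And>i. AE x in lborel. g x $ i = g0 i x"
proof -
  have "\<exists>u0. u0 \<in> borel_measurable borel \<and> (AE x in lborel. g x $ i = u0 x)" for i
    using borel_representative[of "\<lambda>x. g x $ i"] assms by (auto simp: Lp_vec_iff[OF p])
  then show ?thesis using that by metis
qed

lemma mu_gradient_unique:
  assumes f: "f \<in> Lp p M" and g: "has_mu_gradient p w f g" and h: "has_mu_gradient p w f h"
  shows "AE x in M. g x = h x"
proof -
  have L: "g \<in> Lp p M" "h \<in> Lp p M" using g h by (auto simp: has_mu_gradient_def)
  obtain f0 where f0: "f0 \<in> borel_measurable borel" "AE x in lborel. f x = f0 x"
    using borel_representative[of f] f by (auto simp: Lp_real_iff)
  obtain g0 where g0: "\<And>i. g0 i \<in> borel_measurable borel" "\<And>i. AE x in lborel. g x $ i = g0 i x" by (rule borel_representatives[OF L(1)]) blast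
  obtain h0 where h0: "\<And>i. h0 i \<in> borel_measurable borel" "\<And>i. AE x in lborel. h x $ i = h0 i x" by (rule borel_representatives[OF L(2)]) blast
  have eq: "AE x in lborel. g0 i x * \<phi> x powr p + f0 x * b i x = h0 i x * \<phi> x powr p + f0 x * b i x" for i
    using mu_gradient_iff_wder[OF f L(1) f0 g0] mu_gradient_iff_wder[OF f L(2) f0 h0] g h by (intro wder_unique) auto
  have "AE x in lborel. \<phi> x \<noteq> 0 \<longrightarrow> g x $ i = h x $ i" for i
    using eq[of i] g0(2)[of i] h0(2)[of i] by eventually_elim auto
  then have "AE x in lborel. \<forall>i. \<phi> x \<noteq> 0 \<longrightarrow> g x $ i = h x $ i" by (intro eventually_all_finite)
  then show ?thesis unfolding AE_M_iff by (auto elim!: eventually_mono simp: vec_eq_iff)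
qed

lemma C0_Lp: "\<eta> \<in> C0_infty \<Longrightarrow> \<eta> \<in> Lp p M"
proof -
  assume e: "\<eta> \<in> C0_infty"
  obtain B R where B: "\<And>x. \<bar>\<eta> x\<bar> \<le> B * indicator (cball 0 R) x" using C0_infty_bound_indicator[OF e] by metis
  show ?thesis unfolding Lp_real_iff
    using C0_lebesgue[OF e] pow_int_bounded_set[OF p _ emeasure_cball_M B] by simp
qed

lemma grad_Lp: "\<eta> \<in> C0_infty \<Longrightarrow> grad \<eta> \<in> Lp p M"
  using C0_Lp[OF C0_infty_partial, of \<eta>] by (auto simp: Lp_vec_iff[OF p] Lp_real_iff grad_def)

lemma C0_mu_gradient:
  assumes e: "\<eta> \<in> C0_infty" shows "has_mu_gradient p w \<eta> (grad \<eta>)"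
proof -
  have "wder i (\<lambda>x. \<eta> x * \<phi> x powr p) (\<lambda>x. partial i \<eta> x * \<phi> x powr p + \<eta> x * b i x)" for i
    using wder_mult_C0[OF wder_weight e, of i] by (simp add: add.commute)
  then show ?thesis
    by (subst mu_gradient_iff_wder[OF C0_Lp[OF e] grad_Lp[OF e] C0_infty_borel[OF e], of "\<lambda>i. partial i \<eta>"])
       (auto simp: grad_def intro: C0_infty_borel C0_infty_partial e)
qed

lemma Lp_diff:
  fixes f u :: "real ^ 'n \<Rightarrow> real"
  assumes "f \<in> Lp p M" "u \<in> Lp p M" shows "(\<lambda>x. f x - u x) \<in> Lp p M"
  using assms pow_int_diff_finite[OF p, of f M u] by (auto simp: Lp_real_iff)

lemma mu_gradient_diff:
  assumes f: "f \<in> Lp p M" "has_mu_gradient p w f g" and u: "u \<in> Lp p M" "has_mu_gradient p w u h"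
  shows "has_mu_gradient p w (\<lambda>x. f x - u x) (\<lambda>x. g x - h x)"
proof -
  have L: "(\<lambda>x. g x $ i) \<in> Lp p M" "(\<lambda>x. h x $ i) \<in> Lp p M" for i
    using f(2) u(2) by (auto simp: has_mu_gradient_def Lp_vec_iff[OF p] Lp_real_iff)
  note dl = dual_integrable[where p=p and M=M]
  show ?thesis unfolding has_mu_gradient_def
  proof (intro conjI allI ballI)
    show "(\<lambda>x. g x - h x) \<in> Lp p M" using Lp_diff[OF L(1) L(2)] by (auto simp: Lp_vec_iff[OF p] Lp_real_iff)
    fix i and \<eta> :: "real ^ 'n \<Rightarrow> real" assume e: "\<eta> \<in> C0_infty"
    have i1: "integrable M (\<lambda>x. v x * \<eta> x)" "integrable M (\<lambda>x. v x * partial i \<eta> x)" "integrable M (\<lambda>x. v x * \<eta> x * beta p w x $ i)"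
      if v: "v \<in> Lp p M" for v
      using dl[OF dual_C0[OF e], of v] dl[OF dual_C0[OF C0_infty_partial[OF e]], of v] dl[OF dual_beta[OF e, of i], of v] v
      by (auto simp: Lp_real_iff mult.assoc)
    have "(\<integral>x. g x $ i * \<eta> x \<partial>M) = - (\<integral>x. f x * partial i \<eta> x \<partial>M) - (\<integral>x. f x * \<eta> x * beta p w x $ i \<partial>M)"
      "(\<integral>x. h x $ i * \<eta> x \<partial>M) = - (\<integral>x. u x * partial i \<eta> x \<partial>M) - (\<integral>x. u x * \<eta> x * beta p w x $ i \<partial>M)"
      using f(2) u(2) e by (auto simp: has_mu_gradient_def)
    then show "(\<integral>x. (g x - h x) $ i * \<eta> x \<partial>M) = - (\<integral>x. (f x - u x) * partial i \<eta> x \<partial>M) - (\<integral>x. (f x - u x) * \<eta> x * beta p w x $ i \<partial>M)"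
      using i1[OF L(1)[of i]] i1[OF L(2)[of i]] i1[OF f(1)] i1[OF u(1)] by (simp add: left_diff_distrib)
  qed
qed

lemma approximation:
  assumes f: "f \<in> Lp p M" and g: "has_mu_gradient p w f g" and e: "e > 0"
  shows "\<exists>U\<in>C0_infty. pow_int p M (\<lambda>x. U x - f x) \<le> ennreal e \<and> pow_int p M (\<lambda>x. norm (grad U x - g x)) \<le> ennreal e"
proof -
  have gL: "g \<in> Lp p M" using g by (auto simp: has_mu_gradient_def)
  obtain f0 where f0: "f0 \<in> borel_measurable borel" "AE x in lborel. f x = f0 x"
    using borel_representative[of f] f by (auto simp: Lp_real_iff)
  obtain g0 where g0: "\<And>i. g0 i \<in> borel_measurable borel" "\<And>i. AE x in lborel. g x $ i = g0 i x" by (rule borel_representatives[OF gL]) blast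
  have f': "f \<in> borel_measurable lebesgue" "pow_int p M f < \<infinity>" using f by (auto simp: Lp_real_iff)
  have g': "(\<lambda>x. g x $ i) \<in> borel_measurable lebesgue" "pow_int p M (\<lambda>x. g x $ i) < \<infinity>" for i using gL by (auto simp: Lp_vec_iff[OF p])
  define c where "c = real CARD('n) powr p * real CARD('n) + 1"
  have c: "c \<ge> 1" by (simp add: c_def)
  have ec: "e / c > 0" using e c by simp
  have wf: "wder i (\<lambda>x. f0 x * \<phi> x powr p) (\<lambda>x. g0 i x * \<phi> x powr p + f0 x * b i x)" for i
    using mu_gradient_iff_wder[OF f gL f0 g0] g by blast
  have fin: "pow_int p lborel (\<lambda>x. f0 x * \<phi> x) < \<infinity>" "pow_int p lborel (\<lambda>x. g0 i x * \<phi> x) < \<infinity>" for i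
    using f'(2) g'(2)[of i] pow_int_M[OF f'(1) f0(2)] pow_int_M[OF g'(1) g0(2), of i] by simp_all
  obtain U where U: "U \<in> C0_infty" "pow_int p lborel (\<lambda>x. (U x - f0 x) * \<phi> x) \<le> ennreal (e / c)"
    "\<And>i. pow_int p lborel (\<lambda>x. (partial i U x - g0 i x) * \<phi> x) \<le> ennreal (e / c)"
    using weighted_approx[OF p phi_nonneg wder_phi phi_loc D_loc b_def f0(1) g0(1) wf fin ec] by blast
  have "AE x in lborel. U x - f x = U x - f0 x" using f0(2) by eventually_elim simp
  from pow_int_M[OF _ this] have 1: "pow_int p M (\<lambda>x. U x - f x) \<le> ennreal (e / c)"
    using U(2) f' C0_lebesgue[OF U(1)] by auto
  have 2: "pow_int p M (\<lambda>x. partial i U x - g x $ i) \<le> ennreal (e / c)" for i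
  proof -
    have "AE x in lborel. partial i U x - g x $ i = partial i U x - g0 i x" using g0(2)[of i] by eventually_elim simp
    from pow_int_M[OF _ this] show ?thesis
      using U(3)[of i] g'(1)[of i] C0_lebesgue[OF C0_infty_partial[OF U(1)]] by auto
  qed
  have "pow_int p M (\<lambda>x. norm (grad U x - g x)) \<le> ennreal (real CARD('n) powr p) * (\<Sum>i\<in>UNIV. pow_int p M (\<lambda>x. (grad U x - g x) $ i))"
    by (rule pow_int_norm[OF p]) (use g'(1) C0_lebesgue[OF C0_infty_partial[OF U(1)]] in \<open>auto simp: grad_def\<close>)
  also have "\<dots> \<le> ennreal (real CARD('n) powr p) * (\<Sum>i\<in>(UNIV :: 'n set). ennreal (e / c))"
    using 2 by (intro mult_left_mono sum_mono) (auto simp: grad_def)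
  also have "\<dots> = ennreal (real CARD('n) powr p * (real CARD('n) * (e / c)))"
  proof -
    have "ennreal a * (of_nat l * ennreal q) = ennreal (a * (real l * q))" if "0 \<le> a" "0 \<le> q" for a q l
      using that by (simp add: ennreal_mult ennreal_of_nat_eq_real_of_nat)
    then show ?thesis using ec by (simp only: sum_constant less_imp_le powr_ge_zero)
  qed
  also have "\<dots> \<le> ennreal e"
  proof (rule ennreal_leI)
    have "real CARD('n) powr p * (real CARD('n) * (e / c)) \<le> c * (e / c)"
      unfolding mult.assoc[symmetric] using e c by (intro mult_right_mono) (auto simp: c_def)
    then show "real CARD('n) powr p * (real CARD('n) * (e / c)) \<le> e" using c by simp
  qed
  finally have 3: "pow_int p M (\<lambda>x. norm (grad U x - g x)) \<le> ennreal e" .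
  have "ennreal (e / c) \<le> ennreal e" using e c by (intro ennreal_leI) (simp add: divide_le_eq mult_le_cancel_left1)
  with 1 3 U(1) show ?thesis by (intro bexI[of _ U]) auto
qed

text \<open>The gradient in \<open>V\<close> is a closed operator on test functions.\<close>

lemma limit_mu_gradient:
  assumes U: "\<And>n. U n \<in> C0_infty" and u: "u \<in> Lp p M" and g: "g \<in> Lp p M"
    and lim: "(\<lambda>n. pow_int p M (\<lambda>x. U n x - u x)) \<longlonglongrightarrow> 0" "\<And>i. (\<lambda>n. pow_int p M (\<lambda>x. partial i (U n) x - g x $ i)) \<longlonglongrightarrow> 0"
  shows "has_mu_gradient p w u g"
  unfolding has_mu_gradient_def
proof (intro conjI allI ballI g)
  fix i and \<eta> :: "real ^ 'n \<Rightarrow> real" assume e: "\<eta> \<in> C0_infty"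
  have UL: "U n \<in> borel_measurable M" "pow_int p M (U n) < \<infinity>" "partial i (U n) \<in> borel_measurable M" "pow_int p M (partial i (U n)) < \<infinity>" for n
    using C0_Lp[OF U[of n]] C0_Lp[OF C0_infty_partial[OF U[of n]], of i] by (auto simp: Lp_real_iff)
  have uL: "u \<in> borel_measurable M" "pow_int p M u < \<infinity>" using u by (auto simp: Lp_real_iff)
  have gL: "(\<lambda>x. g x $ i) \<in> borel_measurable M" "pow_int p M (\<lambda>x. g x $ i) < \<infinity>" using g by (auto simp: Lp_vec_iff[OF p])
  have 1: "(\<lambda>n. \<integral>x. partial i (U n) x * \<eta> x \<partial>M) \<longlonglongrightarrow> (\<integral>x. g x $ i * \<eta> x \<partial>M)"
    by (rule dual_limit[OF dual_C0[OF e] UL(3) gL(1) UL(4) gL(2) lim(2)])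
  have 2: "(\<lambda>n. \<integral>x. U n x * partial i \<eta> x \<partial>M) \<longlonglongrightarrow> (\<integral>x. u x * partial i \<eta> x \<partial>M)"
    by (rule dual_limit[OF dual_C0[OF C0_infty_partial[OF e]] UL(1) uL(1) UL(2) uL(2) lim(1)])
  have 3: "(\<lambda>n. \<integral>x. U n x * (\<eta> x * beta p w x $ i) \<partial>M) \<longlonglongrightarrow> (\<integral>x. u x * (\<eta> x * beta p w x $ i) \<partial>M)"
    by (rule dual_limit[OF dual_beta[OF e] UL(1) uL(1) UL(2) uL(2) lim(1)])
  have "(\<integral>x. partial i (U n) x * \<eta> x \<partial>M) = - (\<integral>x. U n x * partial i \<eta> x \<partial>M) - (\<integral>x. U n x * (\<eta> x * beta p w x $ i) \<partial>M)" for n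
    using C0_mu_gradient[OF U[of n]] e by (auto simp: has_mu_gradient_def grad_def mult.assoc)
  with 1 have "(\<lambda>n. - (\<integral>x. U n x * partial i \<eta> x \<partial>M) - (\<integral>x. U n x * (\<eta> x * beta p w x $ i) \<partial>M)) \<longlonglongrightarrow> (\<integral>x. g x $ i * \<eta> x \<partial>M)" by simp
  from LIMSEQ_unique[OF this tendsto_diff[OF tendsto_minus[OF 2] 3]]
  show "(\<integral>x. g x $ i * \<eta> x \<partial>M) = - (\<integral>x. u x * partial i \<eta> x \<partial>M) - (\<integral>x. u x * \<eta> x * beta p w x $ i \<partial>M)"
    by (simp add: mult.assoc)
qed

lemma has_mu_gradient_mu_gradient: "f \<in> V1p p w \<Longrightarrow> has_mu_gradient p w f (mu_gradient p w f)"
  unfolding mu_gradient_def by (rule someI_ex[where P="has_mu_gradient p w f"]) (simp add: V1p_def)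

lemma C0_subset_V: "C0_infty \<subseteq> V1p p w"
  using C0_Lp C0_mu_gradient by (auto simp: V1p_def)

lemma C0_dense_V:
  assumes f: "f \<in> V1p p w" and e: "e > 0"
  shows "\<exists>\<eta>\<in>C0_infty. V_norm p w (\<lambda>x. f x - \<eta> x) < e"
proof -
  have fL: "f \<in> Lp p M" using f by (simp add: V1p_def)
  note g = has_mu_gradient_mu_gradient[OF f]
  \<comment> \<open>Both terms of the norm contribute at most \<open>d\<close>, and \<open>2 d < e\<^sup>p\<close>.\<close>
  define d where "d = e powr p / 4"
  have d: "d > 0" using e by (simp add: d_def)
  obtain U where U: "U \<in> C0_infty" "pow_int p M (\<lambda>x. U x - f x) \<le> ennreal d" "pow_int p M (\<lambda>x. norm (grad U x - mu_gradient p w f x)) \<le> ennreal d"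
    using approximation[OF fL g d] by blast
  let ?u = "\<lambda>x. f x - U x"
  have uL: "?u \<in> Lp p M" by (rule Lp_diff[OF fL C0_Lp[OF U(1)]])
  have G: "has_mu_gradient p w ?u (\<lambda>x. mu_gradient p w f x - grad U x)"
    by (rule mu_gradient_diff[OF fL g C0_Lp[OF U(1)] C0_mu_gradient[OF U(1)]])
  then have uV: "?u \<in> V1p p w" using uL by (auto simp: V1p_def)
  note Gu = has_mu_gradient_mu_gradient[OF uV]
  have AE: "AE x in M. mu_gradient p w ?u x = mu_gradient p w f x - grad U x" by (rule mu_gradient_unique[OF uL Gu G])
  have GuL: "mu_gradient p w ?u \<in> Lp p M" using Gu by (simp add: has_mu_gradient_def)
  have "pow_int p M (\<lambda>x. norm (mu_gradient p w ?u x)) = pow_int p M (\<lambda>x. norm (grad U x - mu_gradient p w f x))"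
    by (rule pow_int_cong_AE) (use AE in \<open>auto elim!: eventually_mono simp: norm_minus_commute\<close>)
  with U(3) have 1: "enn2real (pow_int p M (\<lambda>x. norm (mu_gradient p w ?u x))) \<le> d" using d by (intro enn2real_leI) auto
  have "pow_int p M (\<lambda>x. norm (?u x)) = pow_int p M (\<lambda>x. U x - f x)" by (simp add: pow_int_def abs_minus_commute)
  with U(2) have 2: "enn2real (pow_int p M (\<lambda>x. norm (?u x))) \<le> d" using d by (intro enn2real_leI) auto
  have m: "mu_gradient p w ?u \<in> borel_measurable M" "?u \<in> borel_measurable M" using GuL uL by (simp_all only: Lp_iff)
  have pp: "(a powr (1 / p)) powr p = a" if "a \<ge> 0" for a :: real using p that by (simp add: powr_powr)
  have "V_norm p w ?u = (enn2real (pow_int p M (\<lambda>x. norm (mu_gradient p w ?u x))) + enn2real (pow_int p M (\<lambda>x. norm (?u x)))) powr (1 / p)"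
    unfolding V_norm_def Lp_norm_eq[OF m(1)] Lp_norm_eq[OF m(2)] by (simp only: pp[OF enn2real_nonneg])
  also have "\<dots> \<le> (d + d) powr (1 / p)" using 1 2 p by (intro powr_mono2 add_mono) auto
  also have "\<dots> < (e powr p) powr (1 / p)" using p e by (intro powr_less_mono2) (auto simp: d_def)
  also have "\<dots> = e" using p e by (simp add: powr_powr)
  finally show ?thesis using U(1) by blast
qed

lemma H_gradient_exists:
  assumes f: "f \<in> Lp p M" and g: "has_mu_gradient p w f g"
  shows "has_H_gradient p w f g"
proof -
  have gL: "g \<in> Lp p M" using g by (simp add: has_mu_gradient_def)
  have "\<forall>n. \<exists>U. U \<in> C0_infty \<and> pow_int p M (\<lambda>x. U x - f x) \<le> ennreal (inverse (real (Suc n))) \<and> pow_int p M (\<lambda>x. norm (grad U x - g x)) \<le> ennreal (inverse (real (Suc n)))"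
    using approximation[OF f g] unfolding Bex_def by simp
  from choice[OF this] obtain U where U: "\<And>n. U n \<in> C0_infty" "\<And>n. pow_int p M (\<lambda>x. U n x - f x) \<le> ennreal (inverse (real (Suc n)))"
    "\<And>n. pow_int p M (\<lambda>x. norm (grad (U n) x - g x)) \<le> ennreal (inverse (real (Suc n)))" by blast
  have z: "(\<lambda>n. ennreal (inverse (real (Suc n)))) \<longlonglongrightarrow> 0"
    using tendsto_ennrealI[OF LIMSEQ_inverse_real_of_nat] by simp
  have abs: "pow_int p M (\<lambda>x. \<bar>U n x - f x\<bar>) = pow_int p M (\<lambda>x. U n x - f x)" for n by (simp add: pow_int_def)
  have fin: "ennreal a < \<infinity>" for a by simp
  have "(\<lambda>x. U n x - f x) \<in> borel_measurable M" for n using Lp_diff[OF C0_Lp[OF U(1)] f] by (simp only: Lp_iff)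
  then have 1: "(\<lambda>n. Lp_norm p M (\<lambda>x. U n x - f x)) \<longlonglongrightarrow> 0"
    by (subst Lp_norm_tendsto_0_iff[OF p]) (auto simp: abs intro: tendsto_0_ennreal_le[OF z U(2)] le_less_trans[OF U(2) fin, unfolded infinity_ennreal_def])
  have "(\<lambda>x. grad (U n) x - g x) \<in> borel_measurable M" for n
    using grad_Lp[OF U(1), of n] gL by (simp only: Lp_iff borel_measurable_diff)
  then have 2: "(\<lambda>n. Lp_norm p M (\<lambda>x. grad (U n) x - g x)) \<longlonglongrightarrow> 0"
    by (subst Lp_norm_tendsto_0_iff[OF p]) (auto intro: tendsto_0_ennreal_le[OF z U(3)] le_less_trans[OF U(3) fin, unfolded infinity_ennreal_def])
  show ?thesis unfolding has_H_gradient_def using gL U(1) 1 2 by blast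
qed

lemma Lp_norm_limit:
  assumes U: "\<And>n. U n \<in> C0_infty" and u: "u \<in> Lp p M" and lim: "(\<lambda>n. Lp_norm p M (\<lambda>x. U n x - u x)) \<longlonglongrightarrow> 0"
  shows "(\<lambda>n. pow_int p M (\<lambda>x. U n x - u x)) \<longlonglongrightarrow> 0"
proof -
  have L: "(\<lambda>x. U n x - u x) \<in> Lp p M" for n by (rule Lp_diff[OF C0_Lp[OF U] u])
  have "(\<lambda>n. pow_int p M (\<lambda>x. norm (U n x - u x))) \<longlonglongrightarrow> 0"
    by (subst Lp_norm_tendsto_0_iff[OF p, symmetric]) (use L lim in \<open>simp_all only: Lp_iff\<close>)
  then show ?thesis by (simp add: pow_int_def)
qed

lemma H_gradient_is_mu_gradient:
  assumes u: "u \<in> Lp p M" and g: "has_H_gradient p w u g"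
  shows "has_mu_gradient p w u g"
proof -
  obtain U where gL: "g \<in> Lp p M" and U: "\<And>n. U n \<in> C0_infty"
    and lim: "(\<lambda>n. Lp_norm p M (\<lambda>x. U n x - u x)) \<longlonglongrightarrow> 0" "(\<lambda>n. Lp_norm p M (\<lambda>x. grad (U n) x - g x)) \<longlonglongrightarrow> 0"
    using g by (auto simp: has_H_gradient_def)
  have L: "(\<lambda>x. grad (U n) x - g x) \<in> Lp p M" for n
    using Lp_diff[of "\<lambda>x. grad (U n) x $ i" "\<lambda>x. g x $ i" for i] grad_Lp[OF U, of n] gL by (auto simp: Lp_vec_iff[OF p] Lp_real_iff)
  have n: "(\<lambda>n. pow_int p M (\<lambda>x. norm (grad (U n) x - g x))) \<longlonglongrightarrow> 0"
    by (subst Lp_norm_tendsto_0_iff[OF p, symmetric]) (use L lim in \<open>simp_all only: Lp_iff\<close>)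
  have comp: "pow_int p M (\<lambda>x. partial i (U n) x - g x $ i) \<le> pow_int p M (\<lambda>x. norm (grad (U n) x - g x))" for i n
    using pow_int_component[OF p, of M "\<lambda>x. grad (U n) x - g x" i] by (simp add: grad_def)
  have "(\<lambda>n. pow_int p M (\<lambda>x. partial i (U n) x - g x $ i)) \<longlonglongrightarrow> 0" for i
    by (rule tendsto_0_ennreal_le[OF n comp])
  then show ?thesis by (rule limit_mu_gradient[OF U u gL Lp_norm_limit[OF U u lim(1)]])
qed

lemma H_subset_V: "H1p p w \<subseteq> V1p p w"
proof
  fix u assume "u \<in> H1p p w"
  then obtain U where u: "u \<in> Lp p M" and U: "\<And>n. U n \<in> C0_infty" and lim: "(\<lambda>n. Lp_norm p M (\<lambda>x. U n x - u x)) \<longlonglongrightarrow> 0"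
    and C: "\<And>e. e > 0 \<Longrightarrow> \<exists>N. \<forall>m\<ge>N. \<forall>n\<ge>N. Lp_norm p M (\<lambda>x. grad (U m) x - grad (U n) x) < e"
    by (auto simp: H1p_def)
  have UL: "partial i (U n) \<in> borel_measurable M" "pow_int p M (partial i (U n)) < \<infinity>" for i n
    using C0_Lp[OF C0_infty_partial[OF U[of n]], of i] by (auto simp: Lp_real_iff)
  have "\<exists>H\<in>borel_measurable M. (\<lambda>n. pow_int p M (\<lambda>x. partial i (U n) x - H x)) \<longlonglongrightarrow> 0" for i
  proof (rule pow_int_complete[OF p UL(1)])
    fix e :: real assume e: "e > 0"
    obtain N where N: "\<And>m n. m \<ge> N \<Longrightarrow> n \<ge> N \<Longrightarrow> Lp_norm p M (\<lambda>x. grad (U m) x - grad (U n) x) < e powr (1 / p)" using C[of "e powr (1 / p)"] e by auto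
    show "\<exists>N. \<forall>m\<ge>N. \<forall>n\<ge>N. pow_int p M (\<lambda>x. partial i (U m) x - partial i (U n) x) \<le> ennreal e"
    proof (intro exI[of _ N] allI impI)
      fix m n assume mn: "m \<ge> N" "n \<ge> N"
      have L: "(\<lambda>x. grad (U m) x - grad (U n) x) \<in> Lp p M"
        using Lp_diff[of "\<lambda>x. grad (U m) x $ i" "\<lambda>x. grad (U n) x $ i" for i] grad_Lp[OF U, of n] grad_Lp[OF U, of m]
        by (auto simp: Lp_vec_iff[OF p] Lp_real_iff)
      have "pow_int p M (\<lambda>x. partial i (U m) x - partial i (U n) x) \<le> pow_int p M (\<lambda>x. norm (grad (U m) x - grad (U n) x))"
        using pow_int_component[OF p, of M "\<lambda>x. grad (U m) x - grad (U n) x" i] by (simp add: grad_def)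
      also have "\<dots> = ennreal (Lp_norm p M (\<lambda>x. grad (U m) x - grad (U n) x) powr p)"
        by (rule pow_int_le_Lp_norm[OF p]) (use L in \<open>simp_all only: Lp_iff\<close>)
      also have "\<dots> \<le> ennreal ((e powr (1 / p)) powr p)"
        using p N[OF mn] by (intro ennreal_leI powr_mono2) (auto simp: Lp_norm_def)
      also have "\<dots> = ennreal e" using p e by (simp add: powr_powr)
      finally show "pow_int p M (\<lambda>x. partial i (U m) x - partial i (U n) x) \<le> ennreal e" .
    qed
  qed
  then have "\<forall>i. \<exists>H. H \<in> borel_measurable M \<and> (\<lambda>n. pow_int p M (\<lambda>x. partial i (U n) x - H x)) \<longlonglongrightarrow> 0" by blast
  from choice[OF this] obtain g where g: "\<And>i. g i \<in> borel_measurable M" "\<And>i. (\<lambda>n. pow_int p M (\<lambda>x. partial i (U n) x - g i x)) \<longlonglongrightarrow> 0" by blast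
  have gfin: "pow_int p M (g i) < \<infinity>" for i
  proof -
    obtain n where n: "pow_int p M (\<lambda>x. partial i (U n) x - g i x) < ennreal 1"
      using tendsto_0_ennrealD[OF g(2), of 1 i] by (auto simp: eventually_sequentially)
    have "pow_int p M (\<lambda>x. partial i (U n) x - (partial i (U n) x - g i x)) < \<infinity>"
      using UL g(1) less_trans[OF n ennreal_less_top] by - (rule pow_int_diff_finite[OF p], auto)
    then show ?thesis by simp
  qed
  define G where "G x = (\<chi> i. g i x)" for x
  have "G \<in> Lp p M" using g(1) gfin by (simp add: Lp_vec_iff[OF p] G_def)
  then have "has_mu_gradient p w u G"
    by (rule limit_mu_gradient[OF U u _ Lp_norm_limit[OF U u lim]]) (use g(2) in \<open>simp add: G_def\<close>)
  then show "u \<in> V1p p w" using u by (auto simp: V1p_def)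
qed

lemma V_subset_H: "V1p p w \<subseteq> H1p p w"
proof
  fix f assume f: "f \<in> V1p p w"
  then have fL: "f \<in> Lp p M" by (simp add: V1p_def)
  define g where "g = mu_gradient p w f"
  have "has_H_gradient p w f g" unfolding g_def by (rule H_gradient_exists[OF fL has_mu_gradient_mu_gradient[OF f]])
  then obtain U where gL: "g \<in> Lp p M" and U: "\<And>n. U n \<in> C0_infty"
    and lim: "(\<lambda>n. Lp_norm p M (\<lambda>x. U n x - f x)) \<longlonglongrightarrow> 0" "(\<lambda>n. Lp_norm p M (\<lambda>x. grad (U n) x - g x)) \<longlonglongrightarrow> 0"
    by (auto simp: has_H_gradient_def)
  have m: "(\<lambda>x. norm (grad (U n) x - g x)) \<in> borel_measurable M" for n
    using grad_Lp[OF U, of n] gL by (auto simp: Lp_iff)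
  have L: "(\<lambda>x. grad (U n) x - g x) \<in> Lp p M" for n
    using Lp_diff[of "\<lambda>x. grad (U n) x $ i" "\<lambda>x. g x $ i" for i] grad_Lp[OF U, of n] gL by (auto simp: Lp_vec_iff[OF p] Lp_real_iff)
  have n0: "(\<lambda>n. pow_int p M (\<lambda>x. norm (grad (U n) x - g x))) \<longlonglongrightarrow> 0"
    by (subst Lp_norm_tendsto_0_iff[OF p, symmetric]) (use L lim in \<open>simp_all only: Lp_iff\<close>)
  have "\<exists>N. \<forall>m\<ge>N. \<forall>n\<ge>N. Lp_norm p M (\<lambda>x. grad (U m) x - grad (U n) x) < e" if e: "e > 0" for e
  proof -
    define d where "d = (e / 2) powr p / (2 powr p * 2)"
    have d: "d > 0" using e by (simp add: d_def)
    obtain N where N: "\<And>n. n \<ge> N \<Longrightarrow> pow_int p M (\<lambda>x. norm (grad (U n) x - g x)) < ennreal d"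
      using tendsto_0_ennrealD[OF n0 d] by (auto simp: eventually_sequentially)
    have "Lp_norm p M (\<lambda>x. grad (U m) x - grad (U n) x) < e" if mn: "m \<ge> N" "n \<ge> N" for m n
    proof -
      have "pow_int p M (\<lambda>x. norm (grad (U m) x - grad (U n) x)) \<le> pow_int p M (\<lambda>x. norm (grad (U m) x - g x) + norm (grad (U n) x - g x))"
        using norm_triangle_ineq4[of "grad (U m) x - g x" "grad (U n) x - g x" for x]
        by (intro pow_int_mono_AE[OF p] AE_I2) simp
      also have "\<dots> \<le> ennreal (2 powr p) * (pow_int p M (\<lambda>x. norm (grad (U m) x - g x)) + pow_int p M (\<lambda>x. norm (grad (U n) x - g x)))"
        by (rule pow_int_add[OF p m m])
      also have "\<dots> \<le> ennreal (2 powr p) * (ennreal d + ennreal d)"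
        using N[OF mn(1)] N[OF mn(2)] by (intro mult_left_mono add_mono) auto
      also have "\<dots> = ennreal ((e / 2) powr p)"
        using d by (simp add: ennreal_plus[symmetric] ennreal_mult[symmetric] d_def del: ennreal_plus)
      finally have "Lp_norm p M (\<lambda>x. grad (U m) x - grad (U n) x) \<le> e / 2"
        using e grad_Lp[OF U, of n] grad_Lp[OF U, of m] by (intro Lp_norm_le[OF p]) (auto simp: Lp_iff)
      then show ?thesis using e by simp
    qed
    then show ?thesis by blast
  qed
  then show "f \<in> H1p p w" unfolding H1p_def using fL U lim(1) by blast
qed

lemma H_gradient_eq_mu_gradient:
  assumes f: "f \<in> V1p p w" shows "AE x in M. H_gradient p w f x = mu_gradient p w f x"
proof -
  have fL: "f \<in> Lp p M" using f by (simp add: V1p_def)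
  note g = has_mu_gradient_mu_gradient[OF f]
  have "has_H_gradient p w f (H_gradient p w f)"
    unfolding H_gradient_def by (rule someI[of "has_H_gradient p w f", OF H_gradient_exists[OF fL g]])
  then show ?thesis by (intro mu_gradient_unique[OF fL H_gradient_is_mu_gradient[OF fL] g])
qed

end

theorem theorem1p1:
  fixes p :: real and w :: "real ^ 'n::finite \<Rightarrow> real"
  assumes "1 \<le> p"
    and "weight w"
    and "Diff_cond p w"
    and "p = 1 \<Longrightarrow> weak_gradient (phi p w) \<in> Linfty_loc lebesgue"
  shows "C0_infty \<subseteq> V1p p w \<and>
         (\<forall>f\<in>V1p p w. \<forall>e>0. \<exists>\<eta>\<in>C0_infty. V_norm p w (\<lambda>x. f x - \<eta> x) < e) \<and>
         H1p p w = V1p p w \<and>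
         (\<forall>f\<in>V1p p w. AE x in mu w. H_gradient p w f x = mu_gradient p w f x)"
proof -
  have m: "phi p w \<in> borel_measurable lebesgue" "weak_gradient (phi p w) \<in> borel_measurable lebesgue"
    using assms(3) by (auto simp: Diff_cond_def W1p_loc_def Lp_loc_def)
  obtain \<phi> where \<phi>: "\<phi> \<in> borel_measurable borel" "AE x in lborel. phi p w x = \<phi> x" using borel_representative[OF m(1)] .
  have "\<exists>u. u \<in> borel_measurable borel \<and> (AE x in lborel. weak_gradient (phi p w) x $ i = u x)" for i
    using borel_representative[of "\<lambda>x. weak_gradient (phi p w) x $ i"] m(2) by (auto simp: borel_measurable_vec_iff[of "weak_gradient _"])
  then obtain D where D: "\<And>i. D i \<in> borel_measurable borel" "\<And>i. AE x in lborel. weak_gradient (phi p w) x $ i = D i x" by metis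
  interpret diff_weight p w "\<lambda>x. \<bar>\<phi> x\<bar>" D
  proof
    show "AE x in lborel. phi p w x = \<bar>\<phi> x\<bar>"
      using \<phi>(2)
    proof eventually_elim
      fix x assume "phi p w x = \<phi> x"
      moreover have "phi p w x \<ge> 0" by (simp add: phi_def)
      ultimately show "phi p w x = \<bar>\<phi> x\<bar>" by simp
    qed
  qed (use assms \<phi> D in auto)
  show ?thesis
    using C0_subset_V C0_dense_V H_subset_V V_subset_H H_gradient_eq_mu_gradient by blast
qed

end
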